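(* Let $D$ be a division ring, and let $G$ be an ascendant subgroup of the multiplicative group $D^*$. If $G$ is periodic-by-(generalized radical), then $G$ is central, i.e. $G$ is contained in the center of $D$.
   Context: $D^*=D\setminus\{0\}$. A subgroup $H$ of a group $X$ is ascendant in $X$ if there is an ordinal $\gamma$ and a family of subgroups $(H_\alpha)_{\alpha\le\gamma}$ with $H_0=H$, $H_\gamma=X$, $H_\alpha\trianglelefteq H_{\alpha+1}$ for all $\alpha<\gamma$, and $H_\lambda=\bigcup_{\alpha<\lambda}H_\alpha$ for every limit ordinal $\lambda\le\gamma$. A group is generalized radical if it has an ascending (possibly transfinite) normal series, starting at $1$ and ending at the group (with unions at limit ordinals), each of whose factors is locally nilpotent or locally finite. A group is periodic if each of its elements has finite order. $G$ is periodic-by-(generalized radical) if it has a periodic normal subgroup $N$ such that $G/N$ is generalized radical. *)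

theory Defs
  imports "HOL-Algebra.Ring" "HOL-Algebra.Generated_Groups"
begin

section \<open>Division rings\<close>

locale skew_field = ring +
  assumes one_not_zero: "\<one> \<noteq> \<zero>"
    and Units_eq: "Units R = carrier R - {\<zero>}"

definition ring_center :: "('a, 'b) ring_scheme \<Rightarrow> 'a set" where
  "ring_center R = {z \<in> carrier R. \<forall>x\<in>carrier R. z \<otimes>\<^bsub>R\<^esub> x = x \<otimes>\<^bsub>R\<^esub> z}"

section \<open>Classes of groups\<close>

definition periodic_group :: "('a, 'b) monoid_scheme \<Rightarrow> bool" where
  "periodic_group G \<longleftrightarrow>
     group G \<and> (\<forall>x\<in>carrier G. \<exists>n::nat. n > 0 \<and> x [^]\<^bsub>G\<^esub> n = \<one>\<^bsub>G\<^esub>)"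

primrec lower_central_series :: "('a, 'b) monoid_scheme \<Rightarrow> nat \<Rightarrow> 'a set" where
  "lower_central_series G 0 = carrier G"
| "lower_central_series G (Suc n) =
     generate G {x \<otimes>\<^bsub>G\<^esub> y \<otimes>\<^bsub>G\<^esub> inv\<^bsub>G\<^esub> x \<otimes>\<^bsub>G\<^esub> inv\<^bsub>G\<^esub> y | x y.
                   x \<in> lower_central_series G n \<and> y \<in> carrier G}"

definition nilpotent_group :: "('a, 'b) monoid_scheme \<Rightarrow> bool" where
  "nilpotent_group G \<longleftrightarrow> group G \<and> (\<exists>n. lower_central_series G n = {\<one>\<^bsub>G\<^esub>})"

definition locally_nilpotent_group :: "('a, 'b) monoid_scheme \<Rightarrow> bool" where
  "locally_nilpotent_group G \<longleftrightarrow> group G \<and>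
     (\<forall>S. finite S \<and> S \<subseteq> carrier G \<longrightarrow> nilpotent_group (subgroup_generated G S))"

definition locally_finite_group :: "('a, 'b) monoid_scheme \<Rightarrow> bool" where
  "locally_finite_group G \<longleftrightarrow> group G \<and>
     (\<forall>S. finite S \<and> S \<subseteq> carrier G \<longrightarrow> finite (carrier (subgroup_generated G S)))"

section \<open>Transfinite ascending series\<close>

definition immediate_succ :: "'i rel \<Rightarrow> 'i \<Rightarrow> 'i \<Rightarrow> bool" where
  "immediate_succ r \<alpha> \<beta> \<longleftrightarrow>
     \<alpha> \<in> underS r \<beta> \<and> \<not> (\<exists>\<delta>. \<alpha> \<in> underS r \<delta> \<and> \<delta> \<in> underS r \<beta>)"

definition limit_point :: "'i rel \<Rightarrow> 'i \<Rightarrow> bool" where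
  "limit_point r \<kappa> \<longleftrightarrow>
     \<kappa> \<in> Field r \<and> underS r \<kappa> \<noteq> {} \<and> \<not> (\<exists>\<alpha>. immediate_succ r \<alpha> \<kappa>)"

text \<open>
  The ordinals \<open>\<alpha> \<le> \<gamma>\<close> indexing a series are represented by the field of a (reflexive)
  well-order \<open>r\<close> with greatest element \<open>\<gamma>\<close>; the least element of \<open>r\<close> plays the role of 0.
\<close>

definition ascending_series ::
  "'i rel \<Rightarrow> ('i \<Rightarrow> 'a set) \<Rightarrow> 'a set \<Rightarrow> ('a, 'b) monoid_scheme \<Rightarrow> bool" where
  "ascending_series r F H X \<longleftrightarrow>
     group X \<and> Well_order r \<and>
     (\<forall>\<alpha>\<in>Field r. subgroup (F \<alpha>) X) \<and>
     (\<exists>\<zeta>\<in>Field r. (\<forall>\<alpha>\<in>Field r. (\<zeta>, \<alpha>) \<in> r) \<and> F \<zeta> = H) \<and>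
     (\<exists>\<gamma>\<in>Field r. (\<forall>\<alpha>\<in>Field r. (\<alpha>, \<gamma>) \<in> r) \<and> F \<gamma> = carrier X) \<and>
     (\<forall>\<alpha> \<beta>. immediate_succ r \<alpha> \<beta> \<longrightarrow> F \<alpha> \<lhd> X\<lparr>carrier := F \<beta>\<rparr>) \<and>
     (\<forall>\<kappa>. limit_point r \<kappa> \<longrightarrow> F \<kappa> = (\<Union>\<alpha>\<in>underS r \<kappa>. F \<alpha>))"

text \<open>
  HOL cannot quantify over all ordinals inside a formula, so the type \<open>'i\<close> carrying the index
  ordinal is an explicit parameter. A theorem that assumes one of the following predicates for
  an arbitrary type \<open>'i\<close> covers series of every ordinal length.
\<close>

definition ascendant :: "'i itself \<Rightarrow> 'a set \<Rightarrow> ('a, 'b) monoid_scheme \<Rightarrow> bool" where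
  "ascendant I H X \<longleftrightarrow> (\<exists>(r :: 'i rel) F. ascending_series r F H X)"

text \<open>
  Each term of the series below is only required to be normal in its successor; series all of
  whose terms are normal in the whole group are a special case.
\<close>

definition generalized_radical :: "'i itself \<Rightarrow> ('a, 'b) monoid_scheme \<Rightarrow> bool" where
  "generalized_radical I G \<longleftrightarrow>
     (\<exists>(r :: 'i rel) F. ascending_series r F {\<one>\<^bsub>G\<^esub>} G \<and>
        (\<forall>\<alpha> \<beta>. immediate_succ r \<alpha> \<beta> \<longrightarrow>
           locally_nilpotent_group (G\<lparr>carrier := F \<beta>\<rparr> Mod F \<alpha>) \<or>
           locally_finite_group (G\<lparr>carrier := F \<beta>\<rparr> Mod F \<alpha>)))"

definition periodic_by_generalized_radical ::
  "'i itself \<Rightarrow> ('a, 'b) monoid_scheme \<Rightarrow> bool" where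
  "periodic_by_generalized_radical I G \<longleftrightarrow>
     (\<exists>N. N \<lhd> G \<and> periodic_group (G\<lparr>carrier := N\<rparr>) \<and> generalized_radical I (G Mod N))"

end

theory Submission
  imports
    Defs
    "HOL-Algebra.Multiplicative_Group"
    "HOL-Computational_Algebra.Polynomial"
    "HOL-Computational_Algebra.Primes"
begin

text \<open>
  By transfinite induction along the preimages in \<open>G\<close> of the generalized radical series, each of
  them is central; all of them are ascendant in the multiplicative group. The periodic bottom term
  is one case. If a term is locally nilpotent modulo central elements, then its elements are left
  Engel elements of the whole multiplicative group, because iterated commutators with an element of
  an ascendant subgroup descend into that subgroup. If it is locally finite modulo central elements,
  then its derived subgroup is periodic by Schur's theorem, hence central.

  Periodicity and commutativity pass from an ascendant subgroup to the normal closures of its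
  elements, so for abelian subgroups the Cartan-Brauer-Hua argument with \<open>1 + x\<close> applies. In the other
  cases a noncentral \<open>a\<close> leads to some \<open>y\<close> with \<open>a y a\<^sup>-\<^sup>1 = \<mu> y\<close>, where \<open>\<mu> \<noteq> 1\<close> has finite order, such
  that \<open>(1 + c y) (1 + c \<mu> y)\<^sup>-\<^sup>1\<close> has finite order for all integers \<open>c\<close>. In characteristic 0 this is
  impossible \<open>l\<close>-adically (take \<open>c = l\<close> for a large prime \<open>l\<close>); in characteristic \<open>p\<close> it makes \<open>y\<close>
  algebraic over the prime field, which contradicts Wedderburn's theorem.
\<close>

subsection \<open>Ascendant subgroups\<close>

text \<open>That commutativity passes to normal closures is not pure group theory: two abelian
  normal subgroups may generate a group of class 2. Each step therefore needs the result on Engel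
  elements, which has to be proved without the abelian case. That result starts from a commutator
  \<open>\<mu>\<close> of \<open>a\<close> and \<open>y\<close> commuting with both. Its finite
  order is not given; it is extracted from the Engel identity at \<open>1 + y\<close>, read as an
  equation between products of factors \<open>1 + \<mu>^j Y\<close>. The quotients \<open>w\<close>
  of \<open>1 + c y\<close> by \<open>1 + c \<mu> y\<close> matter because
  \<open>w V = V + c\<close> for a suitable \<open>V\<close>, so that finite order of
  \<open>w\<close> becomes \<open>(V + c)^k = V^k\<close>, an equation with integer coefficients.
  Already \<open>c = 1\<close> makes \<open>y^-1\<close> act on a finitely generated additive group,
  up to denominators. In general no commutative field contains both \<open>a\<close> and
  \<open>y\<close>, so algebraicity, integrality at a prime and finiteness are all measured by this
  action, with the integers as the only scalars.\<close>

definition comm_by :: "('a, 'b) monoid_scheme \<Rightarrow> 'a \<Rightarrow> 'a \<Rightarrow> 'a" where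
  "comm_by G a x = x \<otimes>\<^bsub>G\<^esub> a \<otimes>\<^bsub>G\<^esub> inv\<^bsub>G\<^esub> x \<otimes>\<^bsub>G\<^esub> inv\<^bsub>G\<^esub> a"

text \<open>The fixed element is the first argument of \<open>comm_by\<close>, so that the function
  power yields the iterated commutator [x, a, ..., a]. Its length may depend on
  \<open>x\<close>.\<close>

definition left_engel :: "('a, 'b) monoid_scheme \<Rightarrow> 'a \<Rightarrow> bool" where
  "left_engel G a \<longleftrightarrow> a \<in> carrier G \<and> (\<forall>x\<in>carrier G. \<exists>n. (comm_by G a ^^ n) x = \<one>\<^bsub>G\<^esub>)"

text \<open>A ring is also a monoid scheme, so \<open>torsion R\<close> means finite multiplicative
  order and can be stated before an element is known to be a unit.\<close>

definition torsion :: "('a, 'b) monoid_scheme \<Rightarrow> 'a \<Rightarrow> bool" where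
  "torsion G x \<longleftrightarrow> (\<exists>n::nat. n > 0 \<and> x [^]\<^bsub>G\<^esub> n = \<one>\<^bsub>G\<^esub>)"

text \<open>Normality relative to a set of conjugators inside one ambient group, so that groups with
  changed carriers do not occur along a series.\<close>

definition conj_closed :: "('a, 'b) monoid_scheme \<Rightarrow> 'a set \<Rightarrow> 'a set \<Rightarrow> bool" where
  "conj_closed G L K \<longleftrightarrow> (\<forall>g\<in>L. \<forall>k\<in>K. g \<otimes>\<^bsub>G\<^esub> k \<otimes>\<^bsub>G\<^esub> inv\<^bsub>G\<^esub> g \<in> K)"

definition nclosure :: "('a, 'b) monoid_scheme \<Rightarrow> 'a set \<Rightarrow> 'a \<Rightarrow> 'a set" where
  "nclosure G K a = generate G {k \<otimes>\<^bsub>G\<^esub> a \<otimes>\<^bsub>G\<^esub> inv\<^bsub>G\<^esub> k | k. k \<in> K}"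

text \<open>
  Weaker than being ascendant, since unions of arbitrary chains are allowed; this avoids ordinals
  and is all that the induction arguments need.
\<close>

inductive asc :: "('a, 'b) monoid_scheme \<Rightarrow> 'a set \<Rightarrow> 'a set \<Rightarrow> bool" for G H where
  refl: "subgroup H G \<Longrightarrow> asc G H H"
| step: "asc G H K \<Longrightarrow> subgroup L G \<Longrightarrow> K \<subseteq> L \<Longrightarrow> conj_closed G L K \<Longrightarrow> asc G H L"
| chain_Union: "\<C> \<noteq> {} \<Longrightarrow> (\<And>K. K \<in> \<C> \<Longrightarrow> asc G H K) \<Longrightarrow>
     (\<And>K L. K \<in> \<C> \<Longrightarrow> L \<in> \<C> \<Longrightarrow> K \<subseteq> L \<or> L \<subseteq> K) \<Longrightarrow> asc G H (\<Union>\<C>)"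

lemma (in monoid) pow_mod:
  assumes "x \<in> carrier G" "x [^] n = \<one>"
  shows "x [^] t = x [^] (t mod n::nat)"
proof -
  have "x [^] t = x [^] (n * (t div n)) \<otimes> x [^] (t mod n)" using assms(1) by (simp add: nat_pow_mult)
  also have "x [^] (n * (t div n)) = (x [^] n) [^] (t div n)" using assms(1) by (simp add: nat_pow_pow)
  finally show ?thesis using assms by simp
qed

context group
begin

lemma inv_cancel:
  "x \<in> carrier G \<Longrightarrow> y \<in> carrier G \<Longrightarrow> inv x \<otimes> (x \<otimes> y) = y"
  "x \<in> carrier G \<Longrightarrow> y \<in> carrier G \<Longrightarrow> x \<otimes> (inv x \<otimes> y) = y"
  by (simp_all flip: m_assoc)

lemmas word_simps = m_assoc inv_mult_group inv_cancel

lemma comm_by_closed [simp]: "a \<in> carrier G \<Longrightarrow> x \<in> carrier G \<Longrightarrow> comm_by G a x \<in> carrier G"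
  by (simp add: comm_by_def)

lemma comm_by_funpow_closed [simp]:
  "a \<in> carrier G \<Longrightarrow> x \<in> carrier G \<Longrightarrow> (comm_by G a ^^ n) x \<in> carrier G"
  by (induction n) auto

lemma comm_by_one_iff:
  assumes "a \<in> carrier G" "x \<in> carrier G"
  shows "comm_by G a x = \<one> \<longleftrightarrow> x \<otimes> a = a \<otimes> x"
proof -
  have "comm_by G a x = (x \<otimes> a) \<otimes> inv (a \<otimes> x)"
    using assms by (simp add: comm_by_def word_simps)
  moreover have "x \<otimes> a = comm_by G a x \<otimes> (a \<otimes> x)"
    using assms by (simp add: comm_by_def word_simps)
  ultimately show ?thesis using assms by auto
qed

lemma conj_nat_pow:
  assumes "g \<in> carrier G" "x \<in> carrier G"
  shows "(g \<otimes> x \<otimes> inv g) [^] (n::nat) = g \<otimes> x [^] n \<otimes> inv g"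
  using assms by (induction n) (auto simp: word_simps)

lemma torsion_conj:
  assumes "g \<in> carrier G" "x \<in> carrier G" "torsion G x"
  shows "torsion G (g \<otimes> x \<otimes> inv g)"
proof -
  obtain n :: nat where "n > 0" "x [^] n = \<one>" using assms(3) by (auto simp: torsion_def)
  then show ?thesis using assms by (auto simp: torsion_def conj_nat_pow intro!: exI[of _ n])
qed

lemma torsion_of_pow:
  assumes "x \<in> carrier G" "k > 0" "torsion G (x [^] (k::nat))"
  shows "torsion G x"
proof -
  obtain n :: nat where "n > 0" "(x [^] k) [^] n = \<one>" using assms(3) by (auto simp: torsion_def)
  then show ?thesis using assms(1,2) by (auto simp: torsion_def nat_pow_pow intro!: exI[of _ "k * n"])
qed

lemma asc_subgroup: "asc G H K \<Longrightarrow> subgroup K G \<and> H \<subseteq> K"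
proof (induction rule: asc.induct)
  case (chain_Union \<C>)
  then have sg: "K \<in> \<C> \<Longrightarrow> subgroup K G" "K \<in> \<C> \<Longrightarrow> H \<subseteq> K" for K by auto
  have "subgroup (\<Union>\<C>) G"
  proof (rule subgroupI)
    show "\<Union>\<C> \<subseteq> carrier G" using sg(1) subgroup.subset by blast
    show "\<Union>\<C> \<noteq> {}" using sg(1) \<open>\<C> \<noteq> {}\<close> subgroup.one_closed by blast
    show "inv a \<in> \<Union>\<C>" if "a \<in> \<Union>\<C>" for a
      using that subgroup.m_inv_closed[OF sg(1)] by auto
    show "a \<otimes> b \<in> \<Union>\<C>" if ab: "a \<in> \<Union>\<C>" "b \<in> \<Union>\<C>" for a b
    proof -
      obtain K L where KL: "K \<in> \<C>" "L \<in> \<C>" "a \<in> K" "b \<in> L" using ab by auto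
      then obtain M where "M \<in> \<C>" "a \<in> M" "b \<in> M" using chain_Union(3) by blast
      then show ?thesis using subgroup.m_closed[OF sg(1)] by blast
    qed
  qed
  then show ?case using sg(2) \<open>\<C> \<noteq> {}\<close> by blast
qed auto

lemma asc_subgroup_base: "asc G H K \<Longrightarrow> subgroup H G"
  by (induction rule: asc.induct) auto

lemma asc_trans: "asc G K L \<Longrightarrow> asc G H K \<Longrightarrow> asc G H L"
proof (induction rule: asc.induct)
  case (chain_Union \<C>)
  then show ?case by (intro asc.chain_Union) auto
qed (auto intro: asc.intros)

text \<open>Only a normal step costs a commutator: for \<open>x\<close> in \<open>L\<close> and
  \<open>h\<close> in \<open>K\<close> the conjugate of \<open>h\<close> by \<open>x\<close> lies in
  \<open>K\<close>, hence so does [x, h]. At a union \<open>x\<close> already lies in a member of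
  the chain, so finitely many commutators suffice for each \<open>x\<close>.\<close>

lemma comm_by_reaches_asc:
  assumes "asc G H K" "h \<in> H"
  shows "x \<in> K \<Longrightarrow> \<exists>n. (comm_by G h ^^ n) x \<in> H"
  using assms
proof (induction arbitrary: x rule: asc.induct)
  case refl
  then show ?case by (metis funpow_0)
next
  case (step K L)
  have h: "h \<in> K" using step.hyps(1) step.prems(2) asc_subgroup by blast
  have sK: "subgroup K G" using step.hyps(1) asc_subgroup by blast
  have "x \<otimes> h \<otimes> inv x \<in> K" using step h by (auto simp: conj_closed_def)
  then have "comm_by G h x \<in> K"
    unfolding comm_by_def using h sK by (simp add: subgroup.m_closed subgroup.m_inv_closed)
  then obtain n where "(comm_by G h ^^ n) (comm_by G h x) \<in> H" using step by blast
  then show ?case by (metis comp_apply funpow_Suc_right)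
qed auto

section \<open>Normal closures along an ascending series\<close>

lemma conj_closed_image:
  assumes "subgroup K G" "subgroup M G" "g \<in> carrier G" "M \<subseteq> K" "conj_closed G K M"
    and "\<And>k. k \<in> K \<Longrightarrow> inv g \<otimes> k \<otimes> g \<in> K"
  shows "conj_closed G K ((\<lambda>m. g \<otimes> m \<otimes> inv g) ` M)"
  unfolding conj_closed_def
proof (intro ballI)
  fix k m' assume k: "k \<in> K" "m' \<in> (\<lambda>m. g \<otimes> m \<otimes> inv g) ` M"
  then obtain m where m: "m \<in> M" "m' = g \<otimes> m \<otimes> inv g" by auto
  have [simp]: "k \<in> carrier G" "m \<in> carrier G" "g \<in> carrier G"
    using assms k m subgroup.subset by blast+
  let ?l = "inv g \<otimes> k \<otimes> g"
  have "?l \<otimes> m \<otimes> inv ?l \<in> M" using assms k m by (auto simp: conj_closed_def)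
  moreover have "k \<otimes> m' \<otimes> inv k = g \<otimes> (?l \<otimes> m \<otimes> inv ?l) \<otimes> inv g"
    by (simp add: m(2) word_simps)
  ultimately show "k \<otimes> m' \<otimes> inv k \<in> (\<lambda>m. g \<otimes> m \<otimes> inv g) ` M" by blast
qed

lemma subgroup_conj_image:
  assumes "subgroup M G" "g \<in> carrier G"
  shows "subgroup ((\<lambda>m. g \<otimes> m \<otimes> inv g) ` M) G"
proof (rule subgroupI)
  have c: "m \<in> M \<Longrightarrow> m \<in> carrier G" for m using assms subgroup.subset by blast
  show "(\<lambda>m. g \<otimes> m \<otimes> inv g) ` M \<subseteq> carrier G" using c assms by auto
  show "(\<lambda>m. g \<otimes> m \<otimes> inv g) ` M \<noteq> {}" using assms subgroup.one_closed by blast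
  fix a assume "a \<in> (\<lambda>m. g \<otimes> m \<otimes> inv g) ` M"
  then obtain m where m: "m \<in> M" "a = g \<otimes> m \<otimes> inv g" by auto
  have "inv a = g \<otimes> inv m \<otimes> inv g" using m c assms by (simp add: word_simps)
  then show "inv a \<in> (\<lambda>m. g \<otimes> m \<otimes> inv g) ` M"
    using subgroup.m_inv_closed[OF assms(1) m(1)] by blast
  fix b assume "b \<in> (\<lambda>m. g \<otimes> m \<otimes> inv g) ` M"
  then obtain l where l: "l \<in> M" "b = g \<otimes> l \<otimes> inv g" by auto
  have "a \<otimes> b = g \<otimes> (m \<otimes> l) \<otimes> inv g" using m l c assms by (simp add: word_simps)
  then show "a \<otimes> b \<in> (\<lambda>m. g \<otimes> m \<otimes> inv g) ` M"
    using subgroup.m_closed[OF assms(1) m(1) l(1)] by blast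
qed

lemma subgroup_nclosure: "K \<subseteq> carrier G \<Longrightarrow> a \<in> carrier G \<Longrightarrow> subgroup (nclosure G K a) G"
  unfolding nclosure_def by (rule generate_is_subgroup) auto

lemma conj_mem_nclosure: "k \<in> K \<Longrightarrow> k \<otimes> a \<otimes> inv k \<in> nclosure G K a"
  unfolding nclosure_def by (rule generate.incl) auto

lemma mem_nclosure: "subgroup K G \<Longrightarrow> a \<in> carrier G \<Longrightarrow> a \<in> nclosure G K a"
  using conj_mem_nclosure[of \<one> K a] by (simp add: subgroup.one_closed)

lemma nclosure_subset: "subgroup K G \<Longrightarrow> a \<in> K \<Longrightarrow> nclosure G K a \<subseteq> K"
  unfolding nclosure_def
  by (rule generate_subgroup_incl) (auto simp: subgroup.m_closed subgroup.m_inv_closed)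

lemma conj_closed_nclosure:
  assumes "subgroup K G" "a \<in> carrier G"
  shows "conj_closed G K (nclosure G K a)"
  unfolding conj_closed_def
proof (intro ballI)
  fix g x assume g: "g \<in> K" and "x \<in> nclosure G K a"
  have K: "K \<subseteq> carrier G" using assms subgroup.subset by blast
  then have gc: "g \<in> carrier G" using g by auto
  have sub: "{k \<otimes> a \<otimes> inv k |k. k \<in> K} \<subseteq> carrier G" using K assms(2) by auto
  have conj1: "g \<otimes> (k \<otimes> a \<otimes> inv k) \<otimes> inv g \<in> nclosure G K a" if "k \<in> K" for k
  proof -
    have "g \<otimes> (k \<otimes> a \<otimes> inv k) \<otimes> inv g = (g \<otimes> k) \<otimes> a \<otimes> inv (g \<otimes> k)"
      using gc subsetD[OF K that] assms(2) by (simp add: word_simps)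
    moreover have "g \<otimes> k \<in> K" using assms(1) g that by (rule subgroup.m_closed)
    ultimately show ?thesis using conj_mem_nclosure[of "g \<otimes> k" K a] by (simp only:)
  qed
  have sg: "subgroup (nclosure G K a) G" using subgroup_nclosure K assms(2) by auto
  from \<open>x \<in> nclosure G K a\<close>[unfolded nclosure_def] show "g \<otimes> x \<otimes> inv g \<in> nclosure G K a"
  proof (induction rule: generate.induct)
    case one
    then show ?case using gc sg by (simp add: subgroup.one_closed)
  next
    case (incl h)
    then show ?case using conj1 by auto
  next
    case (inv h)
    then obtain k where k: "k \<in> K" "h = k \<otimes> a \<otimes> inv k" by auto
    have "g \<otimes> inv h \<otimes> inv g = inv (g \<otimes> h \<otimes> inv g)"
      using gc k(2) subsetD[OF K k(1)] assms(2) by (simp add: word_simps)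
    then show ?case using subgroup.m_inv_closed[OF sg conj1[OF k(1)]] k(2) by (simp only:)
  next
    case (eng h1 h2)
    then have c: "h1 \<in> carrier G" "h2 \<in> carrier G" using generate_in_carrier[OF sub] by auto
    have "g \<otimes> (h1 \<otimes> h2) \<otimes> inv g = (g \<otimes> h1 \<otimes> inv g) \<otimes> (g \<otimes> h2 \<otimes> inv g)"
      using gc c by (simp add: word_simps)
    then show ?case using subgroup.m_closed[OF sg eng.IH] by (simp only:)
  qed
qed

text \<open>Computation modulo the normal subgroup \<open>M\<close> of \<open>K\<close>, phrased
  with elements. It serves to show that a product of two periodic normal subgroups is
  periodic.\<close>

lemma pow_mult_mem:
  assumes "subgroup M G" "subgroup K G" "M \<subseteq> K" "conj_closed G K M" "m \<in> M" "k \<in> K"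
  shows "\<exists>m'\<in>M. (m \<otimes> k) [^] (n::nat) = m' \<otimes> k [^] n"
proof (induction n)
  case 0
  then show ?case using assms subgroup.one_closed by force
next
  case (Suc n)
  then obtain m' where m': "m' \<in> M" "(m \<otimes> k) [^] n = m' \<otimes> k [^] n" by auto
  have [simp]: "m \<in> carrier G" "k \<in> carrier G" "m' \<in> carrier G"
    using assms m' subgroup.subset by blast+
  have kn: "k [^] n \<in> K" using assms(2,6) by (induction n) (auto simp: subgroup.m_closed subgroup.one_closed)
  have "(m \<otimes> k) [^] Suc n = (m' \<otimes> (k [^] n \<otimes> m \<otimes> inv (k [^] n))) \<otimes> k [^] Suc n"
    by (simp add: m' word_simps)
  moreover have "m' \<otimes> (k [^] n \<otimes> m \<otimes> inv (k [^] n)) \<in> M"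
    using assms(4)[unfolded conj_closed_def, rule_format, OF kn assms(5)] assms m'
    by (simp add: subgroup.m_closed)
  ultimately show ?case by blast
qed

text \<open>The normal closure in \<open>L\<close> is generated by the conjugates under
  \<open>L\<close> of the periodic group \<open>nclosure G K a\<close>. Each of them is a periodic
  normal subgroup of \<open>K\<close>, a product of two such subgroups is again one, and an element
  involves only finitely many.\<close>

lemma torsion_nclosure_step:
  assumes sK: "subgroup K G" and sL: "subgroup L G" and KL: "K \<subseteq> L" and cc: "conj_closed G L K"
    and a: "a \<in> K" and tor: "\<And>x. x \<in> nclosure G K a \<Longrightarrow> torsion G x"
    and x: "x \<in> nclosure G L a"
  shows "torsion G x"
proof -
  define \<N> where "\<N> = {M. subgroup M G \<and> M \<subseteq> K \<and> conj_closed G K M \<and> (\<forall>x\<in>M. torsion G x)}"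
  let ?N = "nclosure G K a"
  have K: "K \<subseteq> carrier G" and L: "L \<subseteq> carrier G" using sK sL subgroup.subset by auto
  have ac: "a \<in> carrier G" using a K by auto
  have sub: "{k \<otimes> a \<otimes> inv k |k. k \<in> L} \<subseteq> carrier G" using L ac by auto
  have gen: "\<exists>M\<in>\<N>. g \<otimes> a \<otimes> inv g \<in> M" if g: "g \<in> L" for g
  proof
    let ?M = "(\<lambda>m. g \<otimes> m \<otimes> inv g) ` ?N"
    have gc: "g \<in> carrier G" using g L by auto
    have NK: "?N \<subseteq> K" using nclosure_subset sK a by auto
    have sN: "subgroup ?N G" using subgroup_nclosure K ac by auto
    have inv: "inv g \<otimes> k \<otimes> g \<in> K" if "k \<in> K" for k
      using cc[unfolded conj_closed_def, rule_format, of "inv g" k] that g sL gc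
      by (simp add: subgroup.m_inv_closed)
    have "conj_closed G K ?M"
      using conj_closed_image[OF sK sN gc NK conj_closed_nclosure[OF sK ac]] inv by blast
    moreover have "?M \<subseteq> K" using cc g NK by (auto simp: conj_closed_def)
    moreover have "\<forall>x\<in>?M. torsion G x" using torsion_conj gc tor NK K by blast
    ultimately show "?M \<in> \<N>" using subgroup_conj_image[OF sN gc] by (simp add: \<N>_def)
    show "g \<otimes> a \<otimes> inv g \<in> ?M" using mem_nclosure[OF sK ac] by blast
  qed
  have "\<exists>M\<in>\<N>. x \<in> M" using x[unfolded nclosure_def]
  proof (induction rule: generate.induct)
    case one
    have "\<one> \<in> L" using sL subgroup.one_closed by blast
    from gen[OF this] obtain M where "M \<in> \<N>" by blast
    then show ?case by (auto simp: \<N>_def subgroup.one_closed intro!: bexI[of _ M])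
  next
    case (incl h)
    then show ?case using gen by auto
  next
    case (inv h)
    then obtain M where "M \<in> \<N>" "h \<in> M" using gen by auto
    then show ?case by (auto simp: \<N>_def intro!: bexI[of _ M] subgroup.m_inv_closed)
  next
    case (eng h1 h2)
    then obtain M1 M2 where M1: "M1 \<in> \<N>" "h1 \<in> M1" and M2: "M2 \<in> \<N>" "h2 \<in> M2" by blast
    let ?M = "M1 <#> M2"
    have c: "M1 \<subseteq> K" "M2 \<subseteq> K" "subgroup M1 G" "subgroup M2 G" "conj_closed G K M1" "conj_closed G K M2"
      "\<forall>x\<in>M1. torsion G x" "\<forall>x\<in>M2. torsion G x"
      using M1 M2 by (auto simp: \<N>_def)
    have cG: "m \<in> M1 \<Longrightarrow> m \<in> carrier G" "m \<in> M2 \<Longrightarrow> m \<in> carrier G" for m using c K by auto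
    have "subgroup ?M G"
    proof (rule subgroupI)
      show "?M \<subseteq> carrier G" using cG by (auto simp: set_mult_def)
      show "?M \<noteq> {}" using M1(2) M2(2) by (auto simp: set_mult_def)
      fix u assume "u \<in> ?M"
      then obtain m n where mn: "m \<in> M1" "n \<in> M2" "u = m \<otimes> n" by (auto simp: set_mult_def)
      have "inv u = (inv n \<otimes> inv m \<otimes> inv (inv n)) \<otimes> inv n" using mn cG by (simp add: word_simps)
      moreover have "inv n \<in> K" "inv m \<in> M1" "inv n \<in> M2"
        using mn c subgroup.m_inv_closed[OF sK] by (auto simp: subgroup.m_inv_closed)
      then have "inv n \<otimes> inv m \<otimes> inv (inv n) \<in> M1"
        using c(5) by (simp only: conj_closed_def)
      ultimately show "inv u \<in> ?M" using \<open>inv n \<in> M2\<close> unfolding set_mult_def by blast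
      fix v assume "v \<in> ?M"
      then obtain p q where pq: "p \<in> M1" "q \<in> M2" "v = p \<otimes> q" by (auto simp: set_mult_def)
      have "u \<otimes> v = (m \<otimes> (n \<otimes> p \<otimes> inv n)) \<otimes> (n \<otimes> q)" using mn pq cG by (simp add: word_simps)
      moreover have "n \<otimes> p \<otimes> inv n \<in> M1"
        using c(5)[unfolded conj_closed_def, rule_format, of n p] mn pq c by auto
      moreover have "m \<otimes> (n \<otimes> p \<otimes> inv n) \<in> M1" "n \<otimes> q \<in> M2"
        using subgroup.m_closed[OF c(3) mn(1) calculation(2)] subgroup.m_closed[OF c(4) mn(2) pq(2)] by auto
      ultimately show "u \<otimes> v \<in> ?M" unfolding set_mult_def by blast
    qed
    moreover have "?M \<subseteq> K" using c subgroup.m_closed[OF sK] unfolding set_mult_def by blast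
    moreover have "conj_closed G K ?M"
      unfolding conj_closed_def
    proof (intro ballI)
      fix g u assume g: "g \<in> K" and "u \<in> ?M"
      then obtain m n where mn: "m \<in> M1" "n \<in> M2" "u = m \<otimes> n" by (auto simp: set_mult_def)
      have "g \<otimes> u \<otimes> inv g = (g \<otimes> m \<otimes> inv g) \<otimes> (g \<otimes> n \<otimes> inv g)"
        using mn cG subsetD[OF K g] by (simp add: word_simps)
      moreover have "g \<otimes> m \<otimes> inv g \<in> M1" "g \<otimes> n \<otimes> inv g \<in> M2"
        using c(5,6) g mn by (auto simp: conj_closed_def)
      ultimately show "g \<otimes> u \<otimes> inv g \<in> ?M" unfolding set_mult_def by blast
    qed
    moreover have "\<forall>u\<in>?M. torsion G u"
    proof
      fix u assume "u \<in> ?M"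
      then obtain m n where mn: "m \<in> M1" "n \<in> M2" "u = m \<otimes> n" by (auto simp: set_mult_def)
      \<comment> \<open>The order of \<open>n\<close> as exponent removes the \<open>M2\<close> part
        and leaves an element of the periodic group \<open>M1\<close>.\<close>
      obtain k :: nat where k: "k > 0" "n [^] k = \<one>" using c(8) mn by (auto simp: torsion_def)
      have nK: "n \<in> K" using mn c by auto
      obtain m' where "m' \<in> M1" "u [^] k = m'"
        using pow_mult_mem[OF c(3) sK c(1) c(5) mn(1) nK, of k] k mn cG by auto
      then have "torsion G (u [^] k)" using c(7) by auto
      then show "torsion G u" using torsion_of_pow k(1) mn cG by auto
    qed
    ultimately have "?M \<in> \<N>" by (auto simp: \<N>_def)
    moreover have "h1 \<otimes> h2 \<in> ?M" using M1(2) M2(2) by (auto simp: set_mult_def)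
    ultimately show ?case by blast
  qed
  then show ?thesis by (auto simp: \<N>_def)
qed

text \<open>At a union, an element of the normal closure involves finitely many conjugators, and one
  member of the chain contains them all.\<close>

lemma asc_torsion_nclosure:
  assumes "asc G H K" "a \<in> H" "\<And>x. x \<in> H \<Longrightarrow> torsion G x"
  shows "x \<in> nclosure G K a \<Longrightarrow> torsion G x"
  using assms
proof (induction arbitrary: x rule: asc.induct)
  case refl
  then show ?case using nclosure_subset by blast
next
  case (step K L)
  have "a \<in> K" "subgroup K G" using step.hyps(1) step.prems(2) asc_subgroup by blast+
  then show ?case using torsion_nclosure_step[of K L a x] step by blast
next
  case (chain_Union \<C>)
  have "\<exists>K\<in>\<C>. x \<in> nclosure G K a" using chain_Union.prems(1)[unfolded nclosure_def]
  proof (induction rule: generate.induct)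
    case one
    then show ?case using chain_Union(1) by (auto simp: nclosure_def generate.one)
  next
    case (incl h)
    then show ?case by (auto simp: nclosure_def intro!: generate.incl)
  next
    case (inv h)
    then show ?case by (auto simp: nclosure_def intro!: generate.inv)
  next
    case (eng h1 h2)
    then obtain K1 K2 where K: "K1 \<in> \<C>" "K2 \<in> \<C>" "h1 \<in> nclosure G K1 a" "h2 \<in> nclosure G K2 a" by auto
    have mono: "nclosure G K a \<subseteq> nclosure G L a" if "K \<subseteq> L" for K L
      unfolding nclosure_def by (rule mono_generate) (use that in auto)
    obtain K where "K \<in> \<C>" "h1 \<in> nclosure G K a" "h2 \<in> nclosure G K a"
      using K chain_Union.hyps(3)[OF K(1,2)] mono by blast
    then show ?case by (auto simp: nclosure_def intro!: generate.eng)
  qed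
  then show ?case using chain_Union by blast
qed

lemma commutes_generate:
  assumes "c \<in> carrier G" "S \<subseteq> carrier G" "\<And>s. s \<in> S \<Longrightarrow> c \<otimes> s = s \<otimes> c" "x \<in> generate G S"
  shows "c \<otimes> x = x \<otimes> c"
  using assms(4)
proof (induction rule: generate.induct)
  case (inv h)
  then have h: "h \<in> carrier G" "c \<otimes> h = h \<otimes> c" using assms by auto
  have "c \<otimes> inv h = inv h \<otimes> (h \<otimes> c) \<otimes> inv h" using h(1) assms(1) by (simp add: word_simps)
  also have "\<dots> = inv h \<otimes> c" using h assms(1) by (simp add: word_simps flip: h(2))
  finally show ?case .
next
  case (eng h1 h2)
  have "h1 \<in> carrier G" "h2 \<in> carrier G" using eng generate_in_carrier[OF assms(2)] by auto
  then show ?case using eng assms(1) by (metis m_assoc)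
qed (use assms in auto)

text \<open>
  The normal closure of \<open>a\<close> stays abelian along the series: for \<open>g\<close> in the next term it and its
  conjugate by \<open>g\<close> are abelian normal subgroups, so \<open>a\<close> and its conjugate commute with their
  commutator.
\<close>

lemma asc_commutes_conj:
  assumes "asc G H K" "a \<in> H" "\<And>g h. g \<in> H \<Longrightarrow> h \<in> H \<Longrightarrow> g \<otimes> h = h \<otimes> g"
    and central: "\<And>b. b \<in> carrier G \<Longrightarrow> comm_by G b a \<otimes> a = a \<otimes> comm_by G b a \<Longrightarrow>
      comm_by G b a \<otimes> b = b \<otimes> comm_by G b a \<Longrightarrow> a \<otimes> b = b \<otimes> a"
  shows "g \<in> K \<Longrightarrow> a \<otimes> (g \<otimes> a \<otimes> inv g) = (g \<otimes> a \<otimes> inv g) \<otimes> a"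
  using assms
proof (induction arbitrary: g rule: asc.induct)
  case refl
  then show ?case by (simp add: subgroup.m_closed subgroup.m_inv_closed)
next
  case (step K L)
  have sK: "subgroup K G" and aK: "a \<in> K" using step.hyps(1) step.prems(2) asc_subgroup by blast+
  have K: "K \<subseteq> carrier G" and L: "L \<subseteq> carrier G" using sK step subgroup.subset by blast+
  have ac: "a \<in> carrier G" and gc: "g \<in> carrier G" using aK K L step by auto
  let ?A = "nclosure G K a"
  let ?S = "{k \<otimes> a \<otimes> inv k |k. k \<in> K}"
  have S: "?S \<subseteq> carrier G" using K ac by auto
  \<comment> \<open>Conjugation by \<open>k\<close> reduces two arbitrary conjugates to
    \<open>a\<close> and its conjugate by \<open>inv k \<otimes> l\<close>, where the induction
    hypothesis applies.\<close>
  have comm_gen: "(k \<otimes> a \<otimes> inv k) \<otimes> (l \<otimes> a \<otimes> inv l) = (l \<otimes> a \<otimes> inv l) \<otimes> (k \<otimes> a \<otimes> inv k)"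
    if kl: "k \<in> K" "l \<in> K" for k l
  proof -
    let ?m = "inv k \<otimes> l"
    have [simp]: "k \<in> carrier G" "l \<in> carrier G" "a \<in> carrier G" using kl K ac by auto
    have "?m \<in> K" using kl sK by (simp add: subgroup.m_closed subgroup.m_inv_closed)
    then have eq: "a \<otimes> (?m \<otimes> a \<otimes> inv ?m) = (?m \<otimes> a \<otimes> inv ?m) \<otimes> a"
      using step.IH step.prems by blast
    have "(k \<otimes> a \<otimes> inv k) \<otimes> (l \<otimes> a \<otimes> inv l) = k \<otimes> (a \<otimes> (?m \<otimes> a \<otimes> inv ?m)) \<otimes> inv k"
      by (simp add: word_simps)
    also have "\<dots> = k \<otimes> ((?m \<otimes> a \<otimes> inv ?m) \<otimes> a) \<otimes> inv k" using eq by simp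
    also have "\<dots> = (l \<otimes> a \<otimes> inv l) \<otimes> (k \<otimes> a \<otimes> inv k)" by (simp add: word_simps)
    finally show ?thesis .
  qed
  have abel: "u \<otimes> v = v \<otimes> u" if "u \<in> ?A" "v \<in> ?A" for u v
  proof -
    have "s \<otimes> v = v \<otimes> s" if "s \<in> ?S" for s
      by (rule commutes_generate[OF _ S _ \<open>v \<in> ?A\<close>[unfolded nclosure_def]]) (use that comm_gen S in auto)
    moreover have vc: "v \<in> carrier G" using \<open>v \<in> ?A\<close> subgroup_nclosure[OF K ac] subgroup.subset by blast
    ultimately have "v \<otimes> u = u \<otimes> v"
      by (intro commutes_generate[OF vc S _ \<open>u \<in> ?A\<close>[unfolded nclosure_def]]) simp
    then show ?thesis by simp
  qed
  have sA: "subgroup ?A G" using subgroup_nclosure K ac by auto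
  have ccA: "conj_closed G K ?A" using conj_closed_nclosure sK ac by auto
  have aA: "a \<in> ?A" using mem_nclosure sK ac by auto
  have AK: "?A \<subseteq> K" using nclosure_subset sK aK by auto
  let ?b = "g \<otimes> a \<otimes> inv g"
  let ?B = "(\<lambda>m. g \<otimes> m \<otimes> inv g) ` ?A"
  have bK: "?b \<in> K" using step aK by (auto simp: conj_closed_def)
  then have bc: "?b \<in> carrier G" using K by auto
  have inv: "inv g \<otimes> k \<otimes> g \<in> K" if "k \<in> K" for k
    using step(4)[unfolded conj_closed_def, rule_format, of "inv g" k] that step gc
    by (simp add: subgroup.m_inv_closed)
  have ccB: "conj_closed G K ?B" using conj_closed_image[OF sK sA gc AK ccA inv] .
  have sB: "subgroup ?B G" using subgroup_conj_image[OF sA gc] .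
  have abelB: "u \<otimes> v = v \<otimes> u" if uv: "u \<in> ?B" "v \<in> ?B" for u v
  proof -
    obtain u' v' where u: "u' \<in> ?A" "u = g \<otimes> u' \<otimes> inv g" "v' \<in> ?A" "v = g \<otimes> v' \<otimes> inv g"
      using uv by auto
    then have [simp]: "u' \<in> carrier G" "v' \<in> carrier G" "g \<in> carrier G" using AK K gc by auto
    have "u \<otimes> v = g \<otimes> (u' \<otimes> v') \<otimes> inv g" by (simp add: u word_simps)
    also have "\<dots> = g \<otimes> (v' \<otimes> u') \<otimes> inv g" using abel u by simp
    also have "\<dots> = v \<otimes> u" by (simp add: u word_simps)
    finally show ?thesis .
  qed
  have bB: "?b \<in> ?B" using aA by blast
  \<comment> \<open>The commutator lies in both abelian groups: it is \<open>a\<close> times a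
    conjugate of \<open>inv a\<close>, and also a conjugate of \<open>?b\<close> times
    \<open>inv ?b\<close>.\<close>
  let ?z = "comm_by G ?b a"
  have "?z = a \<otimes> (?b \<otimes> inv a \<otimes> inv ?b)" unfolding comm_by_def using ac bc by (simp add: m_assoc del: inv_mult_group)
  moreover have "?b \<otimes> inv a \<otimes> inv ?b \<in> ?A"
    using ccA[unfolded conj_closed_def, rule_format, OF bK, of "inv a"] sA aA
    by (simp add: subgroup.m_inv_closed)
  ultimately have zA: "?z \<in> ?A" using sA aA by (simp add: subgroup.m_closed)
  have "a \<otimes> ?b \<otimes> inv a \<in> ?B"
    using ccB[unfolded conj_closed_def, rule_format, OF aK bB] .
  then have zB: "?z \<in> ?B" unfolding comm_by_def using sB bB by (simp add: subgroup.m_closed subgroup.m_inv_closed)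
  \<comment> \<open>\<open>?z\<close> commutes with \<open>a\<close> inside \<open>?A\<close> and
    with \<open>?b\<close> inside \<open>?B\<close>, so the assumption \<open>central\<close>
    applies. For the units of a skew field it is \<open>engel_commutator_commutes\<close>.\<close>
  show ?case using step.prems(4)[OF bc] abel[OF zA aA] abelB[OF zB bB] by blast
qed auto

end

section \<open>Well-ordered series and the relation \<open>asc\<close>\<close>

context group
begin

text \<open>Induction on the upper index for all lower indices at once. Inclusion between distant
  terms is not part of the definition of a series; it comes out with \<open>asc\<close>, and it is
  what makes the terms below a limit a chain.\<close>

lemma ascending_series_asc:
  assumes "ascending_series r F H G" "(\<alpha>, \<beta>) \<in> r"
  shows "asc G (F \<alpha>) (F \<beta>)"
proof -
  have wo: "Well_order r" and sg: "\<And>\<alpha>. \<alpha> \<in> Field r \<Longrightarrow> subgroup (F \<alpha>) G"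
    and nrm: "\<And>\<alpha> \<beta>. immediate_succ r \<alpha> \<beta> \<Longrightarrow> F \<alpha> \<lhd> G\<lparr>carrier := F \<beta>\<rparr>"
    and lim: "\<And>\<kappa>. limit_point r \<kappa> \<Longrightarrow> F \<kappa> = (\<Union>\<alpha>\<in>underS r \<kappa>. F \<alpha>)"
    using assms(1) by (auto simp: ascending_series_def)
  interpret r: wo_rel r using wo by (simp add: wo_rel.intro)
  show ?thesis using assms(2)
  proof (induction \<beta> arbitrary: \<alpha> rule: r.well_order_induct)
    case (1 \<beta>)
    have IH: "asc G (F \<alpha>) (F \<delta>)" if "\<delta> \<in> underS r \<beta>" "(\<alpha>, \<delta>) \<in> r" for \<alpha> \<delta>
      using 1(1) that by (auto simp: underS_def)
    have \<beta>: "\<beta> \<in> Field r" and \<alpha>: "\<alpha> \<in> Field r" using 1(2) by (auto simp: Field_def)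
    show ?case
    proof (cases "\<alpha> = \<beta>")
      case True
      then show ?thesis using sg \<beta> by (simp add: asc.refl)
    next
      case ne: False
      then have \<alpha>u: "\<alpha> \<in> underS r \<beta>" using 1(2) by (auto simp: underS_def)
      show ?thesis
      proof (cases "\<exists>\<delta>. immediate_succ r \<delta> \<beta>")
        case True
        then obtain \<delta> where \<delta>: "immediate_succ r \<delta> \<beta>" by auto
        then have \<delta>u: "\<delta> \<in> underS r \<beta>" and "\<not> (\<delta> \<in> underS r \<alpha>)"
          using \<alpha>u by (auto simp: immediate_succ_def)
        moreover have "\<delta> \<in> Field r" using \<delta>u underS_Field by fastforce
        ultimately have "(\<alpha>, \<delta>) \<in> r" using \<alpha> r.TOTALS r.REFL
          by (metis (mono_tags, lifting) mem_Collect_eq underS_def)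
        then have "asc G (F \<alpha>) (F \<delta>)" using IH \<delta>u by blast
        moreover have s\<beta>: "subgroup (F \<beta>) G" using sg \<beta> .
        note N = nrm[OF \<delta>]
        note s\<beta>
        moreover have "F \<delta> \<subseteq> F \<beta>"
          using subgroup.subset[OF normal_imp_subgroup[OF N]] by simp
        moreover have "conj_closed G (F \<beta>) (F \<delta>)"
          using normal.inv_op_closed2[OF N] s\<beta> by (simp add: conj_closed_def m_inv_consistent)
        ultimately show ?thesis by (rule asc.step[of G "F \<alpha>" "F \<delta>"])
      next
        case False
        then have "limit_point r \<beta>" using \<alpha>u \<beta> by (auto simp: limit_point_def)
        then have F\<beta>: "F \<beta> = (\<Union>\<delta>\<in>underS r \<beta>. F \<delta>)" by (rule lim)
        \<comment> \<open>Only the terms from \<open>\<alpha>\<close> on lie above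
          \<open>F \<alpha>\<close>; dropping the earlier ones does not change the union.\<close>
        let ?C = "F ` {\<delta> \<in> underS r \<beta>. (\<alpha>, \<delta>) \<in> r}"
        have mono: "F \<delta> \<subseteq> F \<epsilon>" if "\<epsilon> \<in> underS r \<beta>" "(\<delta>, \<epsilon>) \<in> r" for \<delta> \<epsilon>
          using IH[OF that] asc_subgroup by blast
        have tot: "(\<delta>, \<epsilon>) \<in> r \<or> (\<epsilon>, \<delta>) \<in> r" if "\<epsilon> \<in> underS r \<beta>" "\<delta> \<in> underS r \<beta>" for \<delta> \<epsilon>
          using that r.TOTALS underS_Field by fastforce
        have "(\<alpha>, \<alpha>) \<in> r" using tot \<alpha>u by blast
        then have "F \<beta> = \<Union>?C" unfolding F\<beta> using mono tot \<alpha>u by blast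
        moreover have "asc G (F \<alpha>) (\<Union>?C)"
        proof (rule asc.chain_Union)
          show "?C \<noteq> {}" using \<open>(\<alpha>, \<alpha>) \<in> r\<close> \<alpha>u by blast
          show "asc G (F \<alpha>) K" if "K \<in> ?C" for K using that IH by blast
          show "K \<subseteq> L \<or> L \<subseteq> K" if KL: "K \<in> ?C" "L \<in> ?C" for K L
          proof -
            obtain \<delta> \<epsilon> where "\<delta> \<in> underS r \<beta>" "K = F \<delta>" "\<epsilon> \<in> underS r \<beta>" "L = F \<epsilon>"
              using KL by auto
            then show ?thesis using mono[of \<epsilon> \<delta>] mono[of \<delta> \<epsilon>] tot[of \<epsilon> \<delta>] by auto
          qed
        qed
        ultimately show ?thesis by simp
      qed
    qed
  qed
qed

text \<open>In the intended use \<open>P\<close> says that a preimage is central, a property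
  inherited by arbitrary unions; this is why \<open>lim\<close> does not speak of chains.\<close>

lemma ascending_series_induct:
  assumes ser: "ascending_series r F H G"
    and base: "P H"
    and step: "\<And>\<alpha> \<beta>. immediate_succ r \<alpha> \<beta> \<Longrightarrow> \<beta> \<in> Field r \<Longrightarrow> P (F \<alpha>) \<Longrightarrow> P (F \<beta>)"
    and lim: "\<And>\<C>. (\<And>K. K \<in> \<C> \<Longrightarrow> P K) \<Longrightarrow> P (\<Union>\<C>)"
  shows "P (carrier G)"
proof -
  have wo: "Well_order r"
    and Fl: "\<And>\<kappa>. limit_point r \<kappa> \<Longrightarrow> F \<kappa> = (\<Union>\<alpha>\<in>underS r \<kappa>. F \<alpha>)"
    using ser by (auto simp: ascending_series_def)
  obtain \<zeta> where \<zeta>: "\<zeta> \<in> Field r" "\<And>\<alpha>. \<alpha> \<in> Field r \<Longrightarrow> (\<zeta>, \<alpha>) \<in> r" "F \<zeta> = H"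
    using ser by (auto simp: ascending_series_def)
  obtain \<gamma> where \<gamma>: "\<gamma> \<in> Field r" "F \<gamma> = carrier G"
    using ser by (auto simp: ascending_series_def)
  interpret r: wo_rel r using wo by (simp add: wo_rel.intro)
  have "\<beta> \<in> Field r \<longrightarrow> P (F \<beta>)" for \<beta>
  proof (induction \<beta> rule: r.well_order_induct)
    case (1 \<beta>)
    have IH: "P (F \<delta>)" if "\<delta> \<in> underS r \<beta>" for \<delta>
      using 1 that underS_Field by (fastforce simp: underS_def)
    show ?case
    proof
      assume \<beta>: "\<beta> \<in> Field r"
      consider "underS r \<beta> = {}" | \<delta> where "immediate_succ r \<delta> \<beta>" | "limit_point r \<beta>"
        using \<beta> unfolding limit_point_def by blast
      then show "P (F \<beta>)"
      proof cases
        case 1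
        then have "\<beta> = \<zeta>" using \<zeta>(2)[OF \<beta>] by (auto simp: underS_def)
        then show ?thesis using \<zeta> base by simp
      next
        case 2
        then show ?thesis using step[OF 2 \<beta>] IH by (simp add: immediate_succ_def)
      next
        case 3
        show ?thesis unfolding Fl[OF 3] using IH by (intro lim) auto
      qed
    qed
  qed
  then show ?thesis using \<gamma> by metis
qed

text \<open>Lets a series inside an ascendant subgroup be continued by the series above it:
  conjugation in \<open>S\<close> is conjugation in \<open>G\<close>.\<close>

lemma asc_consistent:
  assumes S: "subgroup S G" and "asc (G\<lparr>carrier := S\<rparr>) A B"
  shows "asc G A B"
proof -
  have sub: "subgroup K G" "K \<subseteq> S" if "subgroup K (G\<lparr>carrier := S\<rparr>)" for K
    using incl_subgroup[OF S that] subgroup.subset[OF that] by auto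
  from assms(2) show ?thesis
  proof (induction rule: asc.induct)
    case refl
    then show ?case using sub by (simp add: asc.refl)
  next
    case (step K L)
    have "conj_closed G L K" using step(4) sub(2)[OF step(2)] S
      by (auto simp: conj_closed_def m_inv_consistent subset_iff)
    then show ?case using sub[OF step(2)] by (intro asc.step[OF step.IH _ step(3)])
  next
    case (chain_Union \<C>)
    from chain_Union.hyps(1) chain_Union.IH chain_Union.hyps(3) show ?case by (rule asc.chain_Union)
  qed
qed

text \<open>
  If \<open>a\<close> acts on \<open>x\<close> with finite order \<open>k\<close>, then the product of the conjugates of
  \<open>comm_by G a x\<close> telescopes to 1; an Engel condition makes a power of it fixed by \<open>a\<close>.
\<close>

lemma engel_torsion:
  assumes a: "a \<in> carrier G" and B: "B \<subseteq> carrier G" "\<And>u. u \<in> B \<Longrightarrow> inv u \<in> B"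
    and mult: "\<And>u v. u \<in> B \<Longrightarrow> v \<in> B \<Longrightarrow> u \<otimes> v \<in> B \<and> u \<otimes> v = v \<otimes> u"
    and conj: "\<And>u. u \<in> B \<Longrightarrow> a \<otimes> u \<otimes> inv a \<in> B"
    and k: "k > 0" "\<And>u. u \<in> B \<Longrightarrow> a [^] (k::nat) \<otimes> u = u \<otimes> a [^] k"
    and x: "x \<in> B" "(comm_by G a ^^ Suc n) x = \<one>"
  shows "torsion G (comm_by G a x)"
proof -
  have Bc: "u \<in> carrier G" if "u \<in> B" for u using that B by auto
  let ?s = "\<lambda>u. a \<otimes> u \<otimes> inv a"
  have cb: "comm_by G a u = u \<otimes> inv (?s u)" if "u \<in> B" for u
    using Bc[OF that] a by (simp add: comm_by_def word_simps)
  have cbB: "comm_by G a u \<in> B" if "u \<in> B" for u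
    using that B mult conj by (simp add: cb)
  have sk: "(?s ^^ j) u = a [^] j \<otimes> u \<otimes> inv (a [^] j)" if "u \<in> carrier G" for u and j :: nat
    using that a
  proof (induction j)
    case (Suc j)
    have "a \<otimes> a [^] j = a [^] j \<otimes> a" using a by (metis nat_pow_Suc nat_pow_Suc2)
    then have "a [^] Suc j = a \<otimes> a [^] j" by simp
    moreover have "(?s ^^ Suc j) u = (a \<otimes> a [^] j) \<otimes> u \<otimes> inv (a \<otimes> a [^] j)"
      using Suc by (simp add: word_simps)
    ultimately show ?case by (simp only:)
  qed auto
  \<comment> \<open>Each further commutator in the Engel relation costs one factor \<open>k\<close>
    in the exponent.\<close>
  have "(comm_by G a x) [^] (k ^ n) = \<one>" using x
  proof (induction n arbitrary: x)
    case 0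
    then show ?case using cbB Bc by (simp del: nat_pow_Suc)
  next
    case (Suc n)
    define w where "w = comm_by G a x"
    have wB: "w \<in> B" using cbB Suc by (simp add: w_def)
    have powB: "u [^] Suc j \<in> B" if "u \<in> B" for u and j :: nat
      using that mult by (induction j) (auto simp: Bc)
    have IH: "(comm_by G a w) [^] (k ^ n) = \<one>"
      using Suc.IH[OF wB] Suc.prems(2) by (simp add: w_def funpow_swap1)
    define g where "g = w [^] (k ^ n)"
    have gB: "g \<in> B" using powB[OF wB, of "k ^ n - 1"] k(1) by (simp add: g_def)
    have pm: "(u \<otimes> v) [^] (j::nat) = u [^] j \<otimes> v [^] j" if "u \<in> B" "v \<in> B" for u v j
      using that Bc mult by (intro pow_mult_distrib) auto
    \<comment> \<open>On the abelian \<open>B\<close> the map \<open>comm_by G a\<close> is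
      multiplicative, hence compatible with powers; by the induction hypothesis \<open>g\<close> is
      fixed by \<open>a\<close>.\<close>
    have "comm_by G a g = w [^] (k ^ n) \<otimes> inv (?s w [^] (k ^ n))"
      using gB Bc[OF wB] a by (simp add: cb g_def conj_nat_pow)
    also have "\<dots> = (comm_by G a w) [^] (k ^ n)"
      using pm[OF wB B(2)[OF conj[OF wB]]] Bc[OF wB] a wB by (simp add: cb nat_pow_inv)
    finally have "g \<otimes> a = a \<otimes> g" using IH comm_by_one_iff a Bc[OF gB] by simp
    then have fix_g: "?s g = g" using Bc[OF gB] a by (simp flip: \<open>g \<otimes> a = a \<otimes> g\<close> add: word_simps)
    \<comment> \<open>A norm: the product of the first \<open>j\<close> conjugates of
      \<open>w\<close>. It telescopes to \<open>x\<close> times the inverse of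
      \<open>(?s ^^ j) x\<close>, which is 1 for \<open>j = k\<close>.\<close>
    define N where "N = rec_nat \<one> (\<lambda>j P. P \<otimes> (?s ^^ j) w)"
    have sjB: "(?s ^^ j) u \<in> B" if "u \<in> B" for u j using that conj by (induction j) auto
    have NS: "N (Suc j) = N j \<otimes> (?s ^^ j) w" for j by (simp add: N_def)
    have N0: "N 0 = \<one>" by (simp add: N_def)
    have xB: "x \<in> B" using Suc.prems(1) .
    have tele: "N j = x \<otimes> inv ((?s ^^ j) x)" for j
    proof (induction j)
      case 0
      then show ?case using N0 Bc[OF xB] by simp
    next
      case (Suc j)
      have c: "a [^] j \<in> carrier G" "x \<in> carrier G" using a Bc[OF xB] by auto
      have "(?s ^^ j) w = (?s ^^ j) x \<otimes> inv ((?s ^^ Suc j) x)"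
      proof -
        have "a [^] Suc j = a [^] j \<otimes> a" by simp
        then show ?thesis using c a Bc[OF wB] unfolding sk[OF Bc[OF wB]] sk[OF c(2)]
          by (simp add: w_def comm_by_def word_simps)
      qed
      have "x \<otimes> inv p \<otimes> (p \<otimes> inv q) = x \<otimes> inv q" if "p \<in> carrier G" "q \<in> carrier G" for p q
        using that c(2) by (simp add: word_simps)
      then show ?case unfolding NS Suc \<open>(?s ^^ j) w = _\<close> using Bc[OF sjB[OF xB]] by blast
    qed
    have onB: "\<one> \<in> B" using mult[OF xB B(2)[OF xB]] Bc[OF xB] by simp
    have NB: "N j \<in> B" for j by (induction j) (use onB NS N0 mult sjB wB in auto)
    have "(?s ^^ k) x = x"
      using sk[OF Bc[OF xB], of k] k(2)[OF xB] a Bc[OF xB] by (simp add: word_simps)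
    then have Nk: "N k = \<one>" using tele[of k] Bc[OF xB] by simp
    have sg: "(?s ^^ j) w [^] (k ^ n) = g" for j
    proof (induction j)
      case (Suc j)
      have "(?s ^^ Suc j) w [^] (k ^ n) = ?s ((?s ^^ j) w [^] (k ^ n))"
        using conj_nat_pow[OF a Bc[OF sjB[OF wB]], of j "k ^ n"] by simp
      then show ?case using Suc fix_g by simp
    qed (simp add: g_def)
    have Npow: "N j [^] (k ^ n) = g [^] j" for j
    proof (induction j)
      case (Suc j)
      then show ?case unfolding NS using pm[OF NB sjB[OF wB]] sg by simp
    qed (simp add: N0)
    \<comment> \<open>Every conjugate of \<open>w\<close> has the same power \<open>g\<close>, so
      raising \<open>N k = \<one>\<close> to the exponent \<open>k ^ n\<close> gives
      \<open>g [^] k\<close>.\<close>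
    have "g [^] k = \<one>" using Npow[of k] Nk by simp
    then show ?case using Bc[OF wB] by (simp add: g_def w_def nat_pow_pow mult.commute)
  qed
  then show ?thesis using k(1) by (auto simp: torsion_def intro!: exI[of _ "k ^ n"])
qed

end

section \<open>Homomorphisms with central kernel\<close>

context group_hom
begin

lemma asc_vimage:
  assumes "asc H A B"
  shows "asc G {x \<in> carrier G. h x \<in> A} {x \<in> carrier G. h x \<in> B}"
proof -
  have sub: "subgroup {x \<in> carrier G. h x \<in> K} G" if "subgroup K H" for K
  proof (rule G.subgroupI)
    show "{x \<in> carrier G. h x \<in> K} \<noteq> {}" using subgroup.one_closed[OF that] hom_one G.one_closed by force
  qed (use that in \<open>auto simp: subgroup.m_inv_closed subgroup.m_closed\<close>)
  from assms show ?thesis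
  proof (induction rule: asc.induct)
    case refl
    then show ?case using sub by (simp add: asc.refl)
  next
    case (step K L)
    have "conj_closed G {x \<in> carrier G. h x \<in> L} {x \<in> carrier G. h x \<in> K}"
      using step(4) by (auto simp: conj_closed_def)
    then show ?case using step(3) by (intro asc.step[OF step.IH sub[OF step(2)]]) auto
  next
    case (chain_Union \<C>)
    have "{x \<in> carrier G. h x \<in> \<Union>\<C>} = \<Union>((\<lambda>K. {x \<in> carrier G. h x \<in> K}) ` \<C>)" by auto
    moreover have "asc G {x \<in> carrier G. h x \<in> A} (\<Union>((\<lambda>K. {x \<in> carrier G. h x \<in> K}) ` \<C>))"
    proof (rule asc.chain_Union)
      fix K L
      assume "K \<in> (\<lambda>K. {x \<in> carrier G. h x \<in> K}) ` \<C>" "L \<in> (\<lambda>K. {x \<in> carrier G. h x \<in> K}) ` \<C>"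
      then obtain K' L' where "K' \<in> \<C>" "L' \<in> \<C>" "K = {x \<in> carrier G. h x \<in> K'}" "L = {x \<in> carrier G. h x \<in> L'}"
        by auto
      with chain_Union(3)[of K' L'] show "K \<subseteq> L \<or> L \<subseteq> K" by auto
    qed (use chain_Union in auto)
    ultimately show ?case by simp
  qed
qed

text \<open>Schur's theorem by transfer to the central kernel of \<open>h\<close>.\<close>

lemma commutators_torsion:
  assumes fin: "finite (h ` carrier G)"
    and central: "\<And>z x. z \<in> carrier G \<Longrightarrow> h z = \<one>\<^bsub>H\<^esub> \<Longrightarrow> x \<in> carrier G \<Longrightarrow> z \<otimes> x = x \<otimes> z"
    and c: "c \<in> generate G {comm_by G y x | x y. x \<in> carrier G \<and> y \<in> carrier G}"
  shows "torsion G c"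
proof -
  define Z where "Z = G\<lparr>carrier := kernel G H h\<rparr>"
  define B where "B = h ` carrier G"
  have Zc: "z \<in> carrier Z \<longleftrightarrow> z \<in> carrier G \<and> h z = \<one>\<^bsub>H\<^esub>" for z by (auto simp: Z_def kernel_def)
  have Zm: "x \<otimes>\<^bsub>Z\<^esub> y = x \<otimes> y" "\<one>\<^bsub>Z\<^esub> = \<one>" for x y by (auto simp: Z_def)
  have "group Z" unfolding Z_def using subgroup_kernel G.subgroup_imp_group by blast
  interpret Z: comm_group Z
  proof (rule group.group_comm_groupI[OF \<open>group Z\<close>])
    show "\<And>x y. x \<in> carrier Z \<Longrightarrow> y \<in> carrier Z \<Longrightarrow> x \<otimes>\<^bsub>Z\<^esub> y = y \<otimes>\<^bsub>Z\<^esub> x"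
      using central by (simp add: Zc Zm)
  qed
  \<comment> \<open>A transversal of the kernel, indexed by the image \<open>B\<close>.\<close>
  define t where "t q = (SOME x. x \<in> carrier G \<and> h x = q)" for q
  have t: "t q \<in> carrier G \<and> h (t q) = q" if "q \<in> B" for q
    unfolding t_def by (rule someI_ex) (use that in \<open>auto simp: B_def\<close>)
  \<comment> \<open>The kernel element by which \<open>g \<otimes> t q\<close> differs from the
    chosen representative of its coset. The transfer \<open>V g\<close> is the product of these
    elements over all cosets.\<close>
  define f where "f g q = inv (t (h g \<otimes>\<^bsub>H\<^esub> q)) \<otimes> g \<otimes> t q" for g q
  have hB: "h g \<otimes>\<^bsub>H\<^esub> q \<in> B" if "g \<in> carrier G" "q \<in> B" for g q
    using that by (auto simp: B_def simp flip: hom_mult)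
  have BH: "q \<in> carrier H" if "q \<in> B" for q using that by (auto simp: B_def)
  have fZ: "f g q \<in> carrier Z" if "g \<in> carrier G" "q \<in> B" for g q
    using that t[OF that(2)] t[OF hB[OF that]] BH by (simp add: Zc f_def H.m_assoc H.word_simps)
  define V where "V g = finprod Z (f g) B" for g
  have VZ: "V g \<in> carrier Z" if "g \<in> carrier G" for g
    unfolding V_def using fZ[OF that] by (intro Z.finprod_closed) auto
  have V_mult: "V (g \<otimes> g') = V g \<otimes> V g'" if gg: "g \<in> carrier G" "g' \<in> carrier G" for g g'
  proof -
    \<comment> \<open>The cocycle identity; in the product over \<open>B\<close>, left
      multiplication by \<open>h g'\<close> then only permutes the indices.\<close>
    have "f (g \<otimes> g') q = f g (h g' \<otimes>\<^bsub>H\<^esub> q) \<otimes>\<^bsub>Z\<^esub> f g' q" if q: "q \<in> B" for q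
    proof -
      have "h g \<otimes>\<^bsub>H\<^esub> (h g' \<otimes>\<^bsub>H\<^esub> q) \<in> B" using hB gg q by blast
      then show ?thesis using t[of "h g \<otimes>\<^bsub>H\<^esub> (h g' \<otimes>\<^bsub>H\<^esub> q)"] t[OF hB[OF gg(2) q]] t[OF q] gg BH[OF q]
        by (simp add: f_def Zm H.m_assoc G.word_simps)
    qed
    then have "V (g \<otimes> g') = finprod Z (\<lambda>q. f g (h g' \<otimes>\<^bsub>H\<^esub> q) \<otimes>\<^bsub>Z\<^esub> f g' q) B"
      unfolding V_def using fZ gg hB by (intro Z.finprod_cong') auto
    also have "\<dots> = finprod Z (\<lambda>q. f g (h g' \<otimes>\<^bsub>H\<^esub> q)) B \<otimes>\<^bsub>Z\<^esub> V g'"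
      unfolding V_def using fZ gg hB by (intro Z.finprod_multf) auto
    also have "finprod Z (\<lambda>q. f g (h g' \<otimes>\<^bsub>H\<^esub> q)) B = V g"
    proof -
      have inj: "inj_on (\<lambda>q. h g' \<otimes>\<^bsub>H\<^esub> q) B" using gg BH by (auto intro!: inj_onI)
      have "(\<lambda>q. h g' \<otimes>\<^bsub>H\<^esub> q) ` B = B"
        using fin inj hB gg by (intro card_subset_eq) (auto simp: B_def card_image)
      then show ?thesis unfolding V_def
        using Z.finprod_reindex[of "f g" "\<lambda>q. h g' \<otimes>\<^bsub>H\<^esub> q" B] inj fZ gg by auto
    qed
    finally show ?thesis by (simp add: Zm)
  qed
  \<comment> \<open>A central \<open>z\<close> passes through the representatives, so each factor of
    the transfer is \<open>z\<close> itself.\<close>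
  have Vker: "V z = z [^] card B" if "z \<in> carrier G" "h z = \<one>\<^bsub>H\<^esub>" for z
  proof -
    have "f z q = z" if "q \<in> B" for q
    proof -
      have "f z q = inv (t q) \<otimes> (z \<otimes> t q)"
        using t[OF that] \<open>z \<in> carrier G\<close> \<open>h z = \<one>\<^bsub>H\<^esub>\<close> BH[OF that] by (simp add: f_def G.m_assoc)
      then show ?thesis using central[of z "t q"] t[OF that] \<open>z \<in> carrier G\<close> \<open>h z = \<one>\<^bsub>H\<^esub>\<close>
        by (simp add: G.word_simps)
    qed
    then have "V z = finprod Z (\<lambda>q. z) B" unfolding V_def using that by (intro Z.finprod_cong') (auto simp: Zc)
    also have "\<dots> = z [^]\<^bsub>Z\<^esub> card B" using that by (intro Z.finprod_const) (simp add: Zc)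
    also have "\<dots> = z [^] card B" by (simp add: Z_def flip: G.nat_pow_consistent)
    finally show ?thesis .
  qed
  have V1: "V \<one> = \<one>" using Vker[of \<one>] by simp
  have cm: "V (comm_by G y x) = \<one>" if "x \<in> carrier G" "y \<in> carrier G" for x y
  proof -
    have "V (comm_by G y x) \<otimes> V (y \<otimes> x) = V (x \<otimes> y)"
      using that by (subst V_mult[symmetric]) (auto simp: comm_by_def G.word_simps)
    also have "\<dots> = V (y \<otimes> x)" using that V_mult VZ Z.m_comm[of "V x" "V y"] by (simp add: Zm)
    finally have "V (comm_by G y x) \<otimes> V (y \<otimes> x) = \<one> \<otimes> V (y \<otimes> x)"
      using VZ[of "y \<otimes> x"] that by (simp add: Zc)
    then show ?thesis using VZ[of "y \<otimes> x"] VZ[of "comm_by G y x"] that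
      by (subst (asm) G.right_cancel) (auto simp: Zc)
  qed
  have "V c = \<one> \<and> c \<in> carrier G" using c
  proof (induction rule: generate.induct)
    case one
    then show ?case using V1 by simp
  next
    case (incl d)
    then show ?case using cm by auto
  next
    case (inv d)
    then obtain x y where d: "d = comm_by G y x" "x \<in> carrier G" "y \<in> carrier G" by auto
    then have "inv d = comm_by G x y" by (simp add: comm_by_def G.word_simps)
    then show ?case using d cm by auto
  next
    case (eng d e)
    then show ?case using V_mult by auto
  qed
  then have Vc: "V c = \<one>" and cG: "c \<in> carrier G" by auto
  interpret I: group "H\<lparr>carrier := B\<rparr>"
    using img_is_subgroup H.subgroup_imp_group by (simp add: B_def)
  \<comment> \<open>The transfer kills \<open>c\<close> because its values commute. The power of
    \<open>c\<close> with exponent \<open>card B\<close> lies in the kernel, where the transfer is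
    again this power; so the square of \<open>card B\<close> annihilates \<open>c\<close>.\<close>
  have "h c [^]\<^bsub>H\<^esub> card B = \<one>\<^bsub>H\<^esub>"
    using I.pow_order_eq_1[of "h c"] cG by (simp add: B_def Coset.order_def flip: H.nat_pow_consistent)
  then have hk: "h (c [^] card B) = \<one>\<^bsub>H\<^esub>" using cG by (simp add: hom_nat_pow)
  have Vpow: "V (c [^] n) = \<one>" for n :: nat
    by (induction n) (use V1 Vc V_mult cG in auto)
  have "(c [^] card B) [^] card B = \<one>" using Vker[OF _ hk] Vpow cG by simp
  moreover have "card B > 0" using fin by (auto simp: B_def card_gt_0_iff)
  ultimately show ?thesis using G.torsion_of_pow[of c "card B"] cG by (auto simp: torsion_def)
qed

text \<open>Only the subgroup \<open>S\<close> generated by the two images matters. Iterated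
  commutators descend along its lower central series into the kernel, and one more commutator gives
  1. For the second claim take the last term of the series over which some element fails to commute
  with an element over \<open>S\<close>: the commutator of such a pair lies over the next term, so
  it commutes with both.\<close>

lemma nilpotent_kernel_central:
  assumes nil: "locally_nilpotent_group H"
    and central: "\<And>z x. z \<in> carrier G \<Longrightarrow> h z = \<one>\<^bsub>H\<^esub> \<Longrightarrow> x \<in> carrier G \<Longrightarrow> z \<otimes> x = x \<otimes> z"
    and xy: "x \<in> carrier G" "y \<in> carrier G"
  shows "\<exists>n. (comm_by G y ^^ n) x = \<one>"
    and "x \<otimes> y \<noteq> y \<otimes> x \<Longrightarrow> \<exists>u\<in>carrier G. \<exists>v\<in>carrier G. u \<otimes> v \<noteq> v \<otimes> u \<and>
      comm_by G v u \<otimes> u = u \<otimes> comm_by G v u \<and> comm_by G v u \<otimes> v = v \<otimes> comm_by G v u"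
proof -
  define S where "S = subgroup_generated H {h x, h y}"
  define L where "L = lower_central_series S"
  have "nilpotent_group S" unfolding S_def using nil xy by (auto simp: locally_nilpotent_group_def)
  then obtain n where n: "L n = {\<one>\<^bsub>H\<^esub>}"
    by (auto simp: nilpotent_group_def L_def S_def)
  interpret S: group S by (simp add: S_def)
  have SH: "carrier S \<subseteq> carrier H" unfolding S_def by (rule H.carrier_subgroup_generated_subset)
  have hS: "h x \<in> carrier S" "h y \<in> carrier S"
    using xy H.subgroup_generated_subset_carrier_subset[of "{h x, h y}"] by (auto simp: S_def)
  have LS: "L i \<subseteq> carrier S" for i
  proof (induction i)
    case (Suc i)
    show ?case unfolding L_def lower_central_series.simps
      by (rule S.generate_incl) (use Suc in \<open>auto simp: L_def\<close>)
  qed (simp add: L_def)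
  have Lstep: "h (comm_by G v u) \<in> L (Suc i)"
    if uv: "u \<in> carrier G" "v \<in> carrier G" "h u \<in> L i" "h v \<in> carrier S" for u v i
  proof -
    have "h (comm_by G v u) = h u \<otimes>\<^bsub>S\<^esub> h v \<otimes>\<^bsub>S\<^esub> inv\<^bsub>S\<^esub> h u \<otimes>\<^bsub>S\<^esub> inv\<^bsub>S\<^esub> h v"
      using uv LS[of i] by (auto simp: comm_by_def S_def)
    then show ?thesis unfolding L_def lower_central_series.simps using uv
      by (intro generate.incl) (auto simp: L_def)
  qed
  have "h ((comm_by G y ^^ i) x) \<in> L i" for i
  proof (induction i)
    case (Suc i)
    then show ?case using Lstep[OF _ xy(2) Suc hS(2)] xy by simp
  qed (simp add: L_def hS)
  from this[of n] have "h ((comm_by G y ^^ n) x) = \<one>\<^bsub>H\<^esub>" using n by simp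
  then have "comm_by G y ((comm_by G y ^^ n) x) = \<one>"
    using central[of "(comm_by G y ^^ n) x" y] xy by (simp add: G.comm_by_one_iff)
  then show "\<exists>n. (comm_by G y ^^ n) x = \<one>" by (metis comp_apply funpow.simps(2))
  define C where "C i \<longleftrightarrow> (\<forall>u\<in>carrier G. \<forall>v\<in>carrier G. h u \<in> L i \<longrightarrow> h v \<in> carrier S \<longrightarrow>
      u \<otimes> v = v \<otimes> u)" for i
  have Cn: "C n" using central n by (auto simp: C_def)
  assume "x \<otimes> y \<noteq> y \<otimes> x"
  then have "\<not> C 0" using xy hS by (auto simp: C_def L_def)
  with Cn obtain i where i: "\<not> C i" "C (Suc i)" 
    using dec_induct[of 0 n "\<lambda>i. \<not> C i"] by blast
  then obtain u v where uv: "u \<in> carrier G" "v \<in> carrier G" "h u \<in> L i" "h v \<in> carrier S" "u \<otimes> v \<noteq> v \<otimes> u"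
    by (auto simp: C_def)
  have "h u \<in> carrier S" using uv(3) LS by auto
  then have "comm_by G v u \<otimes> u = u \<otimes> comm_by G v u" "comm_by G v u \<otimes> v = v \<otimes> comm_by G v u"
    using i(2) Lstep[OF uv(1-4)] uv unfolding C_def by auto
  then show "\<exists>u\<in>carrier G. \<exists>v\<in>carrier G. u \<otimes> v \<noteq> v \<otimes> u \<and>
      comm_by G v u \<otimes> u = u \<otimes> comm_by G v u \<and> comm_by G v u \<otimes> v = v \<otimes> comm_by G v u"
    using uv by blast
qed

end

subsection \<open>Evaluation of integer polynomials\<close>

text \<open>Integers are central in every ring, which makes them the coefficients and denominators
  of all later linear algebra.\<close>

definition ofi :: "('a, 'b) ring_scheme \<Rightarrow> int \<Rightarrow> 'a" where
  "ofi R n = add_pow R n \<one>\<^bsub>R\<^esub>"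

text \<open>Horner evaluation. With integer coefficients it is a ring homomorphism although
  \<open>R\<close> need not be commutative.\<close>

definition ev :: "('a, 'b) ring_scheme \<Rightarrow> 'a \<Rightarrow> int poly \<Rightarrow> 'a" where
  "ev R c p = fold_coeffs (\<lambda>a b. ofi R a \<oplus>\<^bsub>R\<^esub> c \<otimes>\<^bsub>R\<^esub> b) p \<zero>\<^bsub>R\<^esub>"

context ring
begin

lemma ofi_closed [simp]: "ofi R n \<in> carrier R"
  by (simp add: ofi_def)

lemma ofi_0 [simp]: "ofi R 0 = \<zero>" and ofi_1 [simp]: "ofi R 1 = \<one>"
  by (simp_all add: ofi_def add_pow_int_ge)

lemma ofi_add: "ofi R (m + n) = ofi R m \<oplus> ofi R n"
  by (simp add: ofi_def add.int_pow_mult)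

lemma ofi_minus: "ofi R (- n) = \<ominus> ofi R n"
  by (simp add: ofi_def add.int_pow_neg)

lemma ofi_diff: "ofi R (m - n) = ofi R m \<ominus> ofi R n"
  using ofi_add[of m "- n"] by (simp add: ofi_minus minus_eq)

lemma ofi_mult: "ofi R (m * n) = ofi R m \<otimes> ofi R n"
  by (simp add: ofi_def add_pow_ldistr_int add.int_pow_pow mult.commute)

lemma ofi_comm: "x \<in> carrier R \<Longrightarrow> ofi R n \<otimes> x = x \<otimes> ofi R n"
  by (simp add: ofi_def add_pow_ldistr_int add_pow_rdistr_int)

lemma ofi_lcomm:
  "x \<in> carrier R \<Longrightarrow> y \<in> carrier R \<Longrightarrow> x \<otimes> (ofi R n \<otimes> y) = ofi R n \<otimes> (x \<otimes> y)"
  by (metis m_assoc ofi_closed ofi_comm)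

lemma minus_unique_right: "x \<in> carrier R \<Longrightarrow> y \<in> carrier R \<Longrightarrow> x \<ominus> y = \<zero> \<longleftrightarrow> x = y"
  by (simp add: r_right_minus_eq)

lemma l_distr_minus:
  "\<lbrakk>x \<in> carrier R; y \<in> carrier R; z \<in> carrier R\<rbrakk> \<Longrightarrow> (x \<ominus> y) \<otimes> z = x \<otimes> z \<ominus> y \<otimes> z"
  by (simp add: minus_eq l_distr l_minus)

lemma r_distr_minus:
  "\<lbrakk>x \<in> carrier R; y \<in> carrier R; z \<in> carrier R\<rbrakk> \<Longrightarrow> z \<otimes> (x \<ominus> y) = z \<otimes> x \<ominus> z \<otimes> y"
  by (simp add: minus_eq r_distr r_minus)

lemma diff_eq_swap:
  assumes "x \<in> carrier R" "u \<in> carrier R" "y \<in> carrier R" "v \<in> carrier R" "x \<oplus> u = y \<oplus> v"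
  shows "u \<ominus> v = y \<ominus> x"
proof -
  have "u \<ominus> v = (\<ominus> x \<oplus> (x \<oplus> u)) \<ominus> v" using assms(1-4) by (simp add: a_assoc[symmetric] l_neg)
  also have "\<dots> = (\<ominus> x \<oplus> y) \<oplus> (v \<oplus> \<ominus> v)"
    using assms(1-4) unfolding assms(5) by (simp add: minus_eq a_assoc)
  also have "\<dots> = y \<ominus> x" using assms(1-4) by (simp add: r_neg minus_eq a_comm)
  finally show ?thesis .
qed

lemma ev_pCons: "c \<in> carrier R \<Longrightarrow> ev R c (pCons a p) = ofi R a \<oplus> c \<otimes> ev R c p"
  by (cases "p = 0 \<and> a = 0") (auto simp: ev_def fold_coeffs_def cCons_def)

lemma ev_0 [simp]: "ev R c 0 = \<zero>"
  by (simp add: ev_def)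

lemma ev_closed [simp]: "c \<in> carrier R \<Longrightarrow> ev R c p \<in> carrier R"
  by (induction p) (auto simp: ev_pCons)

lemma ev_const [simp]: "c \<in> carrier R \<Longrightarrow> ev R c [:a:] = ofi R a"
  by (simp add: ev_pCons)

lemma ev_1 [simp]: "c \<in> carrier R \<Longrightarrow> ev R c 1 = \<one>"
  by (simp add: one_pCons)

lemma ev_X [simp]: "c \<in> carrier R \<Longrightarrow> ev R c [:0, 1:] = c"
  by (simp add: ev_pCons)

lemma ev_add: "c \<in> carrier R \<Longrightarrow> ev R c (p + q) = ev R c p \<oplus> ev R c q"
  by (induction p q rule: poly_induct2) (auto simp: ev_pCons ofi_add r_distr a_ac)

lemma ev_smult: "c \<in> carrier R \<Longrightarrow> ev R c (smult a p) = ofi R a \<otimes> ev R c p"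
proof (induction p)
  case (pCons b p)
  then show ?case by (simp add: ev_pCons ofi_mult r_distr ofi_lcomm)
qed simp

lemma ev_minus: "c \<in> carrier R \<Longrightarrow> ev R c (- p) = \<ominus> ev R c p"
  using ev_smult[of c "- 1" p] by (simp add: ofi_minus l_minus)

lemma ev_diff: "c \<in> carrier R \<Longrightarrow> ev R c (p - q) = ev R c p \<ominus> ev R c q"
  using ev_add[of c p "- q"] by (simp add: ev_minus minus_eq)

lemma ev_mult: "c \<in> carrier R \<Longrightarrow> ev R c (p * q) = ev R c p \<otimes> ev R c q"
proof (induction p)
  case (pCons b p)
  then show ?case by (simp add: ev_pCons ev_add ev_smult l_distr m_assoc)
qed simp

lemma ev_power: "c \<in> carrier R \<Longrightarrow> ev R c (p ^ n) = ev R c p [^] n"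
  by (induction n) (simp, simp only: power_Suc2 ev_mult nat_pow_Suc)

text \<open>The principle behind geometric sums, Fourier components and the resolvent of Hilbert 90:
  an operator that shifts the summands cyclically fixes the sum.\<close>

lemma finsum_rotate:
  assumes "f \<in> UNIV \<rightarrow> carrier R" "f m = f (0::nat)"
  shows "(\<Oplus>j\<in>{..<m}. f (Suc j)) = (\<Oplus>j\<in>{..<m}. f j)"
proof (cases m)
  case (Suc n)
  have f: "\<And>j. f j \<in> carrier R" using assms by auto
  have "(\<Oplus>j\<in>{..<m}. f j) = (\<Oplus>j\<in>{..n}. f j)" by (simp add: Suc lessThan_Suc_atMost)
  moreover have "(\<Oplus>j\<in>{..Suc n}. f j) = (\<Oplus>j\<in>{..n}. f (Suc j)) \<oplus> f 0"
    using f by (intro finsum_Suc2) auto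
  moreover have "(\<Oplus>j\<in>{..Suc n}. f j) = f (Suc n) \<oplus> (\<Oplus>j\<in>{..n}. f j)"
    using f by (intro finsum_Suc) auto
  ultimately show ?thesis using assms f by (simp add: Suc lessThan_Suc_atMost a_comm[of "f 0"])
qed simp

lemma finsum_swap:
  assumes "finite A" "finite B" "\<And>i j. f i j \<in> carrier R"
  shows "(\<Oplus>i\<in>A. \<Oplus>j\<in>B. f i j) = (\<Oplus>j\<in>B. \<Oplus>i\<in>A. f i j)"
  using assms(1)
proof (induction A rule: finite_induct)
  case (insert i A)
  have "(\<Oplus>j\<in>B. \<Oplus>i\<in>insert i A. f i j) = (\<Oplus>j\<in>B. f i j \<oplus> (\<Oplus>i\<in>A. f i j))"
    using insert assms by (intro finsum_cong') (auto simp: finsum_insert)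
  also have "\<dots> = (\<Oplus>j\<in>B. f i j) \<oplus> (\<Oplus>j\<in>B. \<Oplus>i\<in>A. f i j)"
    using assms by (intro finsum_addf) auto
  finally show ?case using insert assms by (simp add: finsum_insert)
qed (simp add: finsum_zero)

end

subsection \<open>Skew fields\<close>

lemma (in ring) torsion_Units:
  assumes "x \<in> carrier R" "torsion R x"
  shows "x \<in> Units R"
proof -
  obtain n :: nat where n: "n > 0" "x [^] n = \<one>" using assms(2) by (auto simp: torsion_def)
  then obtain k where k: "n = Suc k" by (cases n) auto
  have "x [^] k \<otimes> x = \<one>" using n k by simp
  moreover have "x \<otimes> x [^] k = \<one>" using n k assms by (metis nat_pow_Suc2)
  ultimately show ?thesis using assms by (auto simp: Units_def)
qed

context skew_field
begin

lemmas [simp] = Units_closed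

lemma in_Units_iff: "x \<in> Units R \<longleftrightarrow> x \<in> carrier R \<and> x \<noteq> \<zero>"
  using Units_eq by auto

lemma Units_cancel:
  "x \<in> Units R \<Longrightarrow> y \<in> carrier R \<Longrightarrow> inv x \<otimes> (x \<otimes> y) = y"
  "x \<in> Units R \<Longrightarrow> y \<in> carrier R \<Longrightarrow> x \<otimes> (inv x \<otimes> y) = y"
  by (simp_all flip: m_assoc)

lemma prod_zero: "x \<in> carrier R \<Longrightarrow> y \<in> carrier R \<Longrightarrow> x \<otimes> y = \<zero> \<longleftrightarrow> x = \<zero> \<or> y = \<zero>"
  using Units_cancel(1)[of x y] by (cases "x = \<zero>") (auto simp: in_Units_iff)

lemma pow_zero_iff: "x \<in> carrier R \<Longrightarrow> x [^] (n::nat) = \<zero> \<Longrightarrow> x = \<zero>"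
  by (induction n) (auto simp: prod_zero one_not_zero)

lemma lcancel:
  "x \<in> carrier R \<Longrightarrow> x \<noteq> \<zero> \<Longrightarrow> y \<in> carrier R \<Longrightarrow> z \<in> carrier R \<Longrightarrow> x \<otimes> y = x \<otimes> z \<longleftrightarrow> y = z"
  using prod_zero[of x "y \<ominus> z"] by (simp add: r_distr_minus minus_unique_right)

lemma rcancel:
  "x \<in> carrier R \<Longrightarrow> x \<noteq> \<zero> \<Longrightarrow> y \<in> carrier R \<Longrightarrow> z \<in> carrier R \<Longrightarrow> y \<otimes> x = z \<otimes> x \<longleftrightarrow> y = z"
  using prod_zero[of "y \<ominus> z" x] by (auto simp: l_distr_minus minus_unique_right)

lemma inv_commutes:
  assumes "x \<in> Units R" "y \<in> carrier R" "x \<otimes> y = y \<otimes> x"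
  shows "inv x \<otimes> y = y \<otimes> inv x"
proof -
  have "inv x \<otimes> y = inv x \<otimes> (y \<otimes> x) \<otimes> inv x" using assms(1,2) by (simp add: m_assoc)
  also have "\<dots> = y \<otimes> inv x" using assms(1,2) by (simp add: Units_cancel m_assoc flip: assms(3))
  finally show ?thesis .
qed

lemma inv_mult_Units: "x \<in> Units R \<Longrightarrow> y \<in> Units R \<Longrightarrow> inv (x \<otimes> y) = inv y \<otimes> inv x"
  using group.inv_mult_group[OF units_group, of x y]
  by (simp add: units_of_carrier units_of_mult units_of_inv Units_m_closed)

text \<open>Multiplication by \<open>c\<close> rotates the summands, so
  \<open>c \<ominus> \<one>\<close> annihilates the sum.\<close>

lemma geometric_zero:
  assumes "c \<in> carrier R" "c [^] m = \<one>" "c \<noteq> \<one>"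
  shows "(\<Oplus>i\<in>{..<m::nat}. c [^] i) = \<zero>"
proof -
  let ?S = "\<Oplus>i\<in>{..<m}. c [^] i"
  have S: "?S \<in> carrier R" using assms(1) by (intro finsum_closed) auto
  have "?S \<otimes> c = (\<Oplus>i\<in>{..<m}. c [^] Suc i)" using assms(1) by (simp add: finsum_ldistr)
  also have "\<dots> = ?S" using assms by (intro finsum_rotate) auto
  finally have "?S \<otimes> (c \<ominus> \<one>) = \<zero>"
    using S assms(1) by (simp add: r_distr_minus minus_unique_right)
  then show ?thesis using S assms by (auto simp: prod_zero minus_unique_right)
qed

text \<open>
  In characteristic \<open>p\<close> the identity \<open>(X - 1)\<^sup>p = X\<^sup>p - 1\<close> excludes elements of order \<open>p\<close>.
\<close>

lemma prime_torsion_trivial: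
  assumes "prime (p::nat)" "ofi R (int p) = \<zero>" "c \<in> carrier R" "c [^] p = \<one>"
  shows "c = \<one>"
proof -
  \<comment> \<open>The congruence is proved for integer polynomials modulo \<open>p\<close> and
    then evaluated at \<open>c\<close>, where \<open>p\<close> vanishes.\<close>
  have "[:int p:] dvd ([:- 1, 1:] ^ p - (monom 1 p - 1))"
  proof -
    have p2: "2 \<le> p" using prime_ge_2_nat[OF assms(1)] .
    have eq: "[:- 1, 1::int:] ^ p = (\<Sum>k\<le>p. of_nat (p choose k) * [:0,1:] ^ k * (- 1) ^ (p - k))"
      using binomial_ring[of "[:0, 1::int:]" "- 1" p] by (simp add: one_pCons)
    define f where "f k = of_nat (p choose k) * [:0,1:] ^ k * (- 1 :: int poly) ^ (p - k)" for k
    have "{..p} = insert 0 (insert p {0<..<p})" using p2 by auto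
    then have "[:- 1, 1:] ^ p = f 0 + (f p + sum f {0<..<p})" using p2 eq by (simp add: f_def)
    also have "f p = monom 1 p" by (simp add: f_def monom_altdef)
    also have "f 0 = (- 1) ^ p" by (simp add: f_def)
    finally have key: "[:- 1, 1:] ^ p - (monom 1 p - 1) = ((- 1) ^ p + 1) + sum f {0<..<p}" by simp
    \<comment> \<open>The constant terms cancel for odd \<open>p\<close> and leave 2 for
      \<open>p = 2\<close>.\<close>
    have "[:int p:] dvd ((- 1) ^ p + 1)"
    proof (cases "p = 2")
      case True
      then show ?thesis by (simp add: one_pCons power2_eq_square)
    next
      case False
      then show ?thesis using prime_odd_nat[OF assms(1)] p2 by auto
    qed
    moreover have "[:int p:] dvd sum f {0<..<p}"
    proof (rule dvd_sum)
      fix k assume "k \<in> {0<..<p}"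
      then have "int p dvd int (p choose k)" using dvd_choose_prime[of k p] assms(1) p2 by (simp add: int_dvd_int_iff)
      then have "[:int p:] dvd of_nat (p choose k)" by (auto simp: dvd_def of_nat_poly intro: exI[of _ "[:_:]"])
      then show "[:int p:] dvd f k" unfolding f_def by (intro dvd_mult2)
    qed
    ultimately show ?thesis unfolding key by (rule dvd_add)
  qed
  then obtain q where q: "[:- 1, 1:] ^ p - (monom 1 p - 1) = [:int p:] * q" by (auto elim: dvdE)
  have "ev R c ([:- 1, 1:] ^ p) \<ominus> ev R c (monom 1 p - 1) = \<zero>"
    using arg_cong[OF q, of "ev R c"] assms by (simp add: ev_diff ev_smult)
  moreover have "ev R c (monom 1 p - 1) = \<zero>"
    using assms by (simp add: ev_diff monom_altdef ev_power ev_smult minus_unique_right)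
  moreover have "ev R c [:- 1, 1:] = c \<ominus> \<one>"
    using assms by (simp add: ev_pCons ofi_minus minus_eq a_comm)
  ultimately have "(c \<ominus> \<one>) [^] p = \<zero>" using assms by (simp add: ev_power minus_unique_right)
  then show ?thesis using pow_zero_iff[of "c \<ominus> \<one>"] assms by (simp add: minus_unique_right)
qed

text \<open>Without zero divisors one of the prime factors of \<open>m\<close> must vanish. That it
  divides \<open>m\<close> is what lets \<open>torsion_orderE\<close> split the order of an
  element.\<close>

lemma prime_char:
  assumes "ofi R (int m) = \<zero>" "m > 0"
  shows "\<exists>p. prime p \<and> p dvd m \<and> ofi R (int p) = \<zero>"
  using assms
proof (induction m rule: less_induct)
  case (less m)
  have "m \<noteq> 1" using less one_not_zero by auto
  then obtain p where p: "prime p" "p dvd m" using prime_factor_nat by blast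
  then obtain k where k: "m = p * k" by (auto elim: dvdE)
  show ?case
  proof (cases "ofi R (int p) = \<zero>")
    case False
    then have "ofi R (int k) = \<zero>" using less k by (simp add: ofi_mult prod_zero)
    moreover have "k < m" "k > 0" using k less p prime_gt_1_nat by auto
    ultimately show ?thesis using less k by (metis dvd_mult)
  qed (use p in auto)
qed

text \<open>The exact order is nonzero in \<open>R\<close>, since in characteristic \<open>p\<close>
  an order divisible by \<open>p\<close> would give an element of order \<open>p\<close>. Hence the
  order may be cancelled, in Fourier inversion as well as in the leading coefficient of
  \<open>(V + c)^k - V^k\<close>.\<close>

lemma torsion_orderE:
  assumes "a \<in> carrier R" "torsion R a"
  obtains m :: nat where "m > 0" "a [^] m = \<one>" "\<And>k. 0 < k \<Longrightarrow> k < m \<Longrightarrow> a [^] k \<noteq> \<one>"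
    "ofi R (int m) \<noteq> \<zero>"
proof -
  define m where "m = (LEAST n::nat. n > 0 \<and> a [^] n = \<one>)"
  have m: "m > 0 \<and> a [^] m = \<one>"
    unfolding m_def by (rule LeastI_ex) (use assms in \<open>auto simp: torsion_def\<close>)
  have mm: "a [^] k \<noteq> \<one>" if "0 < k" "k < m" for k
    using not_less_Least[of k "\<lambda>n. n > 0 \<and> a [^] n = \<one>"] that by (auto simp: m_def)
  have "ofi R (int m) \<noteq> \<zero>"
  proof
    assume "ofi R (int m) = \<zero>"
    then obtain p where p: "prime p" "p dvd m" "ofi R (int p) = \<zero>" using prime_char m by blast
    then obtain k where k: "m = p * k" by (auto elim: dvdE)
    have "(a [^] k) [^] p = \<one>" using m k assms by (simp add: nat_pow_pow mult.commute)
    then have "a [^] k = \<one>" using prime_torsion_trivial p assms by simp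
    moreover have "0 < k" "k < m" using k m p prime_gt_1_nat by auto
    ultimately show False using mm by blast
  qed
  then show ?thesis using that m mm by blast
qed

text \<open>Fourier inversion: \<open>m x\<close> is the sum of its components \<open>y\<close> with \<open>y a = a\<^sup>i y\<close>.\<close>

lemma exists_eigenvector:
  assumes a: "a \<in> carrier R" "torsion R a" and x: "x \<in> carrier R" "a \<otimes> x \<noteq> x \<otimes> a"
    and E: "x \<in> E" "E \<subseteq> carrier R" "\<And>u. u \<in> E \<Longrightarrow> u \<otimes> a \<in> E" "\<And>u. u \<in> E \<Longrightarrow> a \<otimes> u \<in> E"
      "\<zero> \<in> E" "\<And>u v. u \<in> E \<Longrightarrow> v \<in> E \<Longrightarrow> u \<oplus> v \<in> E"
  shows "\<exists>y\<in>E. \<exists>i::nat. y \<noteq> \<zero> \<and> y \<otimes> a = a [^] i \<otimes> y \<and> y \<otimes> a \<noteq> a \<otimes> y"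
proof -
  obtain m :: nat where m: "m > 0" "a [^] m = \<one>" "\<And>k. 0 < k \<Longrightarrow> k < m \<Longrightarrow> a [^] k \<noteq> \<one>"
    "ofi R (int m) \<noteq> \<zero>" using torsion_orderE a by blast
  \<comment> \<open>The inverse of \<open>a\<close>, taken as a power because \<open>E\<close> is
    only closed under multiplication by \<open>a\<close>.\<close>
  define b where "b = a [^] (m - 1)"
  have bc: "b \<in> carrier R" and ab: "a \<otimes> b = \<one>" "b \<otimes> a = \<one>"
    using a m nat_pow_Suc2[of a "m - 1"] nat_pow_Suc[of a "m - 1"]
    by (simp_all add: b_def del: nat_pow_Suc nat_pow_Suc2)
  have comm: "a \<otimes> b = b \<otimes> a" using ab by simp
  have abp: "a [^] j \<otimes> b [^] j = \<one>" for j :: nat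
    using pow_mult_distrib[OF comm a(1) bc, of j] by (simp add: ab)
  have bap: "b [^] j \<otimes> a [^] j = \<one>" for j :: nat
    using pow_mult_distrib[OF comm[symmetric] bc a(1), of j] by (simp add: ab)
  have bm: "b [^] m = \<one>" using abp[of m] m bc by simp
  define f where "f i j = b [^] (i * j) \<otimes> x \<otimes> a [^] j" for i j :: nat
  have fc: "f i j \<in> carrier R" for i j using a bc x by (simp add: f_def)
  define y where "y i = (\<Oplus>j\<in>{..<m}. f i j)" for i
  have yc: "y i \<in> carrier R" for i unfolding y_def using fc by (intro finsum_closed) auto
  have ya: "y i \<otimes> a = a [^] i \<otimes> y i" for i
  proof -
    have "f i j \<otimes> a = a [^] i \<otimes> f i (Suc j)" for j
    proof -
      have "b [^] (i * Suc j) = b [^] i \<otimes> b [^] (i * j)" using bc by (simp add: nat_pow_mult)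
      then have "a [^] i \<otimes> f i (Suc j) = (a [^] i \<otimes> b [^] i) \<otimes> (b [^] (i * j) \<otimes> x \<otimes> a [^] j \<otimes> a)"
        using a x bc by (simp add: f_def m_assoc)
      then show ?thesis using abp a x bc by (simp add: f_def m_assoc)
    qed
    then have "y i \<otimes> a = (\<Oplus>j\<in>{..<m}. a [^] i \<otimes> f i (Suc j))"
      unfolding y_def using fc a by (subst finsum_ldistr) auto
    also have "\<dots> = a [^] i \<otimes> (\<Oplus>j\<in>{..<m}. f i (Suc j))"
      using fc a by (subst finsum_rdistr) auto
    also have "(\<Oplus>j\<in>{..<m}. f i (Suc j)) = y i"
      unfolding y_def
    proof (rule finsum_rotate)
      have "b [^] (i * m) = \<one>" using nat_pow_pow[OF bc, of m i] bm by (simp add: mult.commute)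
      then show "f i m = f i 0" using m x by (simp add: f_def)
    qed (use fc in auto)
    finally show ?thesis .
  qed
  have "(\<Oplus>i\<in>{..<m}. y i) = (\<Oplus>j\<in>{..<m}. \<Oplus>i\<in>{..<m}. f i j)"
    unfolding y_def by (rule finsum_swap) (auto simp: fc)
  \<comment> \<open>Summing over \<open>i\<close> first leaves a geometric sum in
    \<open>b [^] j\<close>, which vanishes unless \<open>j = 0\<close> because \<open>a\<close> has
    exact order \<open>m\<close>.\<close>
  also have "\<dots> = (\<Oplus>j\<in>{..<m}. if j = 0 then ofi R (int m) \<otimes> x else \<zero>)"
  proof (rule finsum_cong')
    fix j assume j: "j \<in> {..<m}"
    have fij: "f i j = (b [^] j) [^] i \<otimes> (x \<otimes> a [^] j)" for i
      using a x bc by (simp add: f_def m_assoc nat_pow_pow mult.commute)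
    have "(\<Oplus>i\<in>{..<m}. f i j) = (\<Oplus>i\<in>{..<m}. (b [^] j) [^] i) \<otimes> (x \<otimes> a [^] j)"
      unfolding fij using a x bc by (subst finsum_ldistr) auto
    also have "\<dots> = (if j = 0 then ofi R (int m) \<otimes> x else \<zero>)"
    proof (cases "j = 0")
      case True
      have "(\<Oplus>i\<in>{..<m}. \<one>) = ofi R (int m)"
        using add.finprod_const[of \<one> "{..<m}"] by (simp add: ofi_def add_pow_int_ge)
      then show ?thesis using True x by simp
    next
      case False
      have "b [^] j \<noteq> \<one>" using abp[of j] m(3)[of j] False j a by auto
      moreover have "(b [^] j) [^] m = \<one>" using nat_pow_pow[OF bc, of j m] nat_pow_pow[OF bc, of m j] bm by (simp add: mult.commute)
      ultimately show ?thesis using geometric_zero[of "b [^] j" m] bc a x False by simp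
    qed
    finally show "(\<Oplus>i\<in>{..<m}. f i j) = (if j = 0 then ofi R (int m) \<otimes> x else \<zero>)" .
  qed (use x in auto)
  also have "\<dots> = ofi R (int m) \<otimes> x"
    using finsum_singleton[of 0 "{..<m}" "\<lambda>_. ofi R (int m) \<otimes> x"] m x by (simp add: eq_commute)
  finally have sum: "(\<Oplus>i\<in>{..<m}. y i) = ofi R (int m) \<otimes> x" .
  \<comment> \<open>If every component commuted with \<open>a\<close>, so would their sum
    \<open>m x\<close>, and \<open>m\<close> can be cancelled.\<close>
  have "\<exists>i. y i \<noteq> \<zero> \<and> y i \<otimes> a \<noteq> a \<otimes> y i"
  proof (rule ccontr)
    assume "\<nexists>i. y i \<noteq> \<zero> \<and> y i \<otimes> a \<noteq> a \<otimes> y i"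
    then have cy: "y i \<otimes> a = a \<otimes> y i" for i using yc a by (cases "y i = \<zero>") auto
    have "(\<Oplus>i\<in>{..<m}. y i) \<otimes> a = a \<otimes> (\<Oplus>i\<in>{..<m}. y i)"
      using cy yc a by (simp add: finsum_ldistr finsum_rdistr)
    then have "ofi R (int m) \<otimes> (x \<otimes> a) = ofi R (int m) \<otimes> (a \<otimes> x)"
      unfolding sum using x a by (simp add: m_assoc ofi_lcomm)
    then show False using lcancel m x a by simp
  qed
  moreover have "y i \<in> E" for i
  proof -
    have aE: "u \<otimes> a [^] j \<in> E" if "u \<in> E" for u and j :: nat
      using that E a by (induction j) (auto simp: m_assoc[symmetric] subset_iff)
    have bE: "a [^] j \<otimes> u \<in> E" if "u \<in> E" for u and j :: nat
      using that
    proof (induction j)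
      case (Suc j)
      have "u \<in> carrier R" using E Suc by auto
      then have "a [^] Suc j \<otimes> u = a \<otimes> (a [^] j \<otimes> u)"
        using a by (subst nat_pow_Suc2) (auto simp: m_assoc)
      then show ?case using Suc E by simp
    qed (use E in auto)
    have fE: "f i j \<in> E" for i j
      using bE[of x "(m - 1) * (i * j)"] aE E(1) a unfolding f_def b_def by (simp add: nat_pow_pow)
    have "(\<Oplus>j\<in>A. f i j) \<in> E" if "finite A" for A
      using that
    proof (induction A rule: finite_induct)
      case (insert j A)
      have "(\<Oplus>j\<in>insert j A. f i j) = f i j \<oplus> (\<Oplus>j\<in>A. f i j)"
        using insert fc by (intro finsum_insert) auto
      then show ?case using insert E(6) fE by simp
    qed (use E in simp)
    then show ?thesis by (simp add: y_def)
  qed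
  ultimately show ?thesis using ya by blast
qed

text \<open>The conjugates \<open>a2\<close> by \<open>x\<close> and \<open>a1\<close> by
  \<open>1 + x\<close> satisfy \<open>(a2 - a1) x = a1 - a\<close>. They commute with
  \<open>a\<close>, so this linear equation forces its solution \<open>x\<close> to commute with
  \<open>a\<close>. In the degenerate case \<open>a2 = a1\<close> it says \<open>a1 = a\<close>,
  with the same effect.\<close>

lemma conjugates_commute_imp_central:
  assumes a: "a \<in> carrier R"
    and com: "\<And>x z. x \<in> Units R \<Longrightarrow> z \<in> Units R \<Longrightarrow>
      (x \<otimes> a \<otimes> inv x) \<otimes> (z \<otimes> a \<otimes> inv z) = (z \<otimes> a \<otimes> inv z) \<otimes> (x \<otimes> a \<otimes> inv x)"
  shows "a \<in> ring_center R"
proof -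
  have "a \<otimes> x = x \<otimes> a" if x: "x \<in> carrier R" for x
  proof (rule ccontr)
    assume ne: "a \<otimes> x \<noteq> x \<otimes> a"
    have x0: "x \<noteq> \<zero>" using ne a by auto
    have x1: "\<one> \<oplus> x \<noteq> \<zero>"
    proof
      assume "\<one> \<oplus> x = \<zero>"
      then have "x = \<ominus> \<one>" using x by (metis a_comm minus_equality one_closed)
      then show False using ne a by (simp add: l_minus r_minus)
    qed
    have xU: "x \<in> Units R" "\<one> \<oplus> x \<in> Units R" using x x0 x1 by (auto simp: in_Units_iff)
    define a2 where "a2 = x \<otimes> a \<otimes> inv x"
    define a1 where "a1 = (\<one> \<oplus> x) \<otimes> a \<otimes> inv (\<one> \<oplus> x)"
    have c: "a1 \<in> carrier R" "a2 \<in> carrier R" using a x xU by (simp_all add: a1_def a2_def)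
    have a2x: "a2 \<otimes> x = x \<otimes> a" using a x xU by (simp add: a2_def m_assoc)
    have "a1 \<otimes> (\<one> \<oplus> x) = (\<one> \<oplus> x) \<otimes> a" using a x xU by (simp add: a1_def m_assoc)
    then have "a1 \<oplus> a1 \<otimes> x = a \<oplus> a2 \<otimes> x" using a x c a2x by (simp add: r_distr l_distr)
    then have eq: "(a2 \<ominus> a1) \<otimes> x = a1 \<ominus> a"
      using a x c diff_eq_swap[of a "a2 \<otimes> x" a1 "a1 \<otimes> x"] by (simp add: l_distr_minus)
    have a1a: "a1 \<otimes> a = a \<otimes> a1" using com[of "\<one> \<oplus> x" \<one>] xU a by (simp add: a1_def)
    have a2a: "a2 \<otimes> a = a \<otimes> a2" using com[of x \<one>] xU a by (simp add: a2_def)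
    have d: "(a2 \<ominus> a1) \<otimes> a = a \<otimes> (a2 \<ominus> a1)" using a c a1a a2a by (simp add: l_distr_minus r_distr_minus)
    show False
    proof (cases "a2 = a1")
      case True
      then have "a1 = a" using eq a c x by (simp add: minus_unique_right) (metis l_null minus_unique_right)
      then show False using True a2x ne by simp
    next
      case False
      let ?d = "a2 \<ominus> a1"
      have dU: "?d \<in> Units R" using False c by (auto simp: in_Units_iff minus_unique_right)
      have "?d \<otimes> (a \<otimes> x) = a \<otimes> (a1 \<ominus> a)" using d a x c eq by (metis m_assoc minus_closed)
      also have "\<dots> = (a1 \<ominus> a) \<otimes> a" using a c a1a by (simp add: l_distr_minus r_distr_minus)
      also have "\<dots> = ?d \<otimes> (x \<otimes> a)" using a x c eq by (metis m_assoc minus_closed)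
      finally show False using ne lcancel[of ?d] dU a x c by (simp add: in_Units_iff)
    qed
  qed
  then show ?thesis using a by (auto simp: ring_center_def)
qed

end

section \<open>Wedderburn's theorem for finite subrings\<close>

lemma (in group_hom) card_kernel_image:
  assumes "finite (carrier G)"
  shows "card (kernel G H h) * card (h ` carrier G) = card (carrier G)"
proof -
  have gI: "group (H\<lparr>carrier := h ` carrier G\<rparr>)"
    using img_is_subgroup H.subgroup_imp_group by blast
  have "h \<in> hom G (H\<lparr>carrier := h ` carrier G\<rparr>)" by (auto simp: hom_def)
  then interpret I: group_hom G "H\<lparr>carrier := h ` carrier G\<rparr>" h
    using gI by (simp add: group_hom_def group_hom_axioms_def)
  have "kernel G (H\<lparr>carrier := h ` carrier G\<rparr>) h = kernel G H h" by (simp add: kernel_def)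
  then have "(\<lambda>X. the_elem (h ` X)) \<in> iso (G Mod kernel G H h) (H\<lparr>carrier := h ` carrier G\<rparr>)"
    using I.FactGroup_iso_set by simp
  then have "bij_betw (\<lambda>X. the_elem (h ` X)) (rcosets (kernel G H h)) (h ` carrier G)"
    by (auto simp: iso_def FactGroup_def)
  then have "card (rcosets (kernel G H h)) = card (h ` carrier G)" by (rule bij_betw_same_card)
  then show ?thesis using G.lagrange[OF subgroup_kernel] by (simp add: Coset.order_def mult.commute)
qed

context skew_field
begin

lemmas unit_simps = m_assoc inv_mult_Units Units_cancel

lemma commute_mult:
  assumes "x \<in> carrier R" "y \<in> carrier R" "z \<in> carrier R" "x \<otimes> z = z \<otimes> x" "y \<otimes> z = z \<otimes> y"
  shows "(x \<otimes> y) \<otimes> z = z \<otimes> (x \<otimes> y)"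
proof -
  have "(x \<otimes> y) \<otimes> z = x \<otimes> (y \<otimes> z)" using assms(1-3) by (rule m_assoc)
  also have "\<dots> = (x \<otimes> z) \<otimes> y" using assms(1-3) by (simp add: assms(5) m_assoc)
  also have "\<dots> = z \<otimes> (x \<otimes> y)" using assms(1-3) by (simp add: assms(4) m_assoc)
  finally show ?thesis .
qed

text \<open>Artin's elimination: the shift \<open>\<kappa>\<close> multiplies the term with index
  \<open>j\<close> by \<open>\<theta> j\<close>, and subtracting \<open>\<theta> n\<close> times the
  relation removes the last term. Stating it for eigenfunctions of a shift covers automorphisms of a
  field, powers of \<open>y\<close> and powers of \<open>\<mu>\<close>. An eigenfunction may vanish
  somewhere, so the conclusion concerns products.\<close>

lemma linear_independence_of_characters:
  assumes f: "\<And>j b. b \<in> B \<Longrightarrow> f j b \<in> carrier R" "\<And>b. b \<in> B \<Longrightarrow> \<kappa> b \<in> B"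
      "\<And>j b. b \<in> B \<Longrightarrow> f j (\<kappa> b) = \<theta> j \<otimes> f j b"
    and \<theta>: "\<And>j. \<theta> j \<in> carrier R" "\<And>i j. i < n \<Longrightarrow> j < n \<Longrightarrow> i \<noteq> j \<Longrightarrow> \<theta> i \<noteq> \<theta> j"
      "\<And>i j. \<theta> i \<otimes> \<theta> j = \<theta> j \<otimes> \<theta> i"
    and d: "\<And>j. d j \<in> carrier R" "\<And>i j. d j \<otimes> \<theta> i = \<theta> i \<otimes> d j"
    and sum: "\<And>b. b \<in> B \<Longrightarrow> (\<Oplus>j\<in>{..<n::nat}. d j \<otimes> f j b) = \<zero>"
    and jb: "j < n" "b \<in> B"
  shows "d j \<otimes> f j b = \<zero>"
  using \<theta>(2) d sum jb
proof (induction n arbitrary: d j b)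
  case (Suc n)
  have Sc: "(\<Oplus>j\<in>{..<Suc n}. d j \<otimes> g j) = (\<Oplus>j\<in>{..<n}. d j \<otimes> g j) \<oplus> d n \<otimes> g n"
    if "\<And>j. g j \<in> carrier R" for g
    using Suc.prems(2) that by (simp add: lessThan_Suc finsum_insert a_comm)
  \<comment> \<open>The coefficients of the shortened relation; the new factor is nonzero for
    \<open>j < n\<close>.\<close>
  define d' where "d' j = d j \<otimes> (\<theta> j \<ominus> \<theta> n)" for j
  have d': "d' j \<in> carrier R" "d' j = (\<theta> j \<ominus> \<theta> n) \<otimes> d j" for j
    using Suc.prems \<theta> by (simp_all add: d'_def l_distr_minus r_distr_minus)
  have d'comm: "d' j \<otimes> \<theta> i = \<theta> i \<otimes> d' j" for i j
  proof -
    have "(\<theta> j \<ominus> \<theta> n) \<otimes> \<theta> i = \<theta> i \<otimes> (\<theta> j \<ominus> \<theta> n)"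
      using \<theta> by (simp add: l_distr_minus r_distr_minus)
    then show ?thesis unfolding d'_def using Suc.prems(2,3) \<theta>(1) by (intro commute_mult) auto
  qed
  have d'sum: "(\<Oplus>j\<in>{..<n}. d' j \<otimes> f j b) = \<zero>" if b: "b \<in> B" for b
  proof -
    let ?A = "\<Oplus>j\<in>{..<n}. d j \<otimes> f j b" and ?A' = "\<Oplus>j\<in>{..<n}. d j \<otimes> (\<theta> j \<otimes> f j b)"
    have c: "?A \<in> carrier R" "?A' \<in> carrier R" using f b \<theta> Suc.prems by (auto intro!: finsum_closed)
    have e1: "?A \<oplus> d n \<otimes> f n b = \<zero>" using Suc.prems(4)[OF b] Sc[of "\<lambda>j. f j b"] f b by simp
    have e2: "?A' \<oplus> d n \<otimes> (\<theta> n \<otimes> f n b) = \<zero>"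
      using Suc.prems(4)[OF f(2)[OF b]] Sc[of "\<lambda>j. \<theta> j \<otimes> f j b"] f b \<theta> by simp
    have "\<theta> n \<otimes> (?A \<oplus> d n \<otimes> f n b) = \<theta> n \<otimes> ?A \<oplus> d n \<otimes> (\<theta> n \<otimes> f n b)"
      using c f b \<theta> Suc.prems(2) Suc.prems(3)[of n n] by (simp add: r_distr flip: m_assoc)
    then have "\<theta> n \<otimes> ?A \<oplus> d n \<otimes> (\<theta> n \<otimes> f n b) = ?A' \<oplus> d n \<otimes> (\<theta> n \<otimes> f n b)"
      unfolding e1 e2 using \<theta> by simp
    then have eq: "\<theta> n \<otimes> ?A = ?A'"
      using c f b \<theta> Suc.prems(2) by (simp add: add.right_cancel)
    have "(\<Oplus>j\<in>{..<n}. d' j \<otimes> f j b) = (\<Oplus>j\<in>{..<n}. d j \<otimes> (\<theta> j \<otimes> f j b) \<oplus> (\<ominus> \<theta> n) \<otimes> (d j \<otimes> f j b))"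
    proof (rule finsum_cong')
      fix j assume "j \<in> {..<n}"
      have "\<theta> n \<otimes> (d j \<otimes> f j b) = d j \<otimes> (\<theta> n \<otimes> f j b)"
        using f b \<theta> Suc.prems(2) Suc.prems(3)[of j n] by (simp flip: m_assoc)
      then show "d' j \<otimes> f j b = d j \<otimes> (\<theta> j \<otimes> f j b) \<oplus> (\<ominus> \<theta> n) \<otimes> (d j \<otimes> f j b)"
        unfolding d'_def using f b \<theta> Suc.prems(2)
        by (simp add: m_assoc l_distr_minus r_distr_minus) (simp add: minus_eq l_minus)
    qed (use f b \<theta> Suc.prems(2) in auto)
    also have "\<dots> = ?A' \<oplus> (\<Oplus>j\<in>{..<n}. (\<ominus> \<theta> n) \<otimes> (d j \<otimes> f j b))"
      using f b \<theta> Suc.prems(2) by (intro finsum_addf) auto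
    also have "(\<Oplus>j\<in>{..<n}. (\<ominus> \<theta> n) \<otimes> (d j \<otimes> f j b)) = (\<ominus> \<theta> n) \<otimes> ?A"
      using f b \<theta> Suc.prems(2) by (subst finsum_rdistr) auto
    finally show ?thesis using c \<theta> by (simp add: l_minus eq r_neg)
  qed
  have IH: "d j \<otimes> f j b = \<zero>" if "j < n" "b \<in> B" for j b
  proof -
    have "d' j \<otimes> f j b = \<zero>"
      by (rule Suc.IH[OF _ d'(1) d'comm d'sum that]) (use Suc.prems(1) in auto)
    then have "(\<theta> j \<ominus> \<theta> n) \<otimes> (d j \<otimes> f j b) = \<zero>"
      unfolding d'(2) using f that \<theta> Suc.prems(2) by (simp add: m_assoc)
    moreover have "\<theta> j \<ominus> \<theta> n \<noteq> \<zero>" using Suc.prems(1)[of j n] that \<theta> by (simp add: minus_unique_right)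
    ultimately show ?thesis using f that \<theta> Suc.prems(2) by (simp add: prod_zero)
  qed
  have "(\<Oplus>j\<in>{..<n}. d j \<otimes> f j b) = (\<Oplus>j\<in>{..<n}. \<zero>)"
    using IH Suc.prems(6) by (intro finsum_cong') auto
  then have "d n \<otimes> f n b = \<zero>"
    using Suc.prems(4)[OF Suc.prems(6)] Sc[of "\<lambda>j. f j b"] f Suc.prems(2,6) by (simp add: finsum_zero)
  then show ?case using IH Suc.prems(5,6) by (cases "j = n") auto
qed simp

lemma finite_imp_torsion:
  assumes "finite E" "x \<in> E" "E \<subseteq> carrier R" "\<And>u. u \<in> E \<Longrightarrow> u \<otimes> x \<in> E" "x \<noteq> \<zero>"
  shows "torsion R x"
proof -
  have xU: "x \<in> Units R" using assms by (auto simp: in_Units_iff)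
  have mem: "x [^] Suc n \<in> E" for n :: nat
    by (induction n) (use assms in auto)
  have "\<not> inj (\<lambda>n::nat. x [^] Suc n)"
  proof
    assume "inj (\<lambda>n::nat. x [^] Suc n)"
    then have "infinite (range (\<lambda>n::nat. x [^] Suc n))" by (simp add: finite_image_iff)
    moreover have "range (\<lambda>n::nat. x [^] Suc n) \<subseteq> E" using mem by (auto simp del: nat_pow_Suc)
    ultimately show False using finite_subset assms(1) by blast
  qed
  then obtain i j where ij: "i < j" "x [^] Suc i = x [^] Suc j"
  proof -
    obtain p q where pq: "x [^] Suc p = x [^] Suc q" "p \<noteq> q"
      using \<open>\<not> inj _\<close> unfolding inj_def by blast
    then show ?thesis using that[of p q] that[of q p] by (metis linorder_neqE_nat)
  qed
  have "x [^] Suc i \<otimes> x [^] (j - i) = x [^] (Suc i + (j - i))"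
    by (rule nat_pow_mult) (use xU in simp)
  also have "\<dots> = x [^] Suc j" using ij(1) by (simp del: nat_pow_Suc)
  also have "\<dots> = x [^] Suc i \<otimes> \<one>" using ij(2) xU by (simp del: nat_pow_Suc)
  finally have "x [^] Suc i \<otimes> x [^] (j - i) = x [^] Suc i \<otimes> \<one>" .
  moreover have "x [^] Suc i \<in> carrier R" "x [^] Suc i \<noteq> \<zero>"
    using Units_pow_closed[OF xU, of "Suc i"] unfolding in_Units_iff by blast+
  ultimately have "x [^] (j - i) = \<one>" using lcancel xU by blast
  then show ?thesis using ij by (auto simp: torsion_def intro!: exI[of _ "j - i"])
qed

text \<open>
  Wedderburn's theorem for a cyclic algebra: \<open>L\<close> is a finite field that contains \<open>a\<close> and \<open>y\<^sup>k\<close> and is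
  normalised by \<open>y\<close>. By Hilbert 90 and counting, the norm \<open>c \<mapsto> (c y)\<^sup>k y\<^sup>-\<^sup>k\<close> of \<open>L\<close> is onto the
  field fixed by \<open>y\<close>, so some \<open>u = c y\<close> satisfies \<open>u\<^sup>k = 1\<close> and hence \<open>1 + u + \<dots> + u\<^sup>k\<^sup>-\<^sup>1 = 0\<close>,
  contradicting the independence of the powers of \<open>y\<close> over \<open>L\<close>.
\<close>

lemma finite_eigenvector_commutes:
  assumes fin: "finite E" and E: "E \<subseteq> carrier R" "\<one> \<in> E"
      "\<And>u v. u \<in> E \<Longrightarrow> v \<in> E \<Longrightarrow> u \<oplus> v \<in> E" "\<And>u v. u \<in> E \<Longrightarrow> v \<in> E \<Longrightarrow> u \<otimes> v \<in> E" "\<zero> \<in> E"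
    and ay: "a \<in> E" "y \<in> E" "y \<noteq> \<zero>" "y \<otimes> a = a [^] (i::nat) \<otimes> y"
  shows "y \<otimes> a = a \<otimes> y"
proof (rule ccontr)
  assume ne: "y \<otimes> a \<noteq> a \<otimes> y"
  have tors: "torsion R u" if "u \<in> E" "u \<noteq> \<zero>" for u
    using finite_imp_torsion[OF fin that(1) E(1)] that E by blast
  have invE: "inv u \<in> E" if u: "u \<in> E" "u \<noteq> \<zero>" for u
  proof -
    obtain n :: nat where n: "n > 0" "u [^] n = \<one>" using tors[OF u] by (auto simp: torsion_def)
    have uc: "u \<in> carrier R" using u E by auto
    have "u [^] (n - 1) \<otimes> u = \<one>" using n by (cases n) auto
    then have "inv u = u [^] (n - 1)"
      using uc u in_Units_iff inv_unique'[of u "u [^] (n - 1)"] nat_pow_Suc2[of u "n - 1"] by simp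
    moreover have "u [^] m \<in> E" for m :: nat by (induction m) (use E u in auto)
    ultimately show ?thesis by simp
  qed
  have ac: "a \<in> carrier R" and yc: "y \<in> carrier R" using ay E by auto
  have yU: "y \<in> Units R" using ay yc by (simp add: in_Units_iff)
  \<comment> \<open>The length of the orbit of \<open>a\<close> under conjugation by
    \<open>y\<close>; below \<open>k\<close> the powers of \<open>y\<close> are independent over
    \<open>L\<close>.\<close>
  define k where "k = (LEAST k::nat. k > 0 \<and> y [^] k \<otimes> a = a \<otimes> y [^] k)"
  have "\<exists>k::nat. k > 0 \<and> y [^] k \<otimes> a = a \<otimes> y [^] k"
    using tors[OF ay(2,3)] ac by (auto simp: torsion_def intro: exI)
  then have k: "k > 0 \<and> y [^] k \<otimes> a = a \<otimes> y [^] k" unfolding k_def by (rule LeastI_ex)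
  have kmin: "y [^] j \<otimes> a \<noteq> a \<otimes> y [^] j" if "0 < j" "j < k" for j :: nat
    using not_less_Least[of j "\<lambda>k. k > 0 \<and> y [^] k \<otimes> a = a \<otimes> y [^] k"] that by (auto simp: k_def)
  define t where "t = y [^] k"
  have yjU: "y [^] j \<in> Units R" for j :: nat using yU by (rule Units_pow_closed)
  have yjE: "y [^] j \<in> E" for j :: nat by (induction j) (use E ay in auto)
  have iyE: "inv y \<in> E" using invE ay by blast
  have tU: "t \<in> Units R" and tE: "t \<in> E" using yjU yjE by (auto simp: t_def)
  have yt: "y \<otimes> t = t \<otimes> y" using yc unfolding t_def by (metis nat_pow_Suc nat_pow_Suc2)
  \<comment> \<open>\<open>L\<close> is the centre of the centraliser of \<open>a\<close> and
    \<open>t = y^k\<close> in \<open>E\<close>. In this form it is visibly commutative and closed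
    under the operations, without a description of its elements.\<close>
  define C where "C = {x \<in> E. x \<otimes> a = a \<otimes> x \<and> x \<otimes> t = t \<otimes> x}"
  define L where "L = {c \<in> C. \<forall>x\<in>C. c \<otimes> x = x \<otimes> c}"
  have Ec: "u \<in> carrier R" if "u \<in> E" for u using that E by auto
  have LE: "u \<in> E" if "u \<in> L" for u using that by (auto simp: L_def C_def)
  have Lc: "u \<in> carrier R" if "u \<in> L" for u using that LE Ec by blast
  have LU: "u \<in> Units R" if "u \<in> L" "u \<noteq> \<zero>" for u using that Lc by (simp add: in_Units_iff)
  have Lcomm: "u \<otimes> v = v \<otimes> u" if "u \<in> L" "v \<in> L" for u v using that unfolding L_def by blast
  have aC: "a \<in> C" "t \<in> C" using ay tE k by (auto simp: C_def t_def)
  have aL: "a \<in> L" "t \<in> L" "\<one> \<in> L" "\<zero> \<in> L" using aC E ac tU by (auto simp: L_def C_def)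
  have LI: "u \<in> L" if "u \<in> E" "\<And>x. x \<in> C \<Longrightarrow> u \<otimes> x = x \<otimes> u" for u
    using that aC by (auto simp: L_def C_def)
  have L_mult: "u \<otimes> v \<in> L" if "u \<in> L" "v \<in> L" for u v
  proof (rule LI)
    show "u \<otimes> v \<in> E" using that LE E by auto
    fix x assume x: "x \<in> C"
    then have "u \<otimes> x = x \<otimes> u" "v \<otimes> x = x \<otimes> v" "x \<in> carrier R" using that Ec by (auto simp: L_def C_def)
    then show "u \<otimes> v \<otimes> x = x \<otimes> (u \<otimes> v)" using that Lc by (metis m_assoc)
  qed
  have L_add: "u \<oplus> v \<in> L" if "u \<in> L" "v \<in> L" for u v
  proof (rule LI)
    show "u \<oplus> v \<in> E" using that LE E by auto
    fix x assume x: "x \<in> C"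
    then have "u \<otimes> x = x \<otimes> u" "v \<otimes> x = x \<otimes> v" "x \<in> carrier R" using that Ec by (auto simp: L_def C_def)
    then show "(u \<oplus> v) \<otimes> x = x \<otimes> (u \<oplus> v)" using that Lc by (simp add: l_distr r_distr)
  qed
  have L_inv: "inv u \<in> L" if "u \<in> L" "u \<noteq> \<zero>" for u
  proof (rule LI)
    show "inv u \<in> E" using that LE invE by auto
    fix x assume x: "x \<in> C"
    then have "u \<otimes> x = x \<otimes> u" "x \<in> carrier R" using that Ec by (auto simp: L_def C_def)
    then show "inv u \<otimes> x = x \<otimes> inv u" using inv_commutes LU that by blast
  qed
  \<comment> \<open>Conjugation by \<open>y\<close> turns \<open>a\<close> into
    \<open>a [^] i\<close>, with which \<open>x\<close> commutes too; this makes \<open>C\<close>,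
    and with it \<open>L\<close>, stable under \<open>y\<close>.\<close>
  have conjC: "inv y \<otimes> x \<otimes> y \<in> C" if x: "x \<in> C" for x
  proof -
    have xc: "x \<in> carrier R" "x \<in> E" "x \<otimes> a = a \<otimes> x" "x \<otimes> t = t \<otimes> x" using x Ec by (auto simp: C_def)
    have xai: "x \<otimes> a [^] i = a [^] i \<otimes> x"
    proof (induction i)
      case (Suc i)
      then show ?case using xc ac by (metis m_assoc nat_pow_Suc nat_pow_closed)
    qed (use xc in simp)
    have "(inv y \<otimes> x \<otimes> y) \<otimes> a = inv y \<otimes> (x \<otimes> (y \<otimes> a))" using xc yU ac by (simp add: m_assoc)
    also have "\<dots> = inv y \<otimes> (a [^] i \<otimes> x \<otimes> y)" using xc yU ac by (simp add: ay(4) xai flip: m_assoc)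
    also have "\<dots> = inv y \<otimes> (a [^] i \<otimes> y) \<otimes> (inv y \<otimes> x \<otimes> y)" using xc yU ac by (simp add: unit_simps)
    also have "\<dots> = a \<otimes> (inv y \<otimes> x \<otimes> y)" using xc yU ac by (simp add: unit_simps flip: ay(4))
    finally have 1: "(inv y \<otimes> x \<otimes> y) \<otimes> a = a \<otimes> (inv y \<otimes> x \<otimes> y)" .
    have iyt: "inv y \<otimes> t = t \<otimes> inv y" using inv_commutes[of y t] yU tU yt by simp
    have "(inv y \<otimes> x \<otimes> y) \<otimes> t = inv y \<otimes> (x \<otimes> t) \<otimes> y" using xc(1) yU tU by (simp add: m_assoc yt)
    also have "\<dots> = (inv y \<otimes> t) \<otimes> x \<otimes> y" unfolding xc(4) using xc(1) yU tU by (simp add: m_assoc)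
    also have "\<dots> = t \<otimes> (inv y \<otimes> x \<otimes> y)" using xc yU tU by (simp add: iyt m_assoc)
    finally show ?thesis using 1 xc E ay iyE by (auto simp: C_def)
  qed
  define s where "s j u = y [^] j \<otimes> u \<otimes> inv (y [^] j)" for j :: nat and u
  have sc: "s j u \<in> carrier R" if "u \<in> carrier R" for j u using that yjU by (simp add: s_def)
  have s_Suc: "s (Suc j) u = y \<otimes> s j u \<otimes> inv y" if "u \<in> carrier R" for j u
  proof -
    have "y [^] Suc j = y \<otimes> y [^] j" using yc by (rule nat_pow_Suc2)
    then show ?thesis unfolding s_def using that yjU[of j] yU by (simp add: unit_simps del: nat_pow_Suc)
  qed
  have s_mult: "s j (u \<otimes> v) = s j u \<otimes> s j v" if "u \<in> carrier R" "v \<in> carrier R" for j u v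
    using that yjU[of j] by (simp add: s_def unit_simps)
  have conjL: "y \<otimes> u \<otimes> inv y \<in> L" if u: "u \<in> L" for u
  proof (rule LI)
    show "y \<otimes> u \<otimes> inv y \<in> E" using LE u E ay iyE by auto
    fix x assume x: "x \<in> C"
    then have xc: "x \<in> carrier R" using Ec by (auto simp: C_def)
    have com: "u \<otimes> (inv y \<otimes> x \<otimes> y) = (inv y \<otimes> x \<otimes> y) \<otimes> u" using conjC[OF x] u by (auto simp: L_def)
    have "y \<otimes> u \<otimes> inv y \<otimes> x = y \<otimes> (u \<otimes> (inv y \<otimes> x \<otimes> y)) \<otimes> inv y"
      using xc Lc[OF u] yU by (simp add: unit_simps)
    also have "\<dots> = x \<otimes> (y \<otimes> u \<otimes> inv y)" unfolding com using xc Lc[OF u] yU by (simp add: unit_simps)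
    finally show "y \<otimes> u \<otimes> inv y \<otimes> x = x \<otimes> (y \<otimes> u \<otimes> inv y)" .
  qed
  have sL: "s j u \<in> L" if "u \<in> L" for j u
  proof (induction j)
    case 0
    then show ?case using that Lc by (simp add: s_def)
  next
    case (Suc j)
    then show ?case using conjL s_Suc Lc that by simp
  qed
  have s_nz: "s j u \<noteq> \<zero>" if "u \<in> carrier R" "u \<noteq> \<zero>" for j u
    using that yjU[of j] Units_inv_Units[OF yjU[of j]] by (auto simp: s_def prod_zero in_Units_iff)
  define \<sigma> where "\<sigma> u = y \<otimes> u \<otimes> inv y" for u
  have \<sigma>L: "\<sigma> u \<in> L" if "u \<in> L" for u using conjL that by (simp add: \<sigma>_def)
  have \<sigma>_mult: "\<sigma> (u \<otimes> v) = \<sigma> u \<otimes> \<sigma> v" if "u \<in> carrier R" "v \<in> carrier R" for u v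
    using that yU by (simp add: \<sigma>_def unit_simps)
  have \<sigma>_nz: "\<sigma> u \<noteq> \<zero>" if "u \<in> L" "u \<noteq> \<zero>" for u
    using that yU Lc Units_inv_Units[OF yU] by (auto simp: \<sigma>_def prod_zero in_Units_iff)
  \<comment> \<open>The conjugates of \<open>a\<close> under powers of \<open>y\<close>, the
    eigenvalues for the independence lemma; minimality of \<open>k\<close> makes the first
    \<open>k\<close> distinct.\<close>
  define \<theta> where "\<theta> j = s j a" for j
  have \<theta>L: "\<theta> j \<in> L" for j using sL aL by (simp add: \<theta>_def)
  have \<theta>_ne: "\<theta> p \<noteq> \<theta> q" if "p < k" "q < k" "p < q" for p q
  proof
    assume eq: "\<theta> p = \<theta> q"
    have "y [^] q = y [^] p \<otimes> y [^] (q - p)" using that yc by (simp add: nat_pow_mult)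
    then have "s q a = s p (s (q - p) a)" using yjU ac by (simp add: s_def unit_simps)
    then have "y [^] p \<otimes> a \<otimes> inv (y [^] p) = y [^] p \<otimes> s (q - p) a \<otimes> inv (y [^] p)"
      using eq by (simp add: \<theta>_def s_def)
    then have "inv (y [^] p) \<otimes> (y [^] p \<otimes> a \<otimes> inv (y [^] p)) \<otimes> y [^] p
      = inv (y [^] p) \<otimes> (y [^] p \<otimes> s (q - p) a \<otimes> inv (y [^] p)) \<otimes> y [^] p" by simp
    then have "a = s (q - p) a" using yjU[of p] ac sc[OF ac] by (simp add: unit_simps)
    then have "a \<otimes> y [^] (q - p) = s (q - p) a \<otimes> y [^] (q - p)" by simp
    also have "\<dots> = y [^] (q - p) \<otimes> a" using yjU[of "q - p"] ac by (simp add: s_def unit_simps)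
    finally have "y [^] (q - p) \<otimes> a = a \<otimes> y [^] (q - p)" by (rule sym)
    moreover have "0 < q - p" "q - p < k" using that by linarith+
    ultimately show False using kmin by blast
  qed
  have \<theta>_ne': "\<theta> p \<noteq> \<theta> q" if "p < k" "q < k" "p \<noteq> q" for p q
    using \<theta>_ne[of p q] \<theta>_ne[of q p] that by (metis nat_neq_iff)
  \<comment> \<open>The partial norm: the product of \<open>c\<close> and its first
    \<open>j - 1\<close> iterated images under \<open>\<sigma>\<close>. For \<open>j = k\<close> it
    is the norm \<open>N\<close>.\<close>
  define d where "d c j = (c \<otimes> y) [^] j \<otimes> inv (y [^] j)" for c and j :: nat
  have d0: "d c 0 = \<one>" for c by (simp add: d_def)
  have d_Suc: "d c (Suc j) = c \<otimes> \<sigma> (d c j)" if "c \<in> carrier R" for c j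
  proof -
    have 1: "(c \<otimes> y) [^] Suc j = c \<otimes> y \<otimes> (c \<otimes> y) [^] j" by (rule nat_pow_Suc2) (use that yc in simp)
    have 2: "y [^] Suc j = y \<otimes> y [^] j" using yc by (rule nat_pow_Suc2)
    show ?thesis unfolding d_def \<sigma>_def 1 2 using that yU yjU[of j] by (simp add: unit_simps)
  qed
  have dL: "d c j \<in> L" if "c \<in> L" for c j
    by (induction j) (use that aL d0 d_Suc Lc L_mult \<sigma>L in auto)
  have d_mult: "d (c \<otimes> c') j = d c j \<otimes> d c' j" if c: "c \<in> L" "c' \<in> L" for c c' j
  proof (induction j)
    case (Suc j)
    have s: "\<sigma> (d c j) \<in> L" "\<sigma> (d c' j) \<in> L" using dL \<sigma>L c by auto
    have "d (c \<otimes> c') (Suc j) = (c \<otimes> c') \<otimes> (\<sigma> (d c j) \<otimes> \<sigma> (d c' j))"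
      using c d_Suc L_mult Lc dL Suc by (simp add: \<sigma>_mult)
    also have "\<dots> = (c \<otimes> \<sigma> (d c j)) \<otimes> (c' \<otimes> \<sigma> (d c' j))"
      using Lcomm[OF c(2) s(1)] Lc[OF c(1)] Lc[OF c(2)] Lc[OF s(1)] Lc[OF s(2)] by (metis m_assoc m_closed)
    finally show ?case using d_Suc Lc c by simp
  qed (simp add: d0)
  have d_nz: "d c j \<noteq> \<zero>" if "c \<in> L" "c \<noteq> \<zero>" for c j
  proof (induction j)
    case (Suc j)
    then show ?case using that d_Suc Lc dL \<sigma>_nz \<sigma>L by (simp add: prod_zero)
  qed (simp add: d0 one_not_zero)
  have cy_pow: "(c \<otimes> y) [^] j = d c j \<otimes> y [^] j" if "c \<in> L" for c j
    using Lc[OF that] yjU[of j] yU by (simp add: d_def unit_simps)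
  \<comment> \<open>The term with \<open>j = 0\<close> equals 1 at \<open>b = \<one>\<close>, so
    such a relation cannot hold throughout \<open>B\<close>.\<close>
  have indep: False if "c \<in> L" and sum: "\<And>b. b \<in> B \<Longrightarrow> (\<Oplus>j\<in>{..<k}. d c j \<otimes> f j b) = \<zero>"
    and f: "\<And>j b. b \<in> B \<Longrightarrow> f j b \<in> carrier R" "\<And>b. b \<in> B \<Longrightarrow> a \<otimes> b \<in> B"
      "\<And>j b. b \<in> B \<Longrightarrow> f j (a \<otimes> b) = \<theta> j \<otimes> f j b" "\<one> \<in> B" "f 0 \<one> = \<one>" for c B f
  proof -
    have "d c 0 \<otimes> f 0 \<one> = \<zero>"
    proof (rule linear_independence_of_characters[where \<kappa> = "\<lambda>b. a \<otimes> b" and \<theta> = \<theta> and B = B and n = k and f = f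
          and d = "d c"])
      show "\<theta> i \<otimes> \<theta> j = \<theta> j \<otimes> \<theta> i" for i j using Lcomm \<theta>L by blast
      show "d c j \<otimes> \<theta> i = \<theta> i \<otimes> d c j" for i j using Lcomm \<theta>L dL that(1) by blast
    qed (use sum f k \<theta>L dL Lc \<theta>_ne' that(1) in auto)
    then show False using f d0 one_not_zero by simp
  qed
  define M where "M = (units_of R)\<lparr>carrier := L - {\<zero>}\<rparr>"
  have sgM: "subgroup (L - {\<zero>}) (units_of R)"
  proof (rule group.subgroupI[OF units_group])
    show "L - {\<zero>} \<subseteq> carrier (units_of R)" using LU by (auto simp: units_of_carrier)
    show "L - {\<zero>} \<noteq> {}" using aL one_not_zero by blast
    fix u assume u: "u \<in> L - {\<zero>}"
    then show "inv\<^bsub>units_of R\<^esub> u \<in> L - {\<zero>}"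
      using L_inv[of u] LU[of u] Units_inv_Units[of u] by (auto simp: units_of_inv in_Units_iff)
    fix v assume "v \<in> L - {\<zero>}"
    then show "u \<otimes>\<^bsub>units_of R\<^esub> v \<in> L - {\<zero>}"
      using u L_mult Lc by (auto simp: units_of_mult prod_zero)
  qed
  interpret M: group M unfolding M_def using sgM units_group group.subgroup_imp_group by blast
  have Mc: "u \<in> carrier M \<longleftrightarrow> u \<in> L \<and> u \<noteq> \<zero>" for u by (auto simp: M_def)
  have Mm: "u \<otimes>\<^bsub>M\<^esub> v = u \<otimes> v" "\<one>\<^bsub>M\<^esub> = \<one>" for u v by (auto simp: M_def units_of_def)
  have finM: "finite (carrier M)" using fin LE by (auto simp: Mc intro: finite_subset[of _ E])
  define N where "N c = d c k" for c
  \<comment> \<open>Hilbert 90 identifies the image of this map with the kernel of the norm; the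
    kernel of \<open>\<beta>\<close> consists of the elements of \<open>L\<close> fixed by
    \<open>y\<close>.\<close>
  define \<beta> where "\<beta> h = h \<otimes> inv (\<sigma> h)" for h
  have N: "group_hom M M N"
    by unfold_locales (auto simp: hom_def Mc Mm N_def dL d_nz d_mult)
  have \<sigma>U: "\<sigma> h \<in> Units R" if "h \<in> L" "h \<noteq> \<zero>" for h using that \<sigma>_nz \<sigma>L Lc by (simp add: in_Units_iff)
  have \<beta>L: "\<beta> h \<in> L \<and> \<beta> h \<noteq> \<zero>" if "h \<in> L" "h \<noteq> \<zero>" for h
    using that L_mult[of h "inv (\<sigma> h)"] L_inv[of "\<sigma> h"] \<sigma>L \<sigma>U[OF that] Units_inv_Units[OF \<sigma>U[OF that]] Lc
    by (auto simp: \<beta>_def prod_zero in_Units_iff)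
  have \<beta>: "group_hom M M \<beta>"
  proof unfold_locales
    have "\<beta> (g \<otimes> h) = \<beta> g \<otimes> \<beta> h" if "g \<in> L" "h \<in> L" "g \<noteq> \<zero>" "h \<noteq> \<zero>" for g h
    proof -
      have "\<beta> (g \<otimes> h) = g \<otimes> h \<otimes> (inv (\<sigma> h) \<otimes> inv (\<sigma> g))"
        using that \<sigma>U Lc by (simp add: \<beta>_def \<sigma>_mult inv_mult_Units)
      also have "\<dots> = g \<otimes> (h \<otimes> inv (\<sigma> h)) \<otimes> inv (\<sigma> g)" using that \<sigma>U Lc by (simp add: m_assoc)
      also have "\<dots> = g \<otimes> (inv (\<sigma> g) \<otimes> (h \<otimes> inv (\<sigma> h)))"
        using that \<sigma>U Lc Lcomm[of "h \<otimes> inv (\<sigma> h)" "inv (\<sigma> g)"] \<beta>L L_inv \<sigma>L \<sigma>_nz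
        by (simp add: m_assoc \<beta>_def)
      finally show ?thesis using that \<sigma>U Lc by (simp add: \<beta>_def m_assoc)
    qed
    then show "\<beta> \<in> hom M M" using \<beta>L by (auto simp: hom_def Mc Mm)
  qed
  interpret N: group_hom M M N by (rule N)
  interpret \<beta>: group_hom M M \<beta> by (rule \<beta>)
  have hilbert90: "\<beta> ` carrier M = kernel M M N"
  proof
    show "\<beta> ` carrier M \<subseteq> kernel M M N"
    proof
      fix c assume "c \<in> \<beta> ` carrier M"
      then obtain h where h: "h \<in> L" "h \<noteq> \<zero>" "c = \<beta> h" by (auto simp: Mc)
      have hU: "h \<in> Units R" using LU h by auto
      have "c \<otimes> y = h \<otimes> y \<otimes> inv h" using h hU yU by (simp add: \<beta>_def \<sigma>_def unit_simps)
      then have "(c \<otimes> y) [^] k = h \<otimes> t \<otimes> inv h"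
      proof -
        have "(h \<otimes> y \<otimes> inv h) [^] j = h \<otimes> y [^] j \<otimes> inv h" for j :: nat
          using hU yU yjU by (induction j) (auto simp: unit_simps)
        then show ?thesis using \<open>c \<otimes> y = _\<close> by (simp add: t_def)
      qed
      also have "\<dots> = t" using Lcomm[OF h(1) aL(2)] hU tU by (simp add: unit_simps)
      finally have "N c = \<one>" using tU by (simp add: N_def d_def flip: t_def)
      then show "c \<in> kernel M M N" using \<beta>L h by (simp add: kernel_def Mc Mm)
    qed
    show "kernel M M N \<subseteq> \<beta> ` carrier M"
    proof
      fix c assume "c \<in> kernel M M N"
      then have c: "c \<in> L" "c \<noteq> \<zero>" "N c = \<one>" by (auto simp: kernel_def Mc Mm)
      have cc: "c \<in> carrier R" using Lc c by simp
      have cyk: "(c \<otimes> y) [^] k = t" using cy_pow[OF c(1), of k] c(3) tU by (simp add: N_def t_def)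
      \<comment> \<open>Lagrange resolvent. Because \<open>(c y)^k = t = y^k\<close>, the operator
        taking \<open>b\<close> to \<open>(c y) b y^-1\<close> has \<open>k\<close>-th power 1 on
        \<open>L\<close>, so the sum \<open>h b\<close> over its powers is fixed. Then
        \<open>c y h = h y\<close>, that is \<open>c = \<beta> h\<close>, and independence supplies
        a \<open>b\<close> for which \<open>h b\<close> is nonzero.\<close>
      define g where "g b j = (c \<otimes> y) [^] j \<otimes> b \<otimes> inv (y [^] j)" for b and j :: nat
      define h where "h b = (\<Oplus>j\<in>{..<k}. g b j)" for b
      have gd: "g b j = d c j \<otimes> s j b" if "b \<in> L" for b j
        using Lc[OF that] yjU[of j] Lc[OF dL[OF c(1)]] cy_pow[OF c(1)] by (simp add: g_def s_def m_assoc)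
      have gL: "g b j \<in> L" if "b \<in> L" for b j using gd that dL[OF c(1)] sL L_mult by simp
      have hL: "h b \<in> L" if "b \<in> L" for b
      proof -
        have "(\<Oplus>j\<in>A. g b j) \<in> L" if "finite A" for A
          using that
        proof (induction A rule: finite_induct)
          case (insert j A)
          then show ?case using gL[OF \<open>b \<in> L\<close>] Lc L_add by (subst finsum_insert) auto
        qed (use aL in simp)
        then show ?thesis by (simp add: h_def)
      qed
      have cyh: "c \<otimes> y \<otimes> h b = h b \<otimes> y" if b: "b \<in> L" for b
      proof -
        have gc: "g b j \<in> carrier R" for j using gL b Lc by blast
        have gS: "c \<otimes> y \<otimes> g b j \<otimes> inv y = g b (Suc j)" for j
        proof -
          have 1: "(c \<otimes> y) [^] Suc j = c \<otimes> y \<otimes> (c \<otimes> y) [^] j" by (rule nat_pow_Suc2) (use cc yc in simp)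
          have 2: "y [^] Suc j = y \<otimes> y [^] j" using yc by (rule nat_pow_Suc2)
          show ?thesis unfolding g_def 1 2 using cc Lc[OF b] yU yjU[of j] by (simp add: unit_simps)
        qed
        have "c \<otimes> y \<otimes> h b \<otimes> inv y = (\<Oplus>j\<in>{..<k}. c \<otimes> y \<otimes> g b j \<otimes> inv y)"
          unfolding h_def using gc cc yU by (simp add: finsum_rdistr finsum_ldistr)
        also have "\<dots> = h b" unfolding gS h_def
        proof (rule finsum_rotate)
          have "g b k = t \<otimes> b \<otimes> inv t" unfolding g_def cyk by (simp add: t_def)
          also have "\<dots> = b" using Lcomm[OF aL(2) b] Lc[OF b] tU by (simp add: unit_simps)
          finally show "g b k = g b 0" using Lc[OF b] by (simp add: g_def)
        qed (use gc in auto)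
        finally have "c \<otimes> y \<otimes> h b \<otimes> inv y \<otimes> y = h b \<otimes> y" by simp
        then show ?thesis using cc yU Lc[OF hL[OF b]] by (simp add: unit_simps)
      qed
      have "\<exists>b\<in>L. h b \<noteq> \<zero>"
      proof (rule ccontr)
        assume "\<not> (\<exists>b\<in>L. h b \<noteq> \<zero>)"
        then have z: "(\<Oplus>j\<in>{..<k}. d c j \<otimes> s j b) = \<zero>" if "b \<in> L" for b
          using that gd by (simp add: h_def)
        have s\<theta>: "s j (a \<otimes> b) = \<theta> j \<otimes> s j b" if "b \<in> L" for b j
          using that Lc ac by (simp add: \<theta>_def s_mult)
        show False
          by (rule indep[OF c(1), of L s]) (use z s\<theta> aL L_mult sL Lc in \<open>auto simp: s_def\<close>)
      qed
      then obtain b where b: "b \<in> L" "h b \<noteq> \<zero>" by auto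
      have hU: "h b \<in> Units R" using LU hL b by auto
      have "\<beta> (h b) = h b \<otimes> (y \<otimes> inv (h b) \<otimes> inv y)"
        using hU yU by (simp add: \<beta>_def \<sigma>_def unit_simps)
      also have "\<dots> = c \<otimes> y \<otimes> h b \<otimes> (inv (h b) \<otimes> inv y)"
        unfolding cyh[OF b(1)] using hU yU by (simp add: m_assoc)
      also have "\<dots> = c" using hU yU cc by (simp add: unit_simps)
      finally show "c \<in> \<beta> ` carrier M" using hL b by (auto simp: Mc)
    qed
  qed
  \<comment> \<open>Since the kernel of \<open>N\<close> is the image of \<open>\<beta>\<close>, the
    image of \<open>N\<close> and the kernel of \<open>\<beta>\<close> have equal size; one contains
    the other.\<close>
  have "N ` carrier M = kernel M M \<beta>"
  proof (rule card_subset_eq)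
    show "finite (kernel M M \<beta>)" using finM by (simp add: kernel_def)
    show "N ` carrier M \<subseteq> kernel M M \<beta>"
    proof
      fix n assume "n \<in> N ` carrier M"
      then obtain c where c: "c \<in> L" "c \<noteq> \<zero>" "n = N c" by (auto simp: Mc)
      have cc: "c \<in> carrier R" and cU: "c \<in> Units R" using Lc LU c by auto
      have nL: "n \<in> L" "n \<noteq> \<zero>" using c dL d_nz by (auto simp: N_def)
      have nc: "n \<in> carrier R" using nL Lc by auto
      have nt: "(c \<otimes> y) [^] k = n \<otimes> t" using cy_pow c by (simp add: N_def t_def)
      have "c \<otimes> (y \<otimes> n) \<otimes> t = c \<otimes> y \<otimes> (c \<otimes> y) [^] k" using cc yc nc tU by (simp add: nt m_assoc)
      also have "\<dots> = (c \<otimes> y) [^] k \<otimes> (c \<otimes> y)" using cc yc by (metis m_closed nat_pow_Suc nat_pow_Suc2)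
      also have "\<dots> = n \<otimes> (t \<otimes> c) \<otimes> y" using cc yc nc tU by (simp add: nt m_assoc)
      also have "\<dots> = c \<otimes> (n \<otimes> y) \<otimes> t"
        using Lcomm[OF aL(2) c(1)] Lcomm[OF nL(1) c(1)] yt cc yc nc tU
        by (metis m_assoc m_closed Units_closed)
      finally have "c \<otimes> (y \<otimes> n) = c \<otimes> (n \<otimes> y)" using rcancel[of t] tU cc yc nc by (simp add: in_Units_iff)
      then have "y \<otimes> n = n \<otimes> y" using lcancel[of c] cc c yc nc by simp
      then have "\<sigma> n = n" using yU nc by (simp add: \<sigma>_def m_assoc)
      then have "\<beta> n = \<one>" using LU nL by (simp add: \<beta>_def)
      then show "n \<in> kernel M M \<beta>" using nL by (simp add: kernel_def Mc Mm)
    qed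
    have "card (kernel M M N) * card (N ` carrier M) = card (kernel M M \<beta>) * card (kernel M M N)"
      using N.card_kernel_image[OF finM] \<beta>.card_kernel_image[OF finM] hilbert90 by simp
    moreover have "card (kernel M M N) > 0"
      using finM subgroup.one_closed[OF N.subgroup_kernel] by (auto simp: card_gt_0_iff kernel_def)
    ultimately show "card (N ` carrier M) = card (kernel M M \<beta>)" by simp
  qed
  \<comment> \<open>As \<open>t\<close> commutes with \<open>y\<close>, its inverse is a norm
    \<open>N c\<close>, and then \<open>(c y)^k = N c t = 1\<close>.\<close>
  moreover have "inv t \<in> kernel M M \<beta>"
  proof -
    have t': "t \<noteq> \<zero>" "inv t \<in> L" "inv t \<in> Units R" using tU Units_inv_Units[OF tU] aL L_inv by (auto simp: in_Units_iff)
    have "inv t \<otimes> y = y \<otimes> inv t" using inv_commutes[OF tU yc] yt by simp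
    then have "\<sigma> (inv t) = inv t" using yU tU by (simp add: \<sigma>_def m_assoc flip: \<open>inv t \<otimes> y = _\<close>)
    then have "\<beta> (inv t) = \<one>" using t' by (simp add: \<beta>_def)
    then show ?thesis using t' by (auto simp: kernel_def Mc Mm in_Units_iff)
  qed
  ultimately have "inv t \<in> N ` carrier M" by (simp only:)
  then obtain c where c: "c \<in> L" "c \<noteq> \<zero>" "N c = inv t" by (auto simp: Mc)
  have cc: "c \<in> carrier R" and cU: "c \<in> Units R" using Lc LU c by auto
  define u where "u = c \<otimes> y"
  have uc: "u \<in> carrier R" using cc yc by (simp add: u_def)
  have uk: "u [^] k = \<one>" using cy_pow[OF c(1), of k] c(3) tU by (simp add: N_def t_def u_def)
  have "u \<noteq> \<one>"
  proof
    assume "u = \<one>"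
    then have "inv c = y" using cU yc uk unfolding u_def by (metis Units_cancel(1) r_one Units_inv_closed)
    then have "y \<in> L" using L_inv c by metis
    then show False using Lcomm aL ne by blast
  qed
  then have sum0: "(\<Oplus>j\<in>{..<k}. u [^] j) = \<zero>" using geometric_zero uc uk by blast
  \<comment> \<open>The vanishing geometric sum in \<open>u\<close>, rewritten with coefficients
    \<open>d c j\<close> on the powers of \<open>y\<close>, is a relation of the kind excluded by
    \<open>indep\<close>.\<close>
  have "(\<Oplus>j\<in>{..<k}. d c j \<otimes> (y [^] j \<otimes> b)) = \<zero>" if b: "b \<in> carrier R" for b
  proof -
    have "(\<Oplus>j\<in>{..<k}. d c j \<otimes> (y [^] j \<otimes> b)) = (\<Oplus>j\<in>{..<k}. u [^] j \<otimes> b)"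
    proof (rule finsum_cong')
      show "d c j \<otimes> (y [^] j \<otimes> b) = u [^] j \<otimes> b" for j
        using cy_pow[OF c(1), of j] Lc[OF dL[OF c(1)], of j] yc b by (simp add: u_def m_assoc)
    qed (use uc b in auto)
    also have "\<dots> = (\<Oplus>j\<in>{..<k}. u [^] j) \<otimes> b" using uc b by (subst finsum_ldistr) auto
    finally show ?thesis using sum0 b by simp
  qed
  moreover have "y [^] j \<otimes> (a \<otimes> b) = \<theta> j \<otimes> (y [^] j \<otimes> b)" if "b \<in> carrier R" for j b
    using that ac yjU[of j] by (simp add: \<theta>_def s_def unit_simps)
  ultimately show False
    by (intro indep[OF c(1), of "carrier R" "\<lambda>j b. y [^] j \<otimes> b"]) (use ac yc in auto)
qed

text \<open>Nonzero elements of \<open>E\<close> have finite order. If \<open>x\<close> failed to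
  commute with \<open>y\<close>, Fourier inversion would produce an eigenvector of \<open>x\<close>
  inside \<open>E\<close> that does not commute with \<open>x\<close>, contrary to the cyclic
  case.\<close>

lemma finite_subring_commutes:
  assumes fin: "finite E" and E: "E \<subseteq> carrier R" "\<one> \<in> E"
      "\<And>u v. u \<in> E \<Longrightarrow> v \<in> E \<Longrightarrow> u \<oplus> v \<in> E" "\<And>u v. u \<in> E \<Longrightarrow> v \<in> E \<Longrightarrow> u \<otimes> v \<in> E" "\<zero> \<in> E"
    and xy: "x \<in> E" "y \<in> E"
  shows "x \<otimes> y = y \<otimes> x"
proof (rule ccontr)
  assume ne: "x \<otimes> y \<noteq> y \<otimes> x"
  have c: "x \<in> carrier R" "y \<in> carrier R" using xy E by auto
  then have "x \<noteq> \<zero>" using ne by auto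
  then have "torsion R x" using finite_imp_torsion[OF fin xy(1) E(1)] E xy by blast
  then have "\<exists>z\<in>E. \<exists>i::nat. z \<noteq> \<zero> \<and> z \<otimes> x = x [^] i \<otimes> z \<and> z \<otimes> x \<noteq> x \<otimes> z"
    by (intro exists_eigenvector[of x y E] c ne xy E) auto
  then obtain z and i :: nat where z: "z \<in> E" "z \<noteq> \<zero>" "z \<otimes> x = x [^] i \<otimes> z"
    and "z \<otimes> x \<noteq> x \<otimes> z" by blast
  have "z \<otimes> x = x \<otimes> z"
    by (rule finite_eigenvector_commutes[OF fin E xy(1) z])
  then show False using \<open>z \<otimes> x \<noteq> x \<otimes> z\<close> by contradiction
qed

end

subsection \<open>Finitely generated additive subgroups\<close>

text \<open>Splitting off the last generator lets the elimination arguments run by induction on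
  \<open>h\<close>.\<close>

primrec zspan :: "('a, 'b) ring_scheme \<Rightarrow> (nat \<Rightarrow> 'a) \<Rightarrow> nat \<Rightarrow> 'a set" where
  "zspan R e 0 = {\<zero>\<^bsub>R\<^esub>}"
| "zspan R e (Suc h) = {g \<oplus>\<^bsub>R\<^esub> ofi R n \<otimes>\<^bsub>R\<^esub> e h | g n. g \<in> zspan R e h}"

text \<open>The notion of integrality, with \<open>P\<close> as the set of admissible denominators.
  If \<open>P n\<close> says that \<open>n\<close> is nonzero in \<open>R\<close>, these are the
  elements acting on the rational span; if it says that a prime \<open>l\<close> does not divide
  \<open>n\<close>, the elements integral at \<open>l\<close>.\<close>

definition stab :: "('a, 'b) ring_scheme \<Rightarrow> (int \<Rightarrow> bool) \<Rightarrow> (nat \<Rightarrow> 'a) \<Rightarrow> nat \<Rightarrow> 'a set" where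
  "stab R P e h = {x \<in> carrier R. \<exists>n. P n \<and> (\<forall>g\<in>zspan R e h. ofi R n \<otimes>\<^bsub>R\<^esub> (x \<otimes>\<^bsub>R\<^esub> g) \<in> zspan R e h)}"

locale zspan_ring = ring +
  fixes e :: "nat \<Rightarrow> 'a"
  assumes e_closed [simp]: "e i \<in> carrier R"
begin

lemma zspan_closed: "zspan R e h \<subseteq> carrier R"
  by (induction h) auto

lemma zspan_carrier: "g \<in> zspan R e h \<Longrightarrow> g \<in> carrier R"
  using zspan_closed by auto

lemma ofi_swap: "y \<in> carrier R \<Longrightarrow> ofi R m \<otimes> (ofi R n \<otimes> y) = ofi R n \<otimes> (ofi R m \<otimes> y)"
  by (rule ofi_lcomm) simp

lemma zspan_SucI: "g \<in> zspan R e h \<Longrightarrow> g \<oplus> ofi R n \<otimes> e h \<in> zspan R e (Suc h)"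
  by auto

lemma zspan_0: "\<zero> \<in> zspan R e h"
proof (induction h)
  case (Suc h)
  then show ?case using zspan_SucI[of \<zero> h 0] by simp
qed simp

lemma zspan_add: "x \<in> zspan R e h \<Longrightarrow> y \<in> zspan R e h \<Longrightarrow> x \<oplus> y \<in> zspan R e h"
proof (induction h arbitrary: x y)
  case (Suc h)
  then obtain g n g' n' where g: "g \<in> zspan R e h" "x = g \<oplus> ofi R n \<otimes> e h"
    "g' \<in> zspan R e h" "y = g' \<oplus> ofi R n' \<otimes> e h" by auto
  then have "x \<oplus> y = (g \<oplus> g') \<oplus> ofi R (n + n') \<otimes> e h"
    using zspan_carrier by (simp add: ofi_add l_distr a_ac)
  then show ?case using g Suc.IH by auto
qed auto

lemma zspan_mult: "x \<in> zspan R e h \<Longrightarrow> ofi R m \<otimes> x \<in> zspan R e h"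
proof (induction h arbitrary: x)
  case (Suc h)
  then obtain g n where g: "g \<in> zspan R e h" "x = g \<oplus> ofi R n \<otimes> e h" by auto
  then have "ofi R m \<otimes> x = (ofi R m \<otimes> g) \<oplus> ofi R (m * n) \<otimes> e h"
    using zspan_carrier by (simp add: ofi_mult r_distr m_assoc)
  then show ?case using g Suc.IH by auto
qed auto

lemma zspan_minus: "x \<in> zspan R e h \<Longrightarrow> \<ominus> x \<in> zspan R e h"
  using zspan_mult[of x h "- 1"] zspan_carrier[of x h] by (simp add: ofi_minus l_minus)

lemma zspan_diff: "x \<in> zspan R e h \<Longrightarrow> y \<in> zspan R e h \<Longrightarrow> x \<ominus> y \<in> zspan R e h"
  using zspan_add zspan_minus by (simp add: minus_eq)

lemma zspan_gen: "i < h \<Longrightarrow> e i \<in> zspan R e h"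
proof (induction h)
  case (Suc h)
  show ?case
  proof (cases "i = h")
    case True
    then show ?thesis using zspan_SucI[OF zspan_0, where h = h and n = 1] by (simp del: zspan.simps)
  next
    case False
    then have "e i \<in> zspan R e h" using Suc by auto
    then show ?thesis using zspan_SucI[of "e i" h 0] by simp
  qed
qed simp

lemma zspan_subsetI:
  assumes "\<zero> \<in> A" "\<And>x y. x \<in> A \<Longrightarrow> y \<in> A \<Longrightarrow> x \<oplus> y \<in> A" "\<And>n i. i < h \<Longrightarrow> ofi R n \<otimes> e i \<in> A"
  shows "zspan R e h \<subseteq> A"
  using assms(3) by (induction h) (use assms(1,2) in auto)

lemma finite_zspan:
  assumes "ofi R p = \<zero>" "p > 0"
  shows "finite (zspan R e h)"
proof (induction h)
  case (Suc h)
  have "ofi R n = ofi R (n mod p)" for n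
  proof -
    have "n = p * (n div p) + n mod p" by simp
    then have "ofi R n = ofi R (p * (n div p) + n mod p)" by simp
    also have "\<dots> = ofi R (n mod p)" using assms unfolding ofi_add ofi_mult by simp
    finally show ?thesis .
  qed
  then have "g \<oplus> ofi R n \<otimes> e h = (\<lambda>(g, n). g \<oplus> ofi R n \<otimes> e h) (g, n mod p)" for g n by simp
  moreover have "n mod p \<in> {0..<p}" for n using assms(2) by simp
  ultimately have "zspan R e (Suc h) \<subseteq> (\<lambda>(g, n). g \<oplus> ofi R n \<otimes> e h) ` (zspan R e h \<times> {0..<p})"
    unfolding zspan.simps by blast
  then show ?case using Suc by (meson finite_SigmaI finite_atLeastLessThan_int finite_imageI finite_subset)
qed simp

lemma stabI:
  assumes "x \<in> carrier R" "P n" "\<And>i. i < h \<Longrightarrow> ofi R n \<otimes> (x \<otimes> e i) \<in> zspan R e h"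
  shows "x \<in> stab R P e h"
proof -
  have "zspan R e h \<subseteq> {g \<in> carrier R. ofi R n \<otimes> (x \<otimes> g) \<in> zspan R e h}"
  proof (rule zspan_subsetI)
    fix m i assume "i < h"
    then have "ofi R m \<otimes> (ofi R n \<otimes> (x \<otimes> e i)) \<in> zspan R e h" using assms zspan_mult by blast
    moreover have "ofi R m \<otimes> (ofi R n \<otimes> (x \<otimes> e i)) = ofi R n \<otimes> (x \<otimes> (ofi R m \<otimes> e i))"
      using assms(1) by (simp add: ofi_lcomm[of x] ofi_swap)
    ultimately show "ofi R m \<otimes> e i \<in> {g \<in> carrier R. ofi R n \<otimes> (x \<otimes> g) \<in> zspan R e h}" by simp
  qed (use assms(1) zspan_0 zspan_add in \<open>auto simp: r_distr\<close>)
  then show ?thesis using assms by (auto simp: stab_def)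
qed

lemma stab_carrier: "x \<in> stab R P e h \<Longrightarrow> x \<in> carrier R"
  by (simp add: stab_def)

section \<open>Rings of elements with admissible denominators\<close>

context
  fixes P :: "int \<Rightarrow> bool"
  assumes P: "P 1" "\<And>m n. P m \<Longrightarrow> P n \<Longrightarrow> P (m * n)"
begin

lemma stab_ofi: "ofi R m \<in> stab R P e h"
  using P(1) zspan_mult by (auto simp: stab_def zspan_carrier intro!: exI[of _ 1])

lemma stab_one: "\<one> \<in> stab R P e h"
  using stab_ofi[of 1] by simp

lemma stab_zero: "\<zero> \<in> stab R P e h"
  using stab_ofi[of 0] by simp

lemma stab_mult:
  assumes "x \<in> stab R P e h" "y \<in> stab R P e h"
  shows "x \<otimes> y \<in> stab R P e h"
proof -
  obtain m n where m: "P m" "\<And>g. g \<in> zspan R e h \<Longrightarrow> ofi R m \<otimes> (x \<otimes> g) \<in> zspan R e h"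
    and n: "P n" "\<And>g. g \<in> zspan R e h \<Longrightarrow> ofi R n \<otimes> (y \<otimes> g) \<in> zspan R e h"
    using assms by (auto simp: stab_def)
  have c: "x \<in> carrier R" "y \<in> carrier R" using assms stab_carrier by auto
  have "ofi R (m * n) \<otimes> (x \<otimes> y \<otimes> g) \<in> zspan R e h" if g: "g \<in> zspan R e h" for g
  proof -
    have "ofi R (m * n) \<otimes> (x \<otimes> y \<otimes> g) = ofi R m \<otimes> (x \<otimes> (ofi R n \<otimes> (y \<otimes> g)))"
      using c zspan_carrier[OF g] by (simp add: ofi_mult m_assoc ofi_lcomm[of x])
    then show ?thesis using m(2)[OF n(2)[OF g]] by simp
  qed
  then show ?thesis using c P(2)[OF m(1) n(1)] by (auto simp: stab_def)
qed

lemma stab_add: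
  assumes "x \<in> stab R P e h" "y \<in> stab R P e h"
  shows "x \<oplus> y \<in> stab R P e h"
proof -
  obtain m n where m: "P m" "\<And>g. g \<in> zspan R e h \<Longrightarrow> ofi R m \<otimes> (x \<otimes> g) \<in> zspan R e h"
    and n: "P n" "\<And>g. g \<in> zspan R e h \<Longrightarrow> ofi R n \<otimes> (y \<otimes> g) \<in> zspan R e h"
    using assms by (auto simp: stab_def)
  have c: "x \<in> carrier R" "y \<in> carrier R" using assms stab_carrier by auto
  have "ofi R (m * n) \<otimes> ((x \<oplus> y) \<otimes> g) \<in> zspan R e h" if g: "g \<in> zspan R e h" for g
  proof -
    have "ofi R (m * n) \<otimes> ((x \<oplus> y) \<otimes> g) = ofi R n \<otimes> (ofi R m \<otimes> (x \<otimes> g)) \<oplus> ofi R m \<otimes> (ofi R n \<otimes> (y \<otimes> g))"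
      using c zspan_carrier[OF g] by (simp add: ofi_mult m_assoc ofi_swap l_distr r_distr)
    then show ?thesis using zspan_add zspan_mult m(2)[OF g] n(2)[OF g] by simp
  qed
  then show ?thesis using c P(2)[OF m(1) n(1)] by (auto simp: stab_def)
qed

lemma stab_minus: "x \<in> stab R P e h \<Longrightarrow> \<ominus> x \<in> stab R P e h"
  using stab_mult[OF stab_ofi[of "- 1"], of x h] stab_carrier[of x P h] by (simp add: ofi_minus l_minus)

lemma stab_diff: "x \<in> stab R P e h \<Longrightarrow> y \<in> stab R P e h \<Longrightarrow> x \<ominus> y \<in> stab R P e h"
  using stab_add stab_minus by (simp add: minus_eq)

lemma stab_pow: "x \<in> stab R P e h \<Longrightarrow> x [^] (n::nat) \<in> stab R P e h"
  by (induction n) (auto simp: stab_one stab_mult)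

lemma stab_ev: "x \<in> stab R P e h \<Longrightarrow> ev R x p \<in> stab R P e h"
proof (induction p)
  case (pCons a p)
  then show ?case using stab_carrier by (auto simp: ev_pCons intro!: stab_add stab_mult stab_ofi)
qed (simp add: stab_zero)

lemma stab_div:
  assumes "ofi R m \<otimes> x \<in> stab R P e h" "x \<in> carrier R" "P m"
  shows "x \<in> stab R P e h"
proof -
  obtain n where n: "P n" "\<And>g. g \<in> zspan R e h \<Longrightarrow> ofi R n \<otimes> (ofi R m \<otimes> x \<otimes> g) \<in> zspan R e h"
    using assms by (auto simp: stab_def)
  have "ofi R (n * m) \<otimes> (x \<otimes> g) \<in> zspan R e h" if g: "g \<in> zspan R e h" for g
    using n(2)[OF g] zspan_carrier[OF g] assms(2) by (simp add: ofi_mult m_assoc)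
  then show ?thesis using assms P(2)[OF n(1) assms(3)] by (auto simp: stab_def)
qed

end

text \<open>The factor \<open>x [^] t\<close> carries the induction over the coefficients: removing
  one lowers the degree and raises \<open>t\<close>.\<close>

lemma zspan_ev:
  assumes "x \<in> carrier R" "\<And>i. i \<le> n \<Longrightarrow> x [^] i \<in> zspan R e h"
  shows "degree q + t \<le> n \<Longrightarrow> x [^] t \<otimes> ev R x q \<in> zspan R e h"
proof (induction q arbitrary: t)
  case 0
  then show ?case using assms zspan_0 by simp
next
  case (pCons a q)
  have t: "x [^] t \<in> zspan R e h" using assms pCons by simp
  show ?case
  proof (cases "q = 0")
    case True
    then show ?thesis using assms t zspan_mult[OF t, of a] ofi_comm[of "x [^] t" a] by simp
  next
    case False
    have "x [^] Suc t \<otimes> ev R x q \<in> zspan R e h" using pCons.IH[of "Suc t"] pCons.prems False by simp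
    moreover have "x [^] t \<otimes> ev R x (pCons a q) = ofi R a \<otimes> x [^] t \<oplus> x [^] Suc t \<otimes> ev R x q"
      using assms by (simp add: ev_pCons r_distr m_assoc ofi_comm)
    ultimately show ?thesis using zspan_add zspan_mult[OF t, of a] by simp
  qed
qed

text \<open>Gaussian elimination without division: a vector \<open>x p\<close> with nonzero last
  coefficient \<open>n p\<close> is the pivot, and \<open>n p x i - n i x p\<close> involves only
  the first \<open>h\<close> generators.\<close>

lemma zspan_dependent:
  assumes "finite I" "card I > h" "\<And>i. i \<in> I \<Longrightarrow> x i \<in> zspan R e h"
    and char0: "\<And>n. n \<noteq> 0 \<Longrightarrow> ofi R n \<noteq> \<zero>"
  shows "\<exists>c. (\<exists>i\<in>I. c i \<noteq> (0::int)) \<and> (\<Oplus>i\<in>I. ofi R (c i) \<otimes> x i) = \<zero>"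
  using assms(1-3)
proof (induction h arbitrary: I x)
  case 0
  then obtain i where "i \<in> I" by force
  moreover have "(\<Oplus>i\<in>I. ofi R 1 \<otimes> x i) = (\<Oplus>i\<in>I. \<zero>)"
    using 0 by (intro finsum_cong') auto
  ultimately show ?case by (intro exI[of _ "\<lambda>_. 1"]) (auto simp: finsum_zero)
next
  case (Suc h)
  have "\<forall>i\<in>I. \<exists>g n. g \<in> zspan R e h \<and> x i = g \<oplus> ofi R n \<otimes> e h" using Suc.prems(3) by simp blast
  then obtain g n where gn: "\<And>i. i \<in> I \<Longrightarrow> g i \<in> zspan R e h"
    "\<And>i. i \<in> I \<Longrightarrow> x i = g i \<oplus> ofi R (n i) \<otimes> e h" by metis
  have xc: "x i \<in> carrier R" if "i \<in> I" for i using Suc.prems(3)[OF that] zspan_carrier by blast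
  have gc: "g i \<in> carrier R" if "i \<in> I" for i using gn(1)[OF that] zspan_carrier by blast
  show ?case
  proof (cases "\<forall>i\<in>I. n i = 0")
    case True
    then have "x i \<in> zspan R e h" if "i \<in> I" for i using gn that gc by simp
    then show ?thesis using Suc.IH[of I x] Suc.prems by simp
  next
    case False
    then obtain p where p: "p \<in> I" "n p \<noteq> 0" by auto
    define I' where "I' = I - {p}"
    define x' where "x' i = ofi R (n p) \<otimes> x i \<ominus> ofi R (n i) \<otimes> x p" for i
    have x': "x' i = ofi R (n p) \<otimes> g i \<ominus> ofi R (n i) \<otimes> g p" if i: "i \<in> I'" for i
    proof -
      have iI: "i \<in> I" using i by (simp add: I'_def)
      have e1: "ofi R (n p) \<otimes> x i = ofi R (n p) \<otimes> g i \<oplus> ofi R (n p * n i) \<otimes> e h"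
        using gn(2)[OF iI] gc[OF iI] by (simp add: r_distr ofi_mult m_assoc)
      have e2: "ofi R (n i) \<otimes> x p = ofi R (n i) \<otimes> g p \<oplus> ofi R (n p * n i) \<otimes> e h"
        using gn(2)[OF p(1)] gc[OF p(1)] by (simp add: r_distr ofi_mult m_assoc mult.commute[of "n p"])
      have "(u \<oplus> w) \<ominus> (v \<oplus> w) = u \<ominus> v" if "u \<in> carrier R" "v \<in> carrier R" "w \<in> carrier R" for u v w
        using diff_eq_swap[of v u "u \<oplus> w" "v \<oplus> w"] diff_eq_swap[of v "u \<oplus> w" u "v \<oplus> w"] that by (simp add: a_ac)
      then show ?thesis unfolding x'_def e1 e2 using gc[OF iI] gc[OF p(1)] by simp
    qed
    have "x' i \<in> zspan R e h" if i: "i \<in> I'" for i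
      unfolding x'[OF i] using i gn(1) p by (intro zspan_diff zspan_mult) (auto simp: I'_def)
    moreover have "finite I'" "card I' > h" using Suc.prems p by (auto simp: I'_def)
    ultimately obtain c where c: "\<exists>i\<in>I'. c i \<noteq> 0" "(\<Oplus>i\<in>I'. ofi R (c i) \<otimes> x' i) = \<zero>"
      using Suc.IH[of I' x'] by auto
    define s where "s = (\<Sum>i\<in>I'. c i * n i)"
    \<comment> \<open>Unfolding \<open>x'\<close> collects the coefficient \<open>- s\<close> at the
      pivot and scales the others by \<open>n p\<close>, which keeps a nonzero one nonzero.\<close>
    define c' where "c' i = (if i = p then - s else c i * n p)" for i
    have fin: "finite I'" and pI: "p \<notin> I'" "I = insert p I'" using Suc.prems p by (auto simp: I'_def)
    have xc': "x i \<in> carrier R" if "i \<in> I'" for i using that xc pI by auto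
    have "(\<Oplus>i\<in>J. ofi R (c i) \<otimes> x' i) = (\<Oplus>i\<in>J. ofi R (c' i) \<otimes> x i) \<ominus> ofi R (\<Sum>i\<in>J. c i * n i) \<otimes> x p"
      if "finite J" "J \<subseteq> I'" for J
      using that
    proof (induction J rule: finite_induct)
      case empty
      then show ?case using xc p by (simp add: minus_eq)
    next
      case (insert j J)
      have j: "j \<noteq> p" "x j \<in> carrier R" using insert pI xc' by auto
      let ?A = "\<Oplus>i\<in>J. ofi R (c' i) \<otimes> x i" and ?s = "\<Sum>i\<in>J. c i * n i"
      have A: "?A \<in> carrier R" using insert xc' by (intro finsum_closed) auto
      have "(\<Oplus>i\<in>insert j J. ofi R (c i) \<otimes> x' i) = ofi R (c j) \<otimes> x' j \<oplus> (?A \<ominus> ofi R ?s \<otimes> x p)"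
        using insert xc' xc p by (subst finsum_insert) (auto simp: x'_def)
      also have "ofi R (c j) \<otimes> x' j = ofi R (c' j) \<otimes> x j \<ominus> ofi R (c j * n j) \<otimes> x p"
        using j xc p by (simp add: x'_def c'_def r_distr_minus ofi_mult m_assoc)
      also have "\<dots> \<oplus> (?A \<ominus> ofi R ?s \<otimes> x p) = (ofi R (c' j) \<otimes> x j \<oplus> ?A) \<ominus> ofi R (c j * n j + ?s) \<otimes> x p"
        using j xc p A by (simp add: minus_eq ofi_add l_distr minus_add a_ac)
      also have "ofi R (c' j) \<otimes> x j \<oplus> ?A = (\<Oplus>i\<in>insert j J. ofi R (c' i) \<otimes> x i)"
        using insert xc' by (subst finsum_insert) auto
      finally show ?case using insert by simp
    qed
    from this[OF fin subset_refl] c(2)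
    have eq: "(\<Oplus>i\<in>I'. ofi R (c' i) \<otimes> x i) \<ominus> ofi R s \<otimes> x p = \<zero>" by (simp add: s_def)
    have "(\<Oplus>i\<in>I. ofi R (c' i) \<otimes> x i) = ofi R (c' p) \<otimes> x p \<oplus> (\<Oplus>i\<in>I'. ofi R (c' i) \<otimes> x i)"
      unfolding pI(2) using fin pI(1) xc' xc p by (intro finsum_insert) auto
    also have "\<dots> = (\<Oplus>i\<in>I'. ofi R (c' i) \<otimes> x i) \<ominus> ofi R s \<otimes> x p"
      using xc' xc p by (simp add: c'_def ofi_minus l_minus minus_eq a_comm)
    finally have "(\<Oplus>i\<in>I. ofi R (c' i) \<otimes> x i) = \<zero>" using eq by simp
    moreover have "\<exists>i\<in>I. c' i \<noteq> 0" using c(1) p pI by (auto simp: c'_def)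
    ultimately show ?thesis by blast
  qed
qed

text \<open>Nakayama's lemma at \<open>l\<close> by elimination. In the last relation
  \<open>e h\<close> has coefficient \<open>s - l n\<close>, still prime to \<open>l\<close>, so
  that multiple of \<open>e h\<close> lies in \<open>l\<close> times the span of the other
  generators. Substituting it restores the hypothesis for one generator fewer.\<close>

lemma zspan_nakayama:
  assumes "prime (l::int)" "\<not> l dvd s"
    and "\<And>i. i < h \<Longrightarrow> \<exists>g\<in>zspan R e h. ofi R s \<otimes> e i = ofi R l \<otimes> g"
  shows "\<exists>s'. \<not> l dvd s' \<and> (\<forall>i<h. ofi R s' \<otimes> e i = \<zero>)"
  using assms(2,3)
proof (induction h arbitrary: s)
  case 0
  then show ?case by auto
next
  case (Suc h)
  from Suc.prems(2)[of h] obtain g n where g: "g \<in> zspan R e h"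
    "ofi R s \<otimes> e h = ofi R l \<otimes> (g \<oplus> ofi R n \<otimes> e h)" by auto
  have gc: "g \<in> carrier R" using g zspan_carrier by blast
  define t where "t = s - l * n"
  have tl: "\<not> l dvd t" using Suc.prems(1) by (simp add: t_def dvd_diff_left_iff)
  have te: "ofi R t \<otimes> e h = ofi R l \<otimes> g"
  proof -
    have "ofi R t \<otimes> e h = ofi R s \<otimes> e h \<ominus> ofi R l \<otimes> (ofi R n \<otimes> e h)"
      by (simp add: t_def ofi_diff ofi_mult l_distr_minus m_assoc)
    also have "\<dots> = (ofi R l \<otimes> g \<oplus> ofi R l \<otimes> (ofi R n \<otimes> e h)) \<ominus> ofi R l \<otimes> (ofi R n \<otimes> e h)"
      unfolding g(2) using gc by (simp add: r_distr)
    also have "\<dots> = ofi R l \<otimes> g" using gc by (simp add: minus_eq a_assoc r_neg)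
    finally show ?thesis .
  qed
  have "\<exists>g\<in>zspan R e h. ofi R (t * s) \<otimes> e i = ofi R l \<otimes> g" if i: "i < h" for i
  proof -
    from Suc.prems(2)[of i] i obtain g' n' where g': "g' \<in> zspan R e h"
      "ofi R s \<otimes> e i = ofi R l \<otimes> (g' \<oplus> ofi R n' \<otimes> e h)" by auto
    have gc': "g' \<in> carrier R" using g' zspan_carrier by blast
    have "ofi R (t * s) \<otimes> e i = ofi R t \<otimes> (ofi R l \<otimes> (g' \<oplus> ofi R n' \<otimes> e h))"
      by (simp add: ofi_mult m_assoc flip: g'(2))
    also have "\<dots> = ofi R l \<otimes> (ofi R t \<otimes> g' \<oplus> ofi R n' \<otimes> (ofi R t \<otimes> e h))"
      using gc' by (simp add: r_distr ofi_swap)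
    also have "\<dots> = ofi R l \<otimes> (ofi R t \<otimes> g' \<oplus> ofi R n' \<otimes> (ofi R l \<otimes> g))" by (simp only: te)
    finally show ?thesis using g' g
      by (intro bexI[of _ "ofi R t \<otimes> g' \<oplus> ofi R n' \<otimes> (ofi R l \<otimes> g)"] zspan_add zspan_mult) auto
  qed
  moreover have "\<not> l dvd t * s" using tl Suc.prems(1) assms(1) by (simp add: prime_dvd_mult_iff)
  ultimately obtain s' where s': "\<not> l dvd s'" "\<And>i. i < h \<Longrightarrow> ofi R s' \<otimes> e i = \<zero>"
    using Suc.IH[of "t * s"] by blast
  \<comment> \<open>What kills the first \<open>h\<close> generators kills \<open>g\<close>, and
    therefore also \<open>t e h = l g\<close>.\<close>
  have "zspan R e h \<subseteq> {g \<in> carrier R. ofi R s' \<otimes> g = \<zero>}"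
    by (rule zspan_subsetI) (auto simp: r_distr ofi_swap[of _ s'] s'(2))
  then have "ofi R s' \<otimes> g = \<zero>" using g by auto
  then have "ofi R s' \<otimes> (ofi R t \<otimes> e h) = \<zero>" unfolding te using gc by (simp add: ofi_swap[of g s' l])
  then have h: "ofi R (s' * t) \<otimes> e h = \<zero>" by (simp add: ofi_mult m_assoc)
  have "ofi R (s' * t) \<otimes> e i = \<zero>" if "i < h" for i
    using s'(2)[OF that] by (simp add: mult.commute[of s' t] ofi_mult m_assoc)
  then have "\<forall>i<Suc h. ofi R (s' * t) \<otimes> e i = \<zero>" using h by (auto simp: less_Suc_eq)
  moreover have "\<not> l dvd s' * t" using tl s' assms(1) by (simp add: prime_dvd_mult_iff)
  ultimately show ?case by blast
qed

end

subsection \<open>Torsion in a one-parameter family\<close>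

text \<open>Turns \<open>(V + 1)^k = V^k\<close> into an expression of \<open>k V^(k-1)\<close> by
  lower powers, which bounds the powers needed in \<open>torsion_family\<close>.\<close>

lemma linear_power_lower:
  assumes "k \<ge> 2"
  shows "degree ([:1, 1::int:] ^ k - monom 1 k - monom (int k) (k - 1)) \<le> k - 2"
proof (rule degree_le, intro allI impI)
  fix i assume i: "k - 2 < i"
  have c: "coeff ([:1, 1::int:] ^ k) i = int (k choose i)"
  proof (cases "i \<le> k")
    case False
    then show ?thesis using degree_linear_power[of "1::int" k] by (simp add: coeff_eq_0)
  qed (simp add: coeff_linear_poly_power)
  consider "i = k - 1" | "i = k" | "i > k" using i by linarith
  then show "coeff ([:1, 1::int:] ^ k - monom 1 k - monom (int k) (k - 1)) i = 0"
  proof cases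
    case 1
    have "k choose (k - 1) = k" using binomial_symmetric[of 1 k] assms by simp
    then show ?thesis using 1 c assms by (simp add: coeff_monom)
  qed (use c assms in \<open>auto simp: coeff_monom\<close>)
qed

text \<open>If \<open>l^v\<close> is the exact power of \<open>l\<close> in \<open>k\<close>, then
  \<open>c = l^(v+1)\<close>: the term \<open>k l X^(k-1)\<close> has exactly this valuation and all
  later ones a larger one. For \<open>l = 2\<close> this fails already at
  \<open>k = 2\<close>.\<close>

lemma power_add_prime_expansion:
  assumes l: "prime (l::nat)" "l \<ge> 3" and k: "k \<ge> 1"
  shows "\<exists>c s P. \<not> int l dvd s \<and> c \<noteq> 0 \<and>
    [:int l, 1:] ^ k - monom 1 k = [:c:] * (monom s (k - 1) + [:int l:] * P)"
proof -
  define v where "v = multiplicity l k"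
  obtain s where s: "k = l ^ v * s" "\<not> l dvd s"
    using multiplicity_decompose'[of k l] k l not_prime_unit by (metis v_def not_one_le_zero)
  have dvd: "l ^ (v + 2) dvd (k choose j) * l ^ j" if j: "j \<ge> 2" "j \<le> k" for j
  proof -
    define w where "w = multiplicity l j"
    obtain j' where j': "j = l ^ w * j'" "\<not> l dvd j'"
      using multiplicity_decompose'[of j l] j l not_prime_unit by (metis w_def not_numeral_le_zero)
    \<comment> \<open>For \<open>w > 0\<close> this rests on \<open>3^w \<le> l^w \<le> j\<close>;
      here \<open>l \<ge> 3\<close> enters.\<close>
    have "w + 2 \<le> j"
    proof (cases "w = 0")
      case False
      then have "1 \<le> w" by simp
      then have "w + 2 \<le> 3 ^ w" by (induction w rule: nat_induct_at_least) auto
      also have "\<dots> \<le> l ^ w" using l by (intro power_mono) auto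
      also have "\<dots> \<le> j" using j' j by (metis dvd_imp_le dvd_triv_left not_numeral_le_zero not_gr_zero)
      finally show ?thesis .
    qed (use j in auto)
    show ?thesis
    proof (cases "v \<le> w")
      case True
      then have "l ^ (v + 2) dvd l ^ j" using \<open>w + 2 \<le> j\<close> by (intro le_imp_power_dvd) auto
      then show ?thesis by (rule dvd_mult)
    next
      case False
      \<comment> \<open>Absorption shows that \<open>l^(v - w)\<close> divides the binomial
        coefficient; the factor \<open>l^j\<close> with \<open>j \<ge> w + 2\<close> completes the
        exponent \<open>v + 2\<close>.\<close>
      have "j * (k choose j) = k * ((k - 1) choose (j - 1))"
        using times_binomial_minus1_eq[of j k] j by simp
      then have "l ^ w * (j' * (k choose j)) = l ^ w * (l ^ (v - w) * s * ((k - 1) choose (j - 1)))"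
        using s(1) j'(1) False by (simp add: mult.assoc power_add[symmetric] flip: mult.assoc)
      then have "j' * (k choose j) = l ^ (v - w) * (s * ((k - 1) choose (j - 1)))"
        using l by (simp add: mult.assoc)
      then have "l ^ (v - w) dvd j' * (k choose j)" by simp
      moreover have "coprime (l ^ (v - w)) j'" using j'(2) l by (simp add: prime_imp_coprime)
      ultimately have "l ^ (v - w) dvd (k choose j)" by (simp add: coprime_dvd_mult_right_iff)
      moreover have "l ^ (w + 2) dvd l ^ j" using \<open>w + 2 \<le> j\<close> by (intro le_imp_power_dvd)
      ultimately have "l ^ (v - w) * l ^ (w + 2) dvd (k choose j) * l ^ j" by (rule mult_dvd_mono)
      moreover have "l ^ (v - w) * l ^ (w + 2) = l ^ (v + 2)" using False by (simp flip: power_add)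
      ultimately show ?thesis by (simp only:)
    qed
  qed
  define f where "f j = of_nat (k choose j) * [:int l:] ^ j * [:0, 1::int:] ^ (k - j)" for j
  have "[:int l, 1:] ^ k = (\<Sum>j\<le>k. f j)"
    using binomial_ring[of "[:int l:]" "[:0, 1::int:]" k] by (simp add: f_def)
  moreover have "{..k} = insert 0 (insert 1 {2..k})" using k by auto
  moreover have "f 0 = monom 1 k" by (simp add: f_def monom_altdef)
  moreover have "f 1 = monom (int (k * l)) (k - 1)"
    by (simp add: f_def monom_altdef of_nat_poly mult.commute)
  ultimately have eq: "[:int l, 1:] ^ k - monom 1 k = monom (int (k * l)) (k - 1) + sum f {2..k}" by simp
  have "[:int l ^ (v + 2):] dvd sum f {2..k}"
  proof (rule dvd_sum)
    fix j assume j: "j \<in> {2..k}"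
    then have "int (l ^ (v + 2)) dvd int ((k choose j) * l ^ j)" using dvd by (simp only: int_dvd_int_iff) simp
    then obtain q where "int ((k choose j) * l ^ j) = int l ^ (v + 2) * q" by (auto elim: dvdE)
    moreover have "of_nat (k choose j) * [:int l:] ^ j = [:int ((k choose j) * l ^ j):]"
      by (simp add: of_nat_poly poly_const_pow)
    moreover have "[:int l ^ (v + 2) * q:] = [:int l ^ (v + 2):] * [:q:]" by simp
    ultimately have "f j = [:int l ^ (v + 2):] * ([:q:] * [:0, 1:] ^ (k - j))"
      unfolding f_def by (simp only: mult.assoc)
    then show "[:int l ^ (v + 2):] dvd f j" by (rule dvdI)
  qed
  then obtain P where P: "sum f {2..k} = [:int l ^ (v + 2):] * P" by (auto elim: dvdE)
  have "[:int l, 1:] ^ k - monom 1 k = [:int l ^ (v + 1):] * (monom (int s) (k - 1) + [:int l:] * P)"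
    unfolding eq P by (subst s(1)) (simp add: smult_add_right smult_monom mult.commute power_add power2_eq_square)
  moreover have "\<not> int l dvd int s" using s(2) by simp
  moreover have "int l ^ (v + 1) \<noteq> 0" using l by auto
  ultimately show ?thesis by blast
qed

context skew_field
begin

text \<open>
  With \<open>y = inv u\<close> and \<open>V = u b + c d\<close> one has \<open>w V = V + c\<close>, so \<open>w\<^sup>k = 1\<close> turns into
  \<open>(V + c)\<^sup>k = V\<^sup>k\<close>, whose leading coefficient \<open>k c\<close> is nonzero for the exact order \<open>k\<close> of \<open>w\<close>.
\<close>

lemma torsion_quotient_power:
  assumes u: "u \<in> Units R" and \<mu>: "\<mu> \<in> carrier R" "\<mu> \<noteq> \<one>"
    and v: "\<one> \<oplus> ofi R c \<otimes> (\<mu> \<otimes> inv u) \<in> Units R"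
    and tors: "torsion R ((\<one> \<oplus> ofi R c \<otimes> inv u) \<otimes> inv (\<one> \<oplus> ofi R c \<otimes> (\<mu> \<otimes> inv u)))"
  shows "\<exists>k::nat. k > 0 \<and> ofi R (int k) \<noteq> \<zero> \<and>
    (let V = u \<otimes> inv (\<one> \<ominus> \<mu>) \<oplus> ofi R c \<otimes> (\<mu> \<otimes> inv (\<one> \<ominus> \<mu>)) in
      (V \<oplus> ofi R c) [^] k = V [^] k)"
proof -
  define y where "y = inv u"
  define b where "b = inv (\<one> \<ominus> \<mu>)"
  define v where "v = \<one> \<oplus> ofi R c \<otimes> (\<mu> \<otimes> y)"
  define w where "w = (\<one> \<oplus> ofi R c \<otimes> y) \<otimes> inv v"
  define V where "V = u \<otimes> b \<oplus> ofi R c \<otimes> (\<mu> \<otimes> b)"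
  have nz: "\<one> \<ominus> \<mu> \<in> Units R" using \<mu> by (auto simp: in_Units_iff minus_unique_right)
  have yU: "y \<in> Units R" and bU: "b \<in> Units R" and vU: "v \<in> Units R"
    using u nz v by (simp_all add: y_def b_def v_def)
  have yu: "y \<otimes> u = \<one>" using u by (simp add: y_def)
  have c: "V \<in> carrier R" "w \<in> carrier R" using u bU vU \<mu> yU by (simp_all add: V_def w_def)
  have Vv: "V = v \<otimes> (u \<otimes> b)"
    using u bU \<mu> yU yu by (simp add: V_def v_def l_distr m_assoc Units_cancel y_def)
  have VU: "V \<in> Units R" unfolding Vv using u bU vU by (intro Units_m_closed)
  have b1: "b \<ominus> \<mu> \<otimes> b = \<one>"
    using \<mu> bU Units_r_inv[OF nz] l_distr_minus[of \<one> \<mu> b] by (simp add: b_def)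
  have "w \<otimes> V = (\<one> \<oplus> ofi R c \<otimes> y) \<otimes> (u \<otimes> b)"
    unfolding w_def Vv using u bU vU yU by (simp add: m_assoc Units_cancel)
  also have "\<dots> = u \<otimes> b \<oplus> ofi R c \<otimes> b"
    using u bU yU yu by (simp add: l_distr m_assoc Units_cancel y_def)
  also have "\<dots> = V \<oplus> ofi R c"
  proof -
    have "b = \<mu> \<otimes> b \<oplus> \<one>" using diff_eq_swap[of "\<mu> \<otimes> b" \<one> b \<zero>] b1 bU \<mu>
      by (metis Units_closed a_comm add.inv_solve_right' m_closed minus_eq one_closed)
    then have "ofi R c \<otimes> b = ofi R c \<otimes> (\<mu> \<otimes> b) \<oplus> ofi R c"
      using bU \<mu> by (metis Units_closed m_closed ofi_closed one_closed r_distr r_one)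
    then show ?thesis using u bU \<mu> by (simp add: V_def a_assoc)
  qed
  finally have wV: "w \<otimes> V = V \<oplus> ofi R c" .
  \<comment> \<open>Integers are central, so \<open>V\<close> commutes with
    \<open>w V = V + c\<close>; cancelling \<open>V\<close> shows that it commutes with
    \<open>w\<close>, as the power of the product requires.\<close>
  have comm: "w \<otimes> V = V \<otimes> w"
  proof -
    have "(V \<otimes> w) \<otimes> V = V \<otimes> (V \<oplus> ofi R c)" using c by (simp add: m_assoc wV)
    also have "\<dots> = (w \<otimes> V) \<otimes> V" using c by (simp add: wV r_distr l_distr ofi_comm)
    finally show ?thesis using rcancel[of V "V \<otimes> w" "w \<otimes> V"] VU c by (simp add: in_Units_iff)
  qed
  have "torsion R w" using tors by (simp add: w_def v_def y_def)
  then obtain k :: nat where k: "k > 0" "w [^] k = \<one>" "ofi R (int k) \<noteq> \<zero>"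
    using torsion_orderE c by blast
  have "(V \<oplus> ofi R c) [^] k = w [^] k \<otimes> V [^] k"
    unfolding wV[symmetric] using comm c by (intro pow_mult_distrib)
  also have "\<dots> = V [^] k" using k c by simp
  finally show ?thesis using k unfolding V_def b_def by (intro exI[of _ k]) (simp add: Let_def)
qed

text \<open>The powers of \<open>z\<close> up to exponent \<open>h\<close>, cleared of denominators,
  are \<open>h + 1\<close> vectors in a span of \<open>h\<close> generators, so \<open>z\<close> is
  a root of an integer polynomial. After removing factors \<open>X\<close> the constant term is
  nonzero, and that integer times \<open>inv z\<close> is a polynomial in \<open>z\<close>.\<close>

lemma inverse_in_stab:
  assumes "zspan_ring R e" and char0: "\<And>n. n \<noteq> 0 \<Longrightarrow> ofi R n \<noteq> \<zero>"
    and z: "z \<in> stab R (\<lambda>n. ofi R n \<noteq> \<zero>) e h" "z \<noteq> \<zero>" and one: "\<one> \<in> zspan R e h"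
  shows "inv z \<in> stab R (\<lambda>n. ofi R n \<noteq> \<zero>) e h"
proof -
  let ?P = "\<lambda>n. ofi R n \<noteq> \<zero>"
  interpret zspan_ring R e by fact
  have P: "?P 1" "\<And>m n. ?P m \<Longrightarrow> ?P n \<Longrightarrow> ?P (m * n)"
    by (auto simp: one_not_zero ofi_mult prod_zero)
  have zc: "z \<in> carrier R" using z stab_carrier by blast
  have "\<exists>n. ?P n \<and> ofi R n \<otimes> z [^] i \<in> zspan R e h" for i :: nat
  proof -
    have "z [^] i \<in> stab R ?P e h" using stab_pow[OF P z(1)] .
    then obtain n where "?P n" "ofi R n \<otimes> (z [^] i \<otimes> \<one>) \<in> zspan R e h"
      using one unfolding stab_def by blast
    then show ?thesis using zc by auto
  qed
  then obtain n where n: "\<And>i. ?P (n i)" "\<And>i::nat. ofi R (n i) \<otimes> z [^] i \<in> zspan R e h" by metis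
  obtain c where c: "\<exists>i\<in>{..h}. c i \<noteq> 0" "(\<Oplus>i\<in>{..h}. ofi R (c i) \<otimes> (ofi R (n i) \<otimes> z [^] i)) = \<zero>"
    using zspan_dependent[of "{..h}" h "\<lambda>i. ofi R (n i) \<otimes> z [^] i"] n char0 by auto
  define f where "f = (\<Sum>i\<le>h. monom (c i * n i) i)"
  have "ev R z (\<Sum>i\<in>A. monom (c i * n i) i) = (\<Oplus>i\<in>A. ofi R (c i) \<otimes> (ofi R (n i) \<otimes> z [^] i))" if "finite A" for A
    using that zc
  proof (induction A rule: finite_induct)
    case (insert i A)
    have "ev R z (monom (c i * n i) i) = ofi R (c i) \<otimes> (ofi R (n i) \<otimes> z [^] i)"
      using zc by (simp add: monom_altdef ev_smult ev_power ofi_mult m_assoc)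
    then show ?case using insert zc by (simp add: ev_add finsum_insert)
  qed simp
  then have fz: "ev R z f = \<zero>" using c(2) by (simp add: f_def)
  have "coeff f i = c i * n i" if "i \<le> h" for i using that by (simp add: f_def coeff_sum coeff_monom)
  moreover have "n i \<noteq> 0" for i using n(1)[of i] by auto
  ultimately have "f \<noteq> 0" using c(1) by auto
  have "\<exists>g. ev R z g = \<zero> \<and> coeff g 0 \<noteq> 0" using fz \<open>f \<noteq> 0\<close>
  proof (induction f)
    case (pCons a f)
    show ?case
    proof (cases "a = 0")
      case True
      then have "ev R z f = \<zero>" "f \<noteq> 0" using pCons.prems pCons.hyps zc z by (auto simp: ev_pCons prod_zero)
      then show ?thesis using pCons.IH by blast
    next
      case False
      then show ?thesis using pCons.prems by (intro exI[of _ "pCons a f"]) auto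
    qed
  qed simp
  then obtain g where g: "ev R z g = \<zero>" "coeff g 0 \<noteq> 0" by blast
  obtain a q where aq: "g = pCons a q" by (cases g)
  have zU: "z \<in> Units R" using z zc by (simp add: in_Units_iff)
  have "ofi R a \<oplus> z \<otimes> ev R z q = \<zero>" using g aq zc by (simp add: ev_pCons)
  then have "ofi R a = \<ominus> (z \<otimes> ev R z q)" using zc by (simp add: minus_equality a_comm)
  then have "inv z \<otimes> ofi R a = \<ominus> ev R z q"
    using zc zU by (simp add: r_minus Units_cancel)
  then have "ofi R a \<otimes> inv z = \<ominus> ev R z q" using zU by (simp add: ofi_comm)
  then have "ofi R a \<otimes> inv z \<in> stab R ?P e h" using stab_minus[OF P stab_ev[OF P z(1)]] by simp
  then show ?thesis using stab_div[OF P] zU char0[of a] g aq by auto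
qed

text \<open>
  In characteristic 0 left multiplications by \<open>z\<close>, \<open>inv z\<close>, \<open>d\<close> are \<open>l\<close>-integral for a large prime \<open>l\<close>; then
  \<open>(V + l)\<^sup>k = V\<^sup>k\<close> for \<open>V = z + l d\<close> would make the unit \<open>z\<close> nilpotent modulo \<open>l\<close>.
\<close>

lemma char0_contradiction:
  assumes "zspan_ring R e" and char0: "\<And>n. n \<noteq> 0 \<Longrightarrow> ofi R n \<noteq> \<zero>"
    and z: "z \<in> stab R (\<lambda>n. ofi R n \<noteq> \<zero>) e h" "z \<noteq> \<zero>"
    and d: "d \<in> stab R (\<lambda>n. ofi R n \<noteq> \<zero>) e h" and one: "0 < h" "e 0 = \<one>"
    and pow: "\<And>l::nat. l > 0 \<Longrightarrow> \<exists>k::nat. k > 0 \<and>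
      (z \<oplus> ofi R (int l) \<otimes> d \<oplus> ofi R (int l)) [^] k = (z \<oplus> ofi R (int l) \<otimes> d) [^] k"
  shows False
proof -
  interpret zspan_ring R e by fact
  let ?E = "stab R (\<lambda>n. ofi R n \<noteq> \<zero>) e h"
  have "\<one> \<in> zspan R e h" using zspan_gen[of 0 h] one by simp
  then have iz: "inv z \<in> ?E" using inverse_in_stab[OF assms(1) char0 z] by blast
  have den: "\<exists>n. n \<noteq> 0 \<and> (\<forall>g\<in>zspan R e h. ofi R n \<otimes> (x \<otimes> g) \<in> zspan R e h)" if "x \<in> ?E" for x
  proof -
    obtain n where n: "ofi R n \<noteq> \<zero>" "\<forall>g\<in>zspan R e h. ofi R n \<otimes> (x \<otimes> g) \<in> zspan R e h"
      using \<open>x \<in> ?E\<close> unfolding stab_def by blast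
    then have "n \<noteq> 0" using ofi_0 by metis
    then show ?thesis using n by blast
  qed
  obtain n1 n2 n3 where n: "n1 \<noteq> 0" "n2 \<noteq> 0" "n3 \<noteq> 0"
      "\<forall>g\<in>zspan R e h. ofi R n1 \<otimes> (z \<otimes> g) \<in> zspan R e h"
      "\<forall>g\<in>zspan R e h. ofi R n2 \<otimes> (inv z \<otimes> g) \<in> zspan R e h"
      "\<forall>g\<in>zspan R e h. ofi R n3 \<otimes> (d \<otimes> g) \<in> zspan R e h"
    using den[OF z(1)] den[OF iz] den[OF d] by blast
  \<comment> \<open>Exceeding the three denominators makes \<open>z\<close>, \<open>inv z\<close>
    and \<open>d\<close> integral at \<open>l\<close>; the summand 2 secures
    \<open>l \<ge> 3\<close> for the binomial expansion.\<close>
  obtain l where l: "prime l" "l > nat (\<bar>n1\<bar> + \<bar>n2\<bar> + \<bar>n3\<bar>) + 2" using bigger_prime by blast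
  have ndvd: "\<not> int l dvd m" if "m \<noteq> 0" "\<bar>m\<bar> \<le> \<bar>n1\<bar> + \<bar>n2\<bar> + \<bar>n3\<bar>" for m
    using zdvd_imp_le[of "int l" "\<bar>m\<bar>"] that l by auto
  have c: "z \<in> carrier R" "d \<in> carrier R" using z d stab_carrier by auto
  have zU: "z \<in> Units R" using z c by (simp add: in_Units_iff)
  let ?P = "\<lambda>n. \<not> int l dvd n"
  let ?S = "stab R ?P e h"
  have pl: "prime (int l)" using l by simp
  have P: "?P 1" "\<And>m n. ?P m \<Longrightarrow> ?P n \<Longrightarrow> ?P (m * n)"
    using pl by (auto simp: prime_dvd_mult_iff not_prime_unit)
  have zS: "z \<in> ?S" and izS: "inv z \<in> ?S" and dS: "d \<in> ?S"
    using n(4-6) c zU ndvd[OF n(1)] ndvd[OF n(2)] ndvd[OF n(3)] Units_inv_closed[OF zU]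
    unfolding stab_def by fastforce+
  let ?l = "ofi R (int l)"
  define V where "V = z \<oplus> ?l \<otimes> d"
  obtain k :: nat where k: "k > 0" "(V \<oplus> ?l) [^] k = V [^] k" using pow[of l] l by (auto simp: V_def)
  have Vc: "V \<in> carrier R" using c by (simp add: V_def)
  have VS: "V \<in> ?S" unfolding V_def using stab_add[OF P zS stab_mult[OF P stab_ofi[OF P] dS]] .
  obtain a s p where exp: "\<not> int l dvd s" "a \<noteq> 0"
    "[:int l, 1:] ^ k - monom 1 k = [:a:] * (monom s (k - 1) + [:int l:] * p)"
    using power_add_prime_expansion[of l k] l k by auto
  have "ev R V ([:int l, 1:] ^ k - monom 1 k) = (V \<oplus> ?l) [^] k \<ominus> V [^] k"
    using Vc by (simp add: ev_diff ev_power ev_pCons monom_altdef ev_smult a_comm)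
  also have "\<dots> = \<zero>" using k Vc by (simp add: minus_unique_right)
  finally have "ofi R a \<otimes> (ofi R s \<otimes> V [^] (k - 1) \<oplus> ?l \<otimes> ev R V p) = \<zero>"
    unfolding exp(3) using Vc by (simp add: ev_mult ev_add ev_smult ev_power monom_altdef)
  then have e1: "ofi R s \<otimes> V [^] (k - 1) \<oplus> ?l \<otimes> ev R V p = \<zero>"
    using char0[OF exp(2)] Vc by (simp add: prod_zero)
  \<comment> \<open>\<open>V\<close> and \<open>z\<close> are congruent modulo \<open>l\<close>,
    hence so are their powers.\<close>
  have "\<exists>x\<in>?S. V [^] j = z [^] j \<oplus> ?l \<otimes> x" for j :: nat
  proof (induction j)
    case 0
    then show ?case using stab_zero[OF P] by (intro bexI[of _ \<zero>]) auto
  next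
    case (Suc j)
    then obtain x where x: "x \<in> ?S" "V [^] j = z [^] j \<oplus> ?l \<otimes> x" by auto
    have xc: "x \<in> carrier R" using x stab_carrier by blast
    have "V [^] Suc j = V [^] j \<otimes> z \<oplus> V [^] j \<otimes> (?l \<otimes> d)"
      using Vc c by (simp add: r_distr flip: V_def) (simp add: V_def r_distr Vc)
    also have "\<dots> = (z [^] j \<oplus> ?l \<otimes> x) \<otimes> z \<oplus> ?l \<otimes> (V [^] j \<otimes> d)"
      using Vc c x by (simp add: ofi_lcomm[of "V [^] j"] flip: x(2))
    also have "\<dots> = z [^] Suc j \<oplus> ?l \<otimes> (x \<otimes> z \<oplus> V [^] j \<otimes> d)"
      using Vc c xc by (simp add: l_distr r_distr m_assoc a_assoc)
    finally show ?case using stab_add[OF P stab_mult[OF P x(1) zS] stab_mult[OF P stab_pow[OF P VS] dS]]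
      by blast
  qed
  then obtain x where x: "x \<in> ?S" "V [^] (k - 1) = z [^] (k - 1) \<oplus> ?l \<otimes> x" by blast
  have xc: "x \<in> carrier R" using x stab_carrier by blast
  define X where "X = \<ominus> (ofi R s \<otimes> x \<oplus> ev R V p)"
  have XS: "X \<in> ?S" unfolding X_def
    by (rule stab_minus[OF P stab_add[OF P stab_mult[OF P stab_ofi[OF P] x(1)] stab_ev[OF P VS]]])
  have Xc: "X \<in> carrier R" using XS stab_carrier by blast
  have sz: "ofi R s \<otimes> z [^] (k - 1) = ?l \<otimes> X"
  proof -
    have "ofi R s \<otimes> z [^] (k - 1) \<oplus> ?l \<otimes> (ofi R s \<otimes> x \<oplus> ev R V p) = \<zero>"
      using e1 xc c Vc unfolding x(2) by (simp add: r_distr a_assoc ofi_swap)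
    then have "ofi R s \<otimes> z [^] (k - 1) = \<ominus> (?l \<otimes> (ofi R s \<otimes> x \<oplus> ev R V p))"
      using xc c Vc by (simp add: minus_equality a_comm)
    then show ?thesis using xc Vc by (simp add: X_def r_minus)
  qed
  \<comment> \<open>Since \<open>inv z\<close> is integral as well, the power of \<open>z\<close>
    cancels, and the integer \<open>s\<close>, prime to \<open>l\<close>, becomes \<open>l\<close>
    times an integral element.\<close>
  define Y where "Y = X \<otimes> inv z [^] (k - 1)"
  have YS: "Y \<in> ?S" unfolding Y_def using stab_mult[OF P XS stab_pow[OF P izS]] .
  have Yc: "Y \<in> carrier R" using YS stab_carrier by blast
  have zi: "z [^] j \<otimes> inv z [^] j = \<one>" for j :: nat
    using pow_mult_distrib[of z "inv z" j] zU by simp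
  have "ofi R s = ofi R s \<otimes> (z [^] (k - 1) \<otimes> inv z [^] (k - 1))" by (simp add: zi)
  also have "\<dots> = ?l \<otimes> Y" using sz c zU Xc by (simp add: Y_def flip: m_assoc)
  finally have sY: "ofi R s = ?l \<otimes> Y" .
  obtain t where t: "?P t" "\<And>g. g \<in> zspan R e h \<Longrightarrow> ofi R t \<otimes> (Y \<otimes> g) \<in> zspan R e h"
    using YS by (auto simp: stab_def)
  have "\<exists>g\<in>zspan R e h. ofi R (t * s) \<otimes> e i = ?l \<otimes> g" if "i < h" for i
  proof
    show "ofi R t \<otimes> (Y \<otimes> e i) \<in> zspan R e h" using t(2) zspan_gen[OF that] by blast
    show "ofi R (t * s) \<otimes> e i = ?l \<otimes> (ofi R t \<otimes> (Y \<otimes> e i))"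
      using Yc by (simp add: ofi_mult sY m_assoc ofi_swap)
  qed
  \<comment> \<open>By Nakayama an integer prime to \<open>l\<close> kills all generators, among
    them \<open>e 0 = \<one>\<close>.\<close>
  then obtain s' where "?P s'" "\<forall>i<h. ofi R s' \<otimes> e i = \<zero>"
    using zspan_nakayama[OF pl P(2)[OF t(1) exp(1)]] by blast
  then have "ofi R s' = \<zero>" "s' \<noteq> 0" using one by auto
  then show False using char0 by blast
qed

text \<open>The parameter \<open>c = 1\<close> gives \<open>(V + 1)^k = V^k\<close> for
  \<open>V = z + d\<close>, which bounds the powers of \<open>V\<close>. Together with
  \<open>u a = a^i u\<close> it makes the products \<open>a^s V^n\<close> span a finitely generated
  group on which \<open>a\<close>, \<open>V\<close> and then \<open>u\<close> act with denominators.
  In characteristic 0 the other parameters contradict this; in characteristic \<open>p\<close> the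
  ring acting on it is finite.\<close>

lemma torsion_family:
  assumes a: "a \<in> carrier R" "torsion R a" and u: "u \<in> Units R" "u \<otimes> a = a [^] (i::nat) \<otimes> u"
    and \<mu>: "\<mu> = a [^] (j::nat)" "\<mu> \<noteq> \<one>"
    and v: "\<And>c::nat. \<one> \<oplus> ofi R (int c) \<otimes> (\<mu> \<otimes> inv u) \<in> Units R"
    and tors: "\<And>c::nat. torsion R ((\<one> \<oplus> ofi R (int c) \<otimes> inv u) \<otimes>
        inv (\<one> \<oplus> ofi R (int c) \<otimes> (\<mu> \<otimes> inv u)))"
  shows "(\<exists>p. prime p \<and> ofi R (int p) = \<zero>) \<and> torsion R u"
proof -
  have aU: "a \<in> Units R" using torsion_Units a by blast
  have \<mu>c: "\<mu> \<in> carrier R" using a \<mu> by simp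
  define b where "b = inv (\<one> \<ominus> \<mu>)"
  define d where "d = \<mu> \<otimes> b"
  define z where "z = u \<otimes> b"
  have nz: "\<one> \<ominus> \<mu> \<in> Units R" using \<mu> \<mu>c by (auto simp: in_Units_iff minus_unique_right)
  have bU: "b \<in> Units R" using nz by (simp add: b_def)
  have c: "d \<in> carrier R" "z \<in> carrier R" "b \<in> carrier R" "u \<in> carrier R" using \<mu>c u bU by (auto simp: d_def z_def)
  have pow: "\<exists>k::nat. k > 0 \<and> ofi R (int k) \<noteq> \<zero> \<and>
      (z \<oplus> ofi R (int l) \<otimes> d \<oplus> ofi R (int l)) [^] k = (z \<oplus> ofi R (int l) \<otimes> d) [^] k" for l
    using torsion_quotient_power[OF u(1) \<mu>c \<mu>(2) v tors, of l]
    by (simp add: Let_def flip: b_def z_def d_def)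
  obtain m :: nat where m: "m > 0" "a [^] m = \<one>" using a by (auto simp: torsion_def)
  have "torsion R \<mu>"
    using m a by (auto simp: torsion_def \<mu>(1) nat_pow_pow mult.commute[of j] simp flip: nat_pow_pow[of a m j] intro!: exI[of _ m])
  then obtain r :: nat where r: "r > 0" "\<mu> [^] r = \<one>" "ofi R (int r) \<noteq> \<zero>" using torsion_orderE \<mu>c by blast
  define V where "V = z \<oplus> d"
  have Vc: "V \<in> carrier R" using c by (simp add: V_def)
  obtain k :: nat where k: "k > 0" "ofi R (int k) \<noteq> \<zero>" "(V \<oplus> \<one>) [^] k = V [^] k"
    using pow[of 1] c by (auto simp: V_def)
  have k2: "k \<ge> 2"
  proof (rule ccontr)
    assume "\<not> k \<ge> 2"
    then have "k = 1" using k by simp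
    then have "V \<oplus> \<one> = V \<oplus> \<zero>" using k Vc by simp
    then show False using Vc one_not_zero by (simp add: add.left_cancel)
  qed
  \<comment> \<open>The leading terms of \<open>(V + 1)^k = V^k\<close> cancel, so
    \<open>V [^] (k - 1)\<close> is the first power to be reduced. The generators \<open>e n\<close>
    below run through the powers of \<open>a\<close> below \<open>m\<close> times the powers of
    \<open>V\<close> below \<open>K\<close>.\<close>
  define K where "K = k - 1"
  define h where "h = K * m"
  define e where "e n = a [^] (n mod m) \<otimes> V [^] (n div m)" for n
  interpret zspan_ring R e by unfold_locales (use a Vc in \<open>simp add: e_def\<close>)
  let ?P = "\<lambda>n. ofi R n \<noteq> \<zero>"
  let ?E = "stab R ?P e h"
  let ?\<Gamma> = "zspan R e h"
  have P: "?P 1" "\<And>m n. ?P m \<Longrightarrow> ?P n \<Longrightarrow> ?P (m * n)"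
    by (auto simp: one_not_zero ofi_mult prod_zero)
  have am: "a [^] s = a [^] (s mod m)" for s :: nat
    by (rule pow_mod) (use a m in auto)
  have gen: "a [^] s \<otimes> V [^] n \<in> ?\<Gamma>" if "n < K" for s n :: nat
  proof -
    have "n * m + s mod m < h"
    proof -
      have "n * m + s mod m < n * m + m" using m by simp
      also have "\<dots> = Suc n * m" by simp
      also have "\<dots> \<le> K * m" using that by (intro mult_right_mono) auto
      finally show ?thesis by (simp add: h_def)
    qed
    moreover have "e (n * m + s mod m) = a [^] s \<otimes> V [^] n" using m am[of s] by (simp add: e_def)
    ultimately show ?thesis using zspan_gen by metis
  qed
  have e_form: "\<exists>(s::nat) n. n < K \<and> e l = a [^] s \<otimes> V [^] n" if "l < h" for l
  proof -
    have "l div m < K" using that m by (simp add: h_def less_mult_imp_div_less)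
    then show ?thesis unfolding e_def by blast
  qed
  have aE: "a \<in> ?E"
  proof (rule stabI[of _ _ 1])
    fix l assume "l < h"
    then obtain s n :: nat where "n < K" "e l = a [^] s \<otimes> V [^] n" using e_form by blast
    then have "a \<otimes> e l = a [^] Suc s \<otimes> V [^] n" using a Vc by (subst nat_pow_Suc2) (auto simp: m_assoc)
    then show "ofi R 1 \<otimes> (a \<otimes> e l) \<in> ?\<Gamma>" using gen[OF \<open>n < K\<close>, of "Suc s"] a Vc by simp
  qed (use a P in auto)
  have apE: "a [^] (s::nat) \<in> ?E" for s using stab_pow[OF P aE] .
  \<comment> \<open>Dividing \<open>1 + X + ... + X^(r-1) - r\<close> by \<open>X - 1\<close> and
    evaluating at \<open>\<mu>\<close> shows that \<open>r b\<close> is an integer polynomial in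
    \<open>\<mu>\<close>; so \<open>b\<close> has denominator \<open>r\<close>.\<close>
  have "poly ((\<Sum>n<r. monom 1 n) - [:int r:]) 1 = 0" by (simp add: poly_sum poly_monom)
  then have "[:- 1, 1:] dvd (\<Sum>n<r. monom 1 n) - [:int r:]" by (simp only: poly_eq_0_iff_dvd)
  then obtain q where q: "(\<Sum>n<r. monom 1 n) - [:int r:] = [:- 1, 1:] * q" by (rule dvdE)
  have rb: "ofi R (int r) \<otimes> b = ev R \<mu> q"
  proof -
    have "ev R \<mu> (\<Sum>n\<in>A. monom 1 n) = (\<Oplus>n\<in>A. \<mu> [^] n)" if "finite A" for A
      using that \<mu>c by (induction A rule: finite_induct)
        (auto simp: ev_add finsum_insert monom_altdef ev_power ev_smult)
    then have "ev R \<mu> (\<Sum>n<r. monom 1 n) = \<zero>" using geometric_zero \<mu>c r \<mu>(2) by simp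
    then have eq: "\<ominus> ofi R (int r) = \<ominus> ev R \<mu> q \<oplus> \<mu> \<otimes> ev R \<mu> q"
      using arg_cong[OF q, of "ev R \<mu>"] \<mu>c by (simp add: ev_diff ev_mult ev_pCons ofi_minus) (simp add: minus_eq a_comm)
    have "ofi R (int r) = \<ominus> (\<ominus> ofi R (int r))" by simp
    also have "\<dots> = ev R \<mu> q \<ominus> \<mu> \<otimes> ev R \<mu> q" unfolding eq using \<mu>c by (simp add: minus_add minus_eq)
    also have "\<dots> = (\<one> \<ominus> \<mu>) \<otimes> ev R \<mu> q" using \<mu>c l_distr_minus[of \<one> \<mu> "ev R \<mu> q"] by simp
    finally have "ofi R (int r) = (\<one> \<ominus> \<mu>) \<otimes> ev R \<mu> q" .
    then have "b \<otimes> ofi R (int r) = ev R \<mu> q" using nz \<mu>c by (simp add: b_def Units_cancel)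
    then show ?thesis using c ofi_comm by simp
  qed
  have \<mu>E: "\<mu> \<in> ?E" using apE \<mu> by simp
  have "b \<in> ?E" by (rule stab_div[OF P, where m = "int r"]) (use rb stab_ev[OF P \<mu>E] c r in auto)
  then have dE: "d \<in> ?E" using stab_mult[OF P \<mu>E] by (simp add: d_def)
  have la: "\<mu> \<otimes> a = a \<otimes> \<mu>" using a by (simp add: \<mu>(1)) (metis nat_pow_Suc nat_pow_Suc2)
  have ba: "b \<otimes> a = a \<otimes> b" unfolding b_def
    using nz a \<mu>c la by (intro inv_commutes) (auto simp: l_distr_minus r_distr_minus)
  have bas: "b \<otimes> a [^] s = a [^] s \<otimes> b" for s :: nat
  proof (induction s)
    case (Suc s)
    then show ?case using commute_mult[of "a [^] s" a b] ba a c by simp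
  qed (use c in simp)
  have uas: "u \<otimes> a [^] s = a [^] (i * s) \<otimes> u" for s :: nat
  proof (induction s)
    case (Suc s)
    have "u \<otimes> a [^] Suc s = (u \<otimes> a [^] s) \<otimes> a" using a c by (simp add: m_assoc)
    also have "\<dots> = a [^] (i * s) \<otimes> (u \<otimes> a)" unfolding Suc using a c by (simp add: m_assoc)
    also have "\<dots> = a [^] (i * Suc s) \<otimes> u"
      unfolding u(2) using a c by (simp add: nat_pow_mult add.commute flip: m_assoc)
    finally show ?case .
  qed (use c in simp)
  \<comment> \<open>The summand \<open>z\<close> moves past \<open>a\<close> as \<open>u\<close>
    does, whereas \<open>d\<close> commutes with \<open>a\<close>; the error term contains
    \<open>d\<close> but no further \<open>V\<close>.\<close>
  have Vas: "V \<otimes> a [^] s = a [^] (i * s) \<otimes> V \<oplus> d \<otimes> (a [^] s \<ominus> a [^] (i * s))" for s :: nat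
  proof -
    have das: "d \<otimes> a [^] t = a [^] t \<otimes> d" for t :: nat
      using commute_mult[of \<mu> b "a [^] t"] a c \<mu>c bas[of t] by (simp add: d_def \<mu>(1) nat_pow_mult add.commute)
    have "z \<otimes> a [^] s = a [^] (i * s) \<otimes> z"
      using a c bas[of s] uas[of s] by (simp add: z_def m_assoc) (simp flip: m_assoc)
    then have "V \<otimes> a [^] s = a [^] (i * s) \<otimes> z \<oplus> d \<otimes> a [^] s" using a c by (simp add: V_def l_distr)
    also have "\<dots> = a [^] (i * s) \<otimes> V \<oplus> (d \<otimes> a [^] s \<ominus> d \<otimes> a [^] (i * s))"
    proof -
      have *: "A \<oplus> C = A \<oplus> B \<oplus> (C \<ominus> B)" if "A \<in> carrier R" "B \<in> carrier R" "C \<in> carrier R" for A B C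
      proof -
        have "A \<oplus> B \<oplus> (C \<ominus> B) = A \<oplus> C \<oplus> (B \<oplus> \<ominus> B)" using that by (simp add: minus_eq a_ac)
        then show ?thesis using that by (simp add: r_neg)
      qed
      have "a [^] (i * s) \<otimes> V = a [^] (i * s) \<otimes> z \<oplus> a [^] (i * s) \<otimes> d"
        using a c by (simp add: V_def r_distr)
      then show ?thesis using a c unfolding das[of "i * s"] by (simp only:) (intro *, auto)
    qed
    also have "d \<otimes> a [^] s \<ominus> d \<otimes> a [^] (i * s) = d \<otimes> (a [^] s \<ominus> a [^] (i * s))"
      using a c by (simp add: r_distr_minus)
    finally show ?thesis .
  qed
  have VK: "ofi R (int k) \<otimes> V [^] K \<in> ?\<Gamma>"
  proof -
    define f where "f = [:1, 1::int:] ^ k - monom 1 k - monom (int k) (k - 1)"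
    have "ev R V f = ((V \<oplus> \<one>) [^] k \<ominus> V [^] k) \<ominus> ofi R (int k) \<otimes> V [^] K"
      using Vc by (simp add: f_def K_def ev_diff ev_power ev_pCons monom_altdef ev_smult a_comm)
    also have "\<dots> = \<ominus> (ofi R (int k) \<otimes> V [^] K)" using k Vc minus_unique_right[of "V [^] k" "V [^] k"]
      by (simp add: minus_eq)
    finally have "ofi R (int k) \<otimes> V [^] K = \<ominus> ev R V f" using Vc by simp
    moreover have "ev R V f \<in> ?\<Gamma>"
    proof -
      have "V [^] n \<in> ?\<Gamma>" if "n \<le> k - 2" for n
        using gen[of n 0] that k2 Vc by (simp add: K_def)
      then show ?thesis
        using zspan_ev[OF Vc, of "k - 2" h f 0] linear_power_lower[OF k2] Vc by (simp add: f_def)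
    qed
    ultimately show ?thesis using zspan_minus by simp
  qed
  have VE: "V \<in> ?E"
  proof -
    obtain nd where nd: "?P nd" "\<And>g. g \<in> ?\<Gamma> \<Longrightarrow> ofi R nd \<otimes> (d \<otimes> g) \<in> ?\<Gamma>" using dE by (auto simp: stab_def)
    have a\<Gamma>: "a [^] s \<otimes> g \<in> ?\<Gamma>" if g: "g \<in> ?\<Gamma>" for s :: nat and g
    proof -
      have sub: "?\<Gamma> \<subseteq> {g \<in> carrier R. a [^] s \<otimes> g \<in> ?\<Gamma>}"
      proof (rule zspan_subsetI)
        fix n l assume "l < h"
        then obtain s' n' :: nat where l: "n' < K" "e l = a [^] s' \<otimes> V [^] n'" using e_form by blast
        have "a [^] s \<otimes> e l = a [^] (s + s') \<otimes> V [^] n'"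
          using a Vc by (simp add: l nat_pow_mult flip: m_assoc)
        then have "a [^] s \<otimes> e l \<in> ?\<Gamma>" using gen[OF l(1)] by simp
        then show "ofi R n \<otimes> e l \<in> {g \<in> carrier R. a [^] s \<otimes> g \<in> ?\<Gamma>}"
          using a zspan_mult by (simp add: ofi_lcomm[of "a [^] s"])
      qed (use a zspan_0 zspan_add in \<open>auto simp: r_distr\<close>)
      then show ?thesis using g by blast
    qed
    \<comment> \<open>Multiplication by \<open>V\<close> needs the denominator \<open>nd\<close> for
      the error term and \<open>k\<close> for the overflow into \<open>V [^] K\<close>.\<close>
    show ?thesis
    proof (rule stabI[of _ _ "nd * int k"])
      show "?P (nd * int k)" using P nd k by blast
      fix l assume "l < h"
      then obtain s n :: nat where l: "n < K" "e l = a [^] s \<otimes> V [^] n" using e_form by blast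
      let ?x = "a [^] (i * s) \<otimes> V [^] Suc n" and ?y = "a [^] s \<otimes> V [^] n \<ominus> a [^] (i * s) \<otimes> V [^] n"
      have "V \<otimes> e l = (V \<otimes> a [^] s) \<otimes> V [^] n" using a Vc by (simp add: l m_assoc)
      also have "\<dots> = a [^] (i * s) \<otimes> (V \<otimes> V [^] n) \<oplus> d \<otimes> ?y"
        unfolding Vas using a Vc c by (simp add: l_distr l_distr_minus m_assoc)
      also have "V \<otimes> V [^] n = V [^] Suc n" using Vc by (rule nat_pow_Suc2[symmetric])
      finally have eq: "V \<otimes> e l = ?x \<oplus> d \<otimes> ?y" .
      have "?y \<in> ?\<Gamma>" using gen[OF l(1)] zspan_diff by blast
      then have 1: "ofi R nd \<otimes> (d \<otimes> ?y) \<in> ?\<Gamma>" using nd by blast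
      have 2: "ofi R (int k) \<otimes> ?x \<in> ?\<Gamma>"
      proof (cases "Suc n < K")
        case True
        then show ?thesis using gen zspan_mult by blast
      next
        case False
        then have "Suc n = K" using l by simp
        then have "ofi R (int k) \<otimes> ?x = a [^] (i * s) \<otimes> (ofi R (int k) \<otimes> V [^] K)"
          using a Vc by (simp add: ofi_lcomm[of "a [^] (i * s)"] del: nat_pow_Suc)
        then show ?thesis using a\<Gamma>[OF VK] by simp
      qed
      have xy: "?x \<in> carrier R" "?y \<in> carrier R" using a Vc by auto
      have "ofi R (nd * int k) \<otimes> (V \<otimes> e l) =
          ofi R nd \<otimes> (ofi R (int k) \<otimes> ?x) \<oplus> ofi R (int k) \<otimes> (ofi R nd \<otimes> (d \<otimes> ?y))"
        unfolding eq using xy c by (simp add: ofi_mult r_distr m_assoc ofi_swap del: nat_pow_Suc)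
      then show "ofi R (nd * int k) \<otimes> (V \<otimes> e l) \<in> ?\<Gamma>" using 1 2 zspan_add zspan_mult by simp
    qed (use Vc in auto)
  qed
  have zE: "z \<in> ?E"
  proof -
    have "z = V \<ominus> d" using c by (simp add: V_def minus_eq a_assoc r_neg)
    then show ?thesis using stab_diff[OF P VE dE] by simp
  qed
  have e0: "e 0 = \<one>" by (simp add: e_def)
  have h0: "h > 0" using m k2 by (simp add: h_def K_def)
  have char: "\<exists>p. prime p \<and> ofi R (int p) = \<zero>"
  proof (rule ccontr)
    assume np: "\<nexists>p. prime p \<and> ofi R (int p) = \<zero>"
    have char0: "ofi R n \<noteq> \<zero>" if "n \<noteq> 0" for n
    proof
      assume n0: "ofi R n = \<zero>"
      have "ofi R (int (nat \<bar>n\<bar>)) = \<zero>" using n0 ofi_minus[of n] by (cases "n \<ge> 0") auto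
      then show False using prime_char[of "nat \<bar>n\<bar>"] that np by auto
    qed
    have "z \<noteq> \<zero>" using u bU by (simp add: z_def prod_zero in_Units_iff)
    show False
      by (rule char0_contradiction[OF zspan_ring_axioms char0 zE \<open>z \<noteq> \<zero>\<close> dE h0 e0]) (use pow in blast)+
  qed
  then obtain p where p: "prime p" "ofi R (int p) = \<zero>" by blast
  \<comment> \<open>An integer that is nonzero in \<open>R\<close> is invertible modulo
    \<open>p\<close>, so applying an element of \<open>?E\<close> to \<open>\<one>\<close> places it
    in the finite group \<open>?\<Gamma>\<close>.\<close>
  have E\<Gamma>: "x \<in> ?\<Gamma>" if x: "x \<in> ?E" for x
  proof -
    have xc: "x \<in> carrier R" using x stab_carrier by blast
    have "\<one> \<in> ?\<Gamma>" using zspan_gen[OF h0] e0 by simp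
    then obtain n where n: "?P n" "ofi R n \<otimes> (x \<otimes> \<one>) \<in> ?\<Gamma>" using x by (auto simp: stab_def)
    have "\<not> int p dvd n" using n(1) p(2) by (auto simp: ofi_mult elim!: dvdE)
    then have "coprime n (int p)" using p(1) by (metis coprime_commute prime_imp_coprime prime_int_nat_transfer prime_nat_int_transfer)
    then obtain n' q where "n' * n + q * int p = 1" using coprime_iff_gcd_eq_1 bezout_int by metis
    then have "ofi R (n' * n + q * int p) \<otimes> x = x" using xc by simp
    then have "ofi R n' \<otimes> (ofi R n \<otimes> (x \<otimes> \<one>)) = x"
      using xc p(2) by (simp add: ofi_add ofi_mult m_assoc)
    then show ?thesis using zspan_mult[OF n(2), of n'] by simp
  qed
  have fin: "finite ?E" using E\<Gamma> finite_zspan[OF p(2)] p(1) prime_gt_0_nat by (intro finite_subset[of ?E ?\<Gamma>]) auto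
  have "u = z \<otimes> (\<one> \<ominus> \<mu>)" using u nz \<mu>c by (simp add: z_def b_def m_assoc)
  then have "u \<in> ?E" using stab_mult[OF P zE stab_diff[OF P stab_one[OF P] \<mu>E]] by simp
  moreover have "?E \<subseteq> carrier R" using stab_carrier by blast
  ultimately have "torsion R u"
    using finite_imp_torsion[OF fin, of u] stab_mult[OF P] u in_Units_iff by blast
  then show ?thesis using char by blast
qed

end

subsection \<open>Periodic and Engel elements are central\<close>

context skew_field
begin

text \<open>The products \<open>m y^t\<close> form a finite monoid, so their span over the prime
  field is a finite ring containing \<open>M\<close> and \<open>y\<close>, and Wedderburn's theorem
  applies.\<close>

lemma torsion_normalizer_commutes:
  assumes p: "ofi R (int p) = \<zero>" "prime p"
    and M: "finite M" "M \<subseteq> carrier R" "\<one> \<in> M" "\<And>m n. m \<in> M \<Longrightarrow> n \<in> M \<Longrightarrow> m \<otimes> n \<in> M"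
    and y: "y \<in> carrier R" "torsion R y" "\<And>m. m \<in> M \<Longrightarrow> \<exists>m'\<in>M. y \<otimes> m = m' \<otimes> y"
    and m: "m \<in> M"
  shows "y \<otimes> m = m \<otimes> y"
proof -
  have Mc: "m \<in> carrier R" if "m \<in> M" for m using that M by auto
  obtain r :: nat where r: "r > 0" "y [^] r = \<one>" using y by (auto simp: torsion_def)
  have yr: "y [^] t = y [^] (t mod r)" for t :: nat
    by (rule pow_mod) (use y r in auto)
  define A where "A = (\<lambda>(m, t::nat). m \<otimes> y [^] t) ` (M \<times> UNIV)"
  have "A \<subseteq> (\<lambda>(m, t::nat). m \<otimes> y [^] t) ` (M \<times> {..<r})"
  proof
    fix x assume "x \<in> A"
    then obtain m and t :: nat where mt: "m \<in> M" "x = m \<otimes> y [^] t" by (auto simp: A_def)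
    then have "x = (\<lambda>(m, t::nat). m \<otimes> y [^] t) (m, t mod r)" using yr[of t] by simp
    moreover have "(m, t mod r) \<in> M \<times> {..<r}" using mt r by simp
    ultimately show "x \<in> (\<lambda>(m, t::nat). m \<otimes> y [^] t) ` (M \<times> {..<r})" by (rule image_eqI)
  qed
  then have finA: "finite A" using M by (meson finite_SigmaI finite_imageI finite_lessThan finite_subset)
  have AI: "m \<otimes> y [^] t \<in> A" if "m \<in> M" for m and t :: nat
    using that by (auto simp: A_def)
  have A: "A \<subseteq> carrier R" using Mc y by (auto simp: A_def)
  have yt: "\<exists>m'\<in>M. y [^] t \<otimes> m = m' \<otimes> y [^] t" if "m \<in> M" for m and t :: nat
  proof (induction t)
    case 0
    then show ?case using that Mc by auto
  next
    case (Suc t)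
    then obtain m1 where m1: "m1 \<in> M" "y [^] t \<otimes> m = m1 \<otimes> y [^] t" by blast
    then obtain m2 where m2: "m2 \<in> M" "y \<otimes> m1 = m2 \<otimes> y" using y by blast
    have 1: "y [^] Suc t = y \<otimes> y [^] t" using y(1) by (rule nat_pow_Suc2)
    have "y [^] Suc t \<otimes> m = y \<otimes> (m1 \<otimes> y [^] t)" unfolding 1 using y Mc that by (simp add: m_assoc m1(2))
    also have "\<dots> = (y \<otimes> m1) \<otimes> y [^] t" using y Mc m1 by (simp add: m_assoc)
    also have "\<dots> = m2 \<otimes> y [^] Suc t" unfolding 1 m2(2) using y Mc m2 by (simp add: m_assoc)
    finally show ?case using m2 by blast
  qed
  have A_mult: "x \<otimes> x' \<in> A" if x: "x \<in> A" "x' \<in> A" for x x'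
  proof -
    obtain m m' and t t' :: nat where mt: "m \<in> M" "x = m \<otimes> y [^] t" "m' \<in> M" "x' = m' \<otimes> y [^] t'"
      using x by (auto simp: A_def)
    obtain m2 where m2: "m2 \<in> M" "y [^] t \<otimes> m' = m2 \<otimes> y [^] t" using yt mt by blast
    have "x \<otimes> x' = m \<otimes> (y [^] t \<otimes> m') \<otimes> y [^] t'" using mt Mc y by (simp add: m_assoc)
    also have "\<dots> = (m \<otimes> m2) \<otimes> y [^] (t + t')"
      unfolding m2(2) using mt m2 Mc y by (simp add: m_assoc nat_pow_mult)
    finally show ?thesis using AI M mt m2 by simp
  qed
  obtain f where f: "bij_betw f {0..<card A} A" using ex_bij_betw_nat_finite[OF finA] by blast
  define h where "h = card A"
  define e where "e i = (if i < h then f i else \<zero>)" for i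
  have eA: "i < h \<Longrightarrow> e i \<in> A" for i using f by (auto simp: e_def h_def bij_betw_def)
  interpret zspan_ring R e by unfold_locales (use eA A in \<open>auto simp: e_def\<close>)
  have Ae: "\<exists>i<h. x = e i" if "x \<in> A" for x
  proof -
    have "x \<in> f ` {0..<h}" using that f by (simp add: bij_betw_def h_def)
    then obtain i where "i < h" "x = f i" by auto
    then have "x = e i" by (simp add: e_def)
    then show ?thesis using \<open>i < h\<close> by blast
  qed
  let ?E = "zspan R e h"
  have A\<Gamma>: "x \<in> ?E" if "x \<in> A" for x using Ae[OF that] zspan_gen by blast
  have eE: "e i \<otimes> g \<in> ?E" if i: "i < h" and g: "g \<in> ?E" for i g
  proof -
    have "?E \<subseteq> {g \<in> carrier R. e i \<otimes> g \<in> ?E}"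
    proof (rule zspan_subsetI)
      fix n j assume "j < h"
      then have "e i \<otimes> e j \<in> ?E" using A\<Gamma> A_mult eA i by blast
      then show "ofi R n \<otimes> e j \<in> {g \<in> carrier R. e i \<otimes> g \<in> ?E}"
        using zspan_mult by (simp add: ofi_lcomm[of "e i"])
    qed (use zspan_0 zspan_add in \<open>auto simp: r_distr\<close>)
    then show ?thesis using g by blast
  qed
  have E_mult: "x \<otimes> g \<in> ?E" if x: "x \<in> ?E" and g: "g \<in> ?E" for x g
  proof -
    have gc: "g \<in> carrier R" using g zspan_carrier by blast
    have "?E \<subseteq> {x \<in> carrier R. x \<otimes> g \<in> ?E}"
    proof (rule zspan_subsetI)
      fix n j assume "j < h"
      then show "ofi R n \<otimes> e j \<in> {x \<in> carrier R. x \<otimes> g \<in> ?E}"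
        using zspan_mult eE g gc by (simp add: m_assoc)
    qed (use zspan_0 zspan_add gc in \<open>auto simp: l_distr\<close>)
    then show ?thesis using x by blast
  qed
  have "finite ?E" using finite_zspan p prime_gt_0_nat by simp
  moreover have "\<one> \<in> ?E" using A\<Gamma> AI[OF M(3), of 0] by simp
  moreover have "y \<in> ?E" "m \<in> ?E" using A\<Gamma> AI[OF M(3), of 1] AI[OF m, of 0] y Mc[OF m] by simp_all
  ultimately show ?thesis
    by (intro finite_subring_commutes[of ?E y m] zspan_closed zspan_add E_mult zspan_0)
qed

lemma one_plus_multiple_Unit:
  assumes "a \<in> carrier R" "y \<in> carrier R" "a \<otimes> y \<noteq> y \<otimes> a"
  shows "\<one> \<oplus> ofi R c \<otimes> y \<in> Units R"
proof -
  have "\<one> \<oplus> ofi R c \<otimes> y \<noteq> \<zero>"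
  proof
    assume eq: "\<one> \<oplus> ofi R c \<otimes> y = \<zero>"
    have c0: "ofi R c \<noteq> \<zero>" using eq assms one_not_zero by auto
    have "ofi R c \<otimes> y = \<ominus> \<one>" using eq assms by (metis a_comm minus_equality m_closed ofi_closed one_closed)
    then have "a \<otimes> (ofi R c \<otimes> y) = (ofi R c \<otimes> y) \<otimes> a" using assms by (simp add: l_minus r_minus)
    then have "ofi R c \<otimes> (a \<otimes> y) = ofi R c \<otimes> (y \<otimes> a)" using assms by (simp add: ofi_lcomm[of a] m_assoc)
    then show False using assms lcancel c0 by simp
  qed
  then show ?thesis using assms by (simp add: in_Units_iff)
qed

text \<open>Fourier inversion gives \<open>u\<close> with \<open>u a = a^i u\<close>. Its inverse
  \<open>y\<close> satisfies \<open>a y a^-1 = \<mu> y\<close> with \<open>\<mu>\<close> a power of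
  \<open>a\<close>, and the commutators of \<open>1 + c y\<close> with \<open>a\<close> are the
  quotients in \<open>torsion_family\<close>. So \<open>u\<close> has finite order in characteristic
  \<open>p\<close> and normalises the powers of \<open>a\<close>, whence it commutes with
  \<open>a\<close>.\<close>

lemma torsion_commutators_imp_central:
  assumes a: "a \<in> carrier R" "torsion R a"
    and tors: "\<And>x. x \<in> Units R \<Longrightarrow> torsion R (x \<otimes> a \<otimes> inv x \<otimes> inv a)"
  shows "a \<in> ring_center R"
proof (rule ccontr)
  assume "a \<notin> ring_center R"
  then obtain x where x: "x \<in> carrier R" "a \<otimes> x \<noteq> x \<otimes> a" using a by (auto simp: ring_center_def)
  have "\<exists>u\<in>carrier R. \<exists>i::nat. u \<noteq> \<zero> \<and> u \<otimes> a = a [^] i \<otimes> u \<and> u \<otimes> a \<noteq> a \<otimes> u"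
    by (rule exists_eigenvector[OF a x]) (use x a in auto)
  then obtain u and i :: nat where u: "u \<in> carrier R" "u \<noteq> \<zero>" "u \<otimes> a = a [^] i \<otimes> u" "u \<otimes> a \<noteq> a \<otimes> u"
    by blast
  have aU: "a \<in> Units R" and uU: "u \<in> Units R" using torsion_Units[OF a] u(1,2) by (simp_all add: in_Units_iff)
  obtain m :: nat where m: "m > 0" "a [^] m = \<one>" using a by (auto simp: torsion_def)
  have am: "a [^] s = a [^] (s mod m)" for s :: nat
    by (rule pow_mod) (use a m in auto)
  define A where "A = range (\<lambda>s::nat. a [^] s)"
  have "A \<subseteq> (\<lambda>s::nat. a [^] s) ` {..<m}"
  proof
    fix x assume "x \<in> A"
    then obtain s :: nat where "x = a [^] s" by (auto simp: A_def)
    then have "x = a [^] (s mod m)" using am[of s] by simp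
    then show "x \<in> (\<lambda>s::nat. a [^] s) ` {..<m}" using m by (intro image_eqI[of _ _ "s mod m"]) auto
  qed
  then have finA: "finite A" by (meson finite_imageI finite_lessThan finite_subset)
  have Ac: "A \<subseteq> carrier R" using a by (auto simp: A_def)
  have uas: "u \<otimes> a [^] s = a [^] (i * s) \<otimes> u" for s :: nat
  proof (induction s)
    case (Suc s)
    have "u \<otimes> a [^] Suc s = (u \<otimes> a [^] s) \<otimes> a" using a u by (simp add: m_assoc)
    also have "\<dots> = a [^] (i * s) \<otimes> (u \<otimes> a)" unfolding Suc using a u by (simp add: m_assoc)
    also have "\<dots> = a [^] (i * Suc s) \<otimes> u"
      unfolding u(3) using a u by (simp add: nat_pow_mult add.commute flip: m_assoc)
    finally show ?case .
  qed (use u in simp)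
  \<comment> \<open>Finiteness turns this inclusion into an equality, so that \<open>inv u\<close>
    normalises \<open>A\<close> as well.\<close>
  have "(\<lambda>x. u \<otimes> x \<otimes> inv u) ` A \<subseteq> A"
  proof
    fix x assume "x \<in> (\<lambda>x. u \<otimes> x \<otimes> inv u) ` A"
    then obtain s :: nat where "x = u \<otimes> a [^] s \<otimes> inv u" by (auto simp: A_def)
    then have "x = a [^] (i * s)" using uas[of s] a uU by (simp add: m_assoc)
    then show "x \<in> A" by (simp add: A_def)
  qed
  moreover have "inj_on (\<lambda>x. u \<otimes> x \<otimes> inv u) A"
  proof (rule inj_onI)
    fix x y assume xy: "x \<in> A" "y \<in> A" "u \<otimes> x \<otimes> inv u = u \<otimes> y \<otimes> inv u"
    then have c: "x \<in> carrier R" "y \<in> carrier R" using Ac by auto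
    then have "u \<otimes> x = u \<otimes> y" using xy(3) uU rcancel[of "inv u"] Units_inv_Units[OF uU] by (simp add: in_Units_iff)
    then show "x = y" using lcancel u c by simp
  qed
  ultimately have surj: "(\<lambda>x. u \<otimes> x \<otimes> inv u) ` A = A" using finA by (intro endo_inj_surj)
  have "a \<in> A" using a by (auto simp: A_def intro: image_eqI[of _ _ 1])
  then obtain s :: nat where s: "a = u \<otimes> a [^] s \<otimes> inv u" using surj by (auto simp: A_def)
  define y where "y = inv u"
  have yU: "y \<in> Units R" and iy: "inv y = u" using uU by (simp_all add: y_def Units_inv_inv)
  \<comment> \<open>This is \<open>a\<close> times the inverse of \<open>a [^] s\<close>, where
    \<open>y \<otimes> a = a [^] s \<otimes> y\<close>; that inverse is a power because
    \<open>a [^] m = \<one>\<close>.\<close>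
  define \<mu> where "\<mu> = a [^] (1 + s * (m - 1))"
  have inva: "inv (a [^] s) = a [^] (s * (m - 1))"
  proof -
    have "a [^] s \<otimes> a [^] (s * (m - 1)) = a [^] (s * m)"
      using a m by (simp add: nat_pow_mult) (metis Suc_pred mult_Suc_right)
    also have "\<dots> = \<one>" using m a nat_pow_pow[of a m s] by (simp add: mult.commute)
    finally show ?thesis using aU a Units_inv_closed[OF Units_pow_closed[OF aU, of s]]
        Units_cancel(1)[OF Units_pow_closed[OF aU, of s], of "a [^] (s * (m - 1))"] by simp
  qed
  have \<mu>y: "\<mu> \<otimes> y = a \<otimes> y \<otimes> inv a"
  proof -
    have "y \<otimes> a = a [^] s \<otimes> y"
      using a uU arg_cong[OF s, of "\<lambda>x. inv u \<otimes> x"] by (simp add: y_def unit_simps)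
    then have "inv (a [^] s) \<otimes> (y \<otimes> a) \<otimes> inv a = inv (a [^] s) \<otimes> (a [^] s \<otimes> y) \<otimes> inv a" by simp
    then have "inv (a [^] s) \<otimes> y = y \<otimes> inv a"
      using a aU yU Units_pow_closed[OF aU, of s] by (simp add: unit_simps)
    moreover have "\<mu> = a \<otimes> inv (a [^] s)" unfolding \<mu>_def inva
      using nat_pow_Suc2[OF a(1), of "s * (m - 1)"] by (simp del: nat_pow_Suc)
    ultimately show ?thesis using a aU yU Units_pow_closed[OF aU, of s] by (simp add: m_assoc)
  qed
  have ay: "a \<otimes> y \<noteq> y \<otimes> a"
  proof
    assume "a \<otimes> y = y \<otimes> a"
    then have "u \<otimes> a = a \<otimes> u" using inv_commutes[OF yU a(1)] by (simp add: iy)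
    then show False using u by simp
  qed
  have \<mu>1: "\<mu> \<noteq> \<one>"
  proof
    assume "\<mu> = \<one>"
    then have "y \<otimes> a = a \<otimes> y \<otimes> inv a \<otimes> a" using \<mu>y yU by simp
    then show False using ay a aU yU by (simp add: m_assoc)
  qed
  have xU: "\<one> \<oplus> ofi R c \<otimes> y \<in> Units R" for c
    using one_plus_multiple_Unit[of a y] ay a yU by simp
  have conj: "\<one> \<oplus> ofi R c \<otimes> (\<mu> \<otimes> y) = a \<otimes> (\<one> \<oplus> ofi R c \<otimes> y) \<otimes> inv a" for c
    unfolding \<mu>y using a aU yU by (simp add: r_distr l_distr m_assoc ofi_lcomm[of a])
  have "(\<exists>p. prime p \<and> ofi R (int p) = \<zero>) \<and> torsion R u"
  proof (rule torsion_family[OF a uU u(3) \<mu>_def \<mu>1])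
    fix c :: nat
    let ?x = "\<one> \<oplus> ofi R (int c) \<otimes> y"
    show "\<one> \<oplus> ofi R (int c) \<otimes> (\<mu> \<otimes> inv u) \<in> Units R"
      using conj[of "int c"] aU xU by (simp flip: y_def)
    \<comment> \<open>The denominator is the conjugate of \<open>?x\<close> by \<open>a\<close>, so
      the quotient is a commutator.\<close>
    have "?x \<otimes> inv (a \<otimes> ?x \<otimes> inv a) = ?x \<otimes> a \<otimes> inv ?x \<otimes> inv a"
      using aU xU[of "int c"] Units_m_closed[OF aU xU[of "int c"]] by (simp add: inv_mult_Units m_assoc Units_inv_inv)
    then show "torsion R ((\<one> \<oplus> ofi R (int c) \<otimes> inv u) \<otimes> inv (\<one> \<oplus> ofi R (int c) \<otimes> (\<mu> \<otimes> inv u)))"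
      using tors[OF xU[of "int c"]] conj[of "int c"] by (simp flip: y_def)
  qed
  then obtain p where p: "prime p" "ofi R (int p) = \<zero>" and tu: "torsion R u" by blast
  have "u \<otimes> a = a \<otimes> u"
  proof (rule torsion_normalizer_commutes[OF p(2,1) finA Ac _ _ u(1) tu])
    show "\<one> \<in> A" by (auto simp: A_def intro: image_eqI[of _ _ 0])
    show "x \<otimes> y \<in> A" if "x \<in> A" "y \<in> A" for x y using that a by (auto simp: A_def nat_pow_mult)
    show "\<exists>m'\<in>A. u \<otimes> x = m' \<otimes> u" if "x \<in> A" for x using that uas by (auto simp: A_def)
    show "a \<in> A" by fact
  qed
  then show False using u by simp
qed

text \<open>One list of coefficients serves every \<open>Y\<close> commuting with
  \<open>\<mu>\<close>, as if \<open>Y\<close> were an indeterminate. This permits comparing two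
  products at all \<open>\<mu>^s y\<close> and then specialising to \<open>Y = -1\<close>.\<close>

lemma product_expansion:
  assumes \<mu>: "\<mu> \<in> carrier R"
  shows "\<exists>c N. (\<forall>k. c k \<in> carrier R \<and> (\<forall>x\<in>carrier R. x \<otimes> \<mu> = \<mu> \<otimes> x \<longrightarrow> c k \<otimes> x = x \<otimes> c k)) \<and>
    (\<forall>k\<ge>N. c k = \<zero>) \<and> (\<forall>Y\<in>carrier R. Y \<otimes> \<mu> = \<mu> \<otimes> Y \<longrightarrow>
      foldr (\<lambda>j u. (\<one> \<oplus> \<mu> [^] (j::nat) \<otimes> Y) \<otimes> u) J \<one> = (\<Oplus>k\<in>{..<N::nat}. c k \<otimes> Y [^] k))"
proof (induction J)
  case Nil
  show ?case
  proof (intro exI conjI ballI allI impI)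
    fix Y assume "Y \<in> carrier R"
    then have "(\<Oplus>k\<in>{..<1::nat}. (if k = 0 then \<one> else \<zero>) \<otimes> Y [^] k) = \<one>"
      by (simp add: lessThan_Suc finsum_insert)
    then show "foldr (\<lambda>j u. (\<one> \<oplus> \<mu> [^] j \<otimes> Y) \<otimes> u) [] \<one>
        = (\<Oplus>k\<in>{..<1::nat}. (if k = 0 then \<one> else \<zero>) \<otimes> Y [^] k)" by simp
  qed auto
next
  case (Cons j J)
  then obtain c N where c: "\<And>k. c k \<in> carrier R" "\<And>k x. x \<in> carrier R \<Longrightarrow> x \<otimes> \<mu> = \<mu> \<otimes> x \<Longrightarrow> c k \<otimes> x = x \<otimes> c k"
    and N: "\<And>k. k \<ge> N \<Longrightarrow> c k = \<zero>"
    and IH: "\<And>Y. Y \<in> carrier R \<Longrightarrow> Y \<otimes> \<mu> = \<mu> \<otimes> Y \<Longrightarrow>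
      foldr (\<lambda>j u. (\<one> \<oplus> \<mu> [^] j \<otimes> Y) \<otimes> u) J \<one> = (\<Oplus>k\<in>{..<N::nat}. c k \<otimes> Y [^] k)" by blast
  \<comment> \<open>The contribution of the new factor: the old coefficients moved up one degree and
    multiplied by \<open>\<mu> [^] j\<close>.\<close>
  define s where "s k = (case k of 0 \<Rightarrow> \<zero> | Suc k' \<Rightarrow> \<mu> [^] j \<otimes> c k')" for k
  have sc: "s k \<in> carrier R" for k using c(1) \<mu> by (cases k) (simp_all add: s_def)
  have \<mu>j: "\<mu> [^] j \<otimes> x = x \<otimes> \<mu> [^] j" if "x \<in> carrier R" "x \<otimes> \<mu> = \<mu> \<otimes> x" for x
  proof (induction j)
    case (Suc j)
    then show ?case using commute_mult[of "\<mu> [^] j" \<mu> x] that \<mu> by simp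
  qed (use that in simp)
  have s_comm: "s k \<otimes> x = x \<otimes> s k" if "x \<in> carrier R" "x \<otimes> \<mu> = \<mu> \<otimes> x" for k x
    using that c(1) c(2)[OF that] \<mu> \<mu>j[OF that] commute_mult[of "\<mu> [^] j" _ x] by (cases k) (simp_all add: s_def)
  show ?case
  proof (intro exI[of _ "\<lambda>k. c k \<oplus> s k"] exI[of _ "Suc N"] conjI allI ballI impI)
    fix k
    show "c k \<oplus> s k \<in> carrier R" using c sc by simp
    show "(c k \<oplus> s k) \<otimes> x = x \<otimes> (c k \<oplus> s k)" if "x \<in> carrier R" "x \<otimes> \<mu> = \<mu> \<otimes> x" for x
      using that c sc s_comm by (simp add: l_distr r_distr)
    show "c k \<oplus> s k = \<zero>" if "Suc N \<le> k" using that N \<mu> by (cases k) (auto simp: s_def)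
    fix Y assume Y: "Y \<in> carrier R" "Y \<otimes> \<mu> = \<mu> \<otimes> Y"
    let ?S = "\<Oplus>k\<in>{..<N}. c k \<otimes> Y [^] k"
    have S: "?S \<in> carrier R" using c Y by (intro finsum_closed) auto
    have "(\<Oplus>k\<in>{..<Suc N}. (c k \<oplus> s k) \<otimes> Y [^] k) = (\<Oplus>k\<in>{..<Suc N}. c k \<otimes> Y [^] k \<oplus> s k \<otimes> Y [^] k)"
      using c sc Y by (intro finsum_cong') (auto simp: l_distr)
    also have "\<dots> = (\<Oplus>k\<in>{..<Suc N}. c k \<otimes> Y [^] k) \<oplus> (\<Oplus>k\<in>{..<Suc N}. s k \<otimes> Y [^] k)"
      using c sc Y by (intro finsum_addf) auto
    also have "(\<Oplus>k\<in>{..<Suc N}. c k \<otimes> Y [^] k) = ?S"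
      using c Y N[of N] S by (simp add: lessThan_Suc finsum_insert)
    also have "(\<Oplus>k\<in>{..<Suc N}. s k \<otimes> Y [^] k) = (\<mu> [^] j \<otimes> Y) \<otimes> ?S"
    proof -
      have tm: "s (Suc k) \<otimes> Y [^] Suc k = (\<mu> [^] j \<otimes> Y) \<otimes> (c k \<otimes> Y [^] k)" for k
      proof -
        have 1: "Y [^] Suc k = Y \<otimes> Y [^] k" using Y(1) by (rule nat_pow_Suc2)
        have "c k \<otimes> Y = Y \<otimes> c k" using c Y by blast
        then have "c k \<otimes> (Y \<otimes> Y [^] k) = Y \<otimes> (c k \<otimes> Y [^] k)" using c Y by (simp flip: m_assoc)
        then show ?thesis unfolding 1 using c Y \<mu> by (simp add: s_def m_assoc)
      qed
      have "(\<Oplus>k\<in>{..<M}. s k \<otimes> Y [^] k) = (\<Oplus>k\<in>{..<M - 1}. s (Suc k) \<otimes> Y [^] Suc k)" for M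
      proof (cases M)
        case (Suc M')
        show ?thesis unfolding Suc
        proof (induction M')
          case 0
          then show ?case using Y by (simp add: lessThan_Suc finsum_insert s_def)
        next
          case (Suc M')
          have "(\<Oplus>k\<in>{..<Suc (Suc M')}. s k \<otimes> Y [^] k) = s (Suc M') \<otimes> Y [^] Suc M' \<oplus> (\<Oplus>k\<in>{..<Suc M'}. s k \<otimes> Y [^] k)"
            unfolding lessThan_Suc[of "Suc M'"] using sc Y by (intro finsum_insert) auto
          moreover have "(\<Oplus>k\<in>{..<Suc M'}. s (Suc k) \<otimes> Y [^] Suc k) = s (Suc M') \<otimes> Y [^] Suc M' \<oplus> (\<Oplus>k\<in>{..<M'}. s (Suc k) \<otimes> Y [^] Suc k)"
            unfolding lessThan_Suc[of M'] using sc Y by (intro finsum_insert) auto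
          ultimately show ?case using Suc by simp
        qed
      qed (simp add: finsum_empty)
      then have "(\<Oplus>k\<in>{..<Suc N}. s k \<otimes> Y [^] k) = (\<Oplus>k\<in>{..<N}. (\<mu> [^] j \<otimes> Y) \<otimes> (c k \<otimes> Y [^] k))"
        unfolding tm by simp
      also have "\<dots> = (\<mu> [^] j \<otimes> Y) \<otimes> ?S" using c Y \<mu> by (subst finsum_rdistr) auto
      finally show ?thesis .
    qed
    also have "?S \<oplus> (\<mu> [^] j \<otimes> Y) \<otimes> ?S = (\<one> \<oplus> \<mu> [^] j \<otimes> Y) \<otimes> ?S"
      using S Y \<mu> by (simp add: l_distr)
    finally show "foldr (\<lambda>j u. (\<one> \<oplus> \<mu> [^] j \<otimes> Y) \<otimes> u) (j # J) \<one> = (\<Oplus>k\<in>{..<Suc N}. (c k \<oplus> s k) \<otimes> Y [^] k)"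
      using IH[OF Y] by simp
  qed
qed

end

section \<open>Engel elements and commutators commuting with both entries\<close>

context skew_field
begin

text \<open>
  All factors lie in \<open>B\<close>, the commutative multiplicative group of the double centraliser of
  \<open>{y, \<mu>}\<close>, on which \<open>a\<close> acts by \<open>\<mu>\<^sup>j y \<mapsto> \<mu>\<^sup>j\<^sup>+\<^sup>1 y\<close>.
\<close>

lemma engel_central_commutator:
  assumes engel: "left_engel (units_of R) a"
    and y: "y \<in> Units R" "a \<otimes> y = \<mu> \<otimes> y \<otimes> a"
    and \<mu>: "\<mu> \<in> Units R" "a \<otimes> \<mu> = \<mu> \<otimes> a" "y \<otimes> \<mu> = \<mu> \<otimes> y" "\<mu> \<noteq> \<one>"
  shows "torsion R \<mu> \<and> (\<forall>c. torsion R ((\<one> \<oplus> ofi R c \<otimes> y) \<otimes> inv (\<one> \<oplus> ofi R c \<otimes> (\<mu> \<otimes> y))))"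
proof -
  interpret U: group "units_of R" by (rule units_group)
  let ?U = "units_of R"
  have Usimps: "carrier ?U = Units R" "x \<otimes>\<^bsub>?U\<^esub> z = x \<otimes> z" "\<one>\<^bsub>?U\<^esub> = \<one>" for x z
    by (simp_all add: units_of_def)
  have Uinv: "x \<in> Units R \<Longrightarrow> inv\<^bsub>?U\<^esub> x = inv x" for x by (rule units_of_inv)
  have aU: "a \<in> Units R" using engel by (simp add: left_engel_def Usimps)
  have ac: "a \<in> carrier R" and yc: "y \<in> carrier R" and \<mu>c: "\<mu> \<in> carrier R" using aU y \<mu> by auto
  have ay: "a \<otimes> y \<noteq> y \<otimes> a"
  proof
    assume "a \<otimes> y = y \<otimes> a"
    then have "\<mu> \<otimes> (y \<otimes> a) = \<one> \<otimes> (y \<otimes> a)" using y ac yc \<mu>c by (simp add: m_assoc)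
    then show False using rcancel[of "y \<otimes> a" \<mu> \<one>] Units_m_closed[OF y(1) aU] \<mu> \<mu>c by (simp add: in_Units_iff)
  qed
  define C where "C = {x \<in> carrier R. x \<otimes> y = y \<otimes> x \<and> x \<otimes> \<mu> = \<mu> \<otimes> x}"
  define B where "B = {b \<in> Units R. \<forall>x\<in>C. b \<otimes> x = x \<otimes> b}"
  have yC: "y \<in> C" "\<mu> \<in> C" using yc \<mu>c \<mu> by (auto simp: C_def)
  have BU: "b \<in> Units R" if "b \<in> B" for b using that by (simp add: B_def)
  have BC: "b \<in> C" if "b \<in> B" for b using that yC BU[OF that] by (auto simp: B_def C_def)
  have Bcomm: "b \<otimes> b' = b' \<otimes> b" if "b \<in> B" "b' \<in> B" for b b'
    using that BC[of b'] unfolding B_def by blast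
  have Cc: "x \<in> carrier R" if "x \<in> C" for x using that by (simp add: C_def)
  have Bmult: "b \<otimes> b' \<in> B" if "b \<in> B" "b' \<in> B" for b b'
    unfolding B_def
  proof (intro CollectI conjI ballI)
    fix x assume x: "x \<in> C"
    then show "b \<otimes> b' \<otimes> x = x \<otimes> (b \<otimes> b')"
      using commute_mult[of b b' x] that BU[OF that(1)] BU[OF that(2)] Cc[OF x]
      unfolding B_def by blast
  qed (use that BU in simp)
  have Binv: "inv b \<in> B" if "b \<in> B" for b
    using that BU[OF that] Cc inv_commutes by (auto simp: B_def)
  have aya: "a \<otimes> y \<otimes> inv a = \<mu> \<otimes> y" using y aU \<mu>c by (simp add: m_assoc)
  have Bconj: "a \<otimes> b \<otimes> inv a \<in> B" if b: "b \<in> B" for b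
    unfolding B_def
  proof (intro CollectI conjI ballI)
    show "a \<otimes> b \<otimes> inv a \<in> Units R" using aU BU[OF b] by simp
    fix x assume x: "x \<in> C"
    then have xc: "x \<in> carrier R" "x \<otimes> y = y \<otimes> x" "x \<otimes> \<mu> = \<mu> \<otimes> x" by (auto simp: C_def)
    define x' where "x' = inv a \<otimes> x \<otimes> a"
    have x'c: "x' \<in> carrier R" using aU xc by (simp add: x'_def)
    have ax: "a \<otimes> x' = x \<otimes> a" using aU xc by (simp add: x'_def unit_simps)
    have "a \<otimes> (x' \<otimes> y) = x \<otimes> (a \<otimes> y)" using ac x'c yc xc ax by (metis m_assoc)
    also have "\<dots> = (x \<otimes> \<mu>) \<otimes> y \<otimes> a" unfolding y(2) using ac xc(1) yc \<mu>c by (simp add: m_assoc)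
    also have "\<dots> = \<mu> \<otimes> (x \<otimes> y) \<otimes> a" unfolding xc(3) using ac xc(1) yc \<mu>c by (simp add: m_assoc)
    also have "\<dots> = \<mu> \<otimes> y \<otimes> (x \<otimes> a)" unfolding xc(2) using ac xc(1) yc \<mu>c by (simp add: m_assoc)
    also have "\<dots> = (\<mu> \<otimes> y \<otimes> a) \<otimes> x'" using ac xc(1) yc \<mu>c x'c by (simp add: m_assoc flip: ax)
    also have "\<dots> = a \<otimes> (y \<otimes> x')" using ac yc x'c by (simp add: m_assoc flip: y(2))
    finally have 1: "x' \<otimes> y = y \<otimes> x'" using lcancel[of a] aU x'c yc by (simp add: in_Units_iff)
    have "a \<otimes> (x' \<otimes> \<mu>) = x \<otimes> (a \<otimes> \<mu>)" using ac x'c \<mu>c xc ax by (metis m_assoc)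
    also have "\<dots> = (x \<otimes> \<mu>) \<otimes> a" unfolding \<mu>(2) using ac xc(1) \<mu>c by (simp add: m_assoc)
    also have "\<dots> = \<mu> \<otimes> (a \<otimes> x')" unfolding xc(3) using ac xc(1) \<mu>c by (simp add: m_assoc ax)
    also have "\<dots> = (a \<otimes> \<mu>) \<otimes> x'" unfolding \<mu>(2) using ac x'c \<mu>c by (simp add: m_assoc)
    also have "\<dots> = a \<otimes> (\<mu> \<otimes> x')" using ac x'c \<mu>c by (simp add: m_assoc)
    finally have 2: "x' \<otimes> \<mu> = \<mu> \<otimes> x'" using lcancel[of a] aU x'c \<mu>c by (simp add: in_Units_iff)
    have "x' \<in> C" using 1 2 x'c by (simp add: C_def)
    then have bx: "b \<otimes> x' = x' \<otimes> b" using b by (simp add: B_def)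
    have xa: "inv a \<otimes> x = x' \<otimes> inv a" using aU xc by (simp add: x'_def unit_simps)
    have bc: "b \<in> carrier R" using BU[OF b] by simp
    have "a \<otimes> b \<otimes> inv a \<otimes> x = a \<otimes> (b \<otimes> x') \<otimes> inv a" using aU bc xc(1) x'c by (simp add: m_assoc xa)
    also have "\<dots> = (a \<otimes> x') \<otimes> b \<otimes> inv a" unfolding bx using aU bc x'c by (simp add: m_assoc)
    also have "\<dots> = x \<otimes> (a \<otimes> b \<otimes> inv a)" unfolding ax using aU bc xc(1) by (simp add: m_assoc)
    finally show "a \<otimes> b \<otimes> inv a \<otimes> x = x \<otimes> (a \<otimes> b \<otimes> inv a)" .
  qed
  have fB: "\<one> \<oplus> ofi R c \<otimes> y \<in> B" for c
    unfolding B_def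
  proof (intro CollectI conjI ballI)
    show "\<one> \<oplus> ofi R c \<otimes> y \<in> Units R" by (rule one_plus_multiple_Unit[OF ac yc ay])
    fix x assume "x \<in> C"
    then have "x \<in> carrier R" "x \<otimes> y = y \<otimes> x" by (auto simp: C_def)
    then show "(\<one> \<oplus> ofi R c \<otimes> y) \<otimes> x = x \<otimes> (\<one> \<oplus> ofi R c \<otimes> y)"
      using yc by (simp add: l_distr r_distr m_assoc ofi_lcomm[of x])
  qed
  have conj_f: "a \<otimes> (\<one> \<oplus> ofi R c \<otimes> y) \<otimes> inv a = \<one> \<oplus> ofi R c \<otimes> (\<mu> \<otimes> y)" for c
    unfolding aya[symmetric] using aU yc by (simp add: r_distr l_distr m_assoc ofi_lcomm[of a])
  have comm_eq: "comm_by ?U a x = x \<otimes> inv (a \<otimes> x \<otimes> inv a)" if "x \<in> Units R" for x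
    using that aU Units_m_closed[OF aU that] by (simp add: comm_by_def Usimps Uinv inv_mult_Units m_assoc Units_inv_inv)
  have ex_n: "\<exists>n. (comm_by ?U a ^^ n) x = \<one>" if "x \<in> Units R" for x
    using engel that by (auto simp: left_engel_def Usimps)
  have ay_pow: "a [^] s \<otimes> y = \<mu> [^] s \<otimes> y \<otimes> a [^] s" for s :: nat
  proof (induction s)
    case (Suc s)
    have a\<mu>: "a [^] s \<otimes> \<mu> = \<mu> \<otimes> a [^] s"
    proof (induction s)
      case (Suc s)
      then show ?case using commute_mult[of "a [^] s" a \<mu>] ac \<mu>c \<mu> by simp
    qed (use \<mu>c in simp)
    have "a [^] Suc s \<otimes> y = a [^] s \<otimes> (\<mu> \<otimes> y \<otimes> a)" using ac yc by (simp add: m_assoc y(2))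
    also have "\<dots> = \<mu> \<otimes> (a [^] s \<otimes> y) \<otimes> a" using ac yc \<mu>c a\<mu> by (simp flip: m_assoc)
    also have "\<dots> = (\<mu> \<otimes> \<mu> [^] s) \<otimes> y \<otimes> a [^] Suc s" unfolding Suc using ac yc \<mu>c by (simp add: m_assoc)
    also have "\<mu> \<otimes> \<mu> [^] s = \<mu> [^] Suc s" using \<mu>c by (rule nat_pow_Suc2[symmetric])
    finally show ?case .
  qed (use yc in simp)
  \<comment> \<open>For \<open>\<mu>\<close> of infinite order the Engel relation at
    \<open>1 + y\<close> becomes a polynomial identity in \<open>Y\<close> of which only one side
    vanishes at \<open>Y = -1\<close>.\<close>
  have tors: "torsion R \<mu>"
  proof (rule ccontr)
    assume nt: "\<not> torsion R \<mu>"
    have \<mu>_ne: "\<mu> [^] p \<noteq> \<mu> [^] q" if "p < q" for p q :: nat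
    proof
      assume eq: "\<mu> [^] p = \<mu> [^] q"
      have "\<mu> [^] p \<otimes> \<mu> [^] (q - p) = \<mu> [^] q" using that \<mu>c by (simp add: nat_pow_mult)
      also have "\<dots> = \<mu> [^] p \<otimes> \<one>" using eq \<mu>c by simp
      finally have "\<mu> [^] p \<otimes> \<mu> [^] (q - p) = \<mu> [^] p \<otimes> \<one>" .
      then have "\<mu> [^] (q - p) = \<one>"
        using lcancel[of "\<mu> [^] p" "\<mu> [^] (q - p)" \<one>] Units_pow_closed[OF \<mu>(1), of p] \<mu>c by (simp add: in_Units_iff)
      moreover have "q - p > 0" using that by simp
      ultimately show False using nt unfolding torsion_def by blast
    qed
    define F where "F Y J = foldr (\<lambda>j u. (\<one> \<oplus> \<mu> [^] (j::nat) \<otimes> Y) \<otimes> u) J \<one>" for Y J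
    have F_Nil: "F Y [] = \<one>" and F_Cons: "F Y (j # J) = (\<one> \<oplus> \<mu> [^] j \<otimes> Y) \<otimes> F Y J" for Y j J
      by (simp_all add: F_def)
    have Fc: "F Y J \<in> carrier R" if "Y \<in> carrier R" for Y J
      using that \<mu>c by (induction J) (auto simp: F_Nil F_Cons)
    have conj_step: "a \<otimes> (\<one> \<oplus> \<mu> [^] j \<otimes> y) \<otimes> inv a = \<one> \<oplus> \<mu> [^] Suc j \<otimes> y" for j :: nat
    proof -
      have a\<mu>: "a \<otimes> \<mu> [^] j = \<mu> [^] j \<otimes> a"
      proof (induction j)
        case (Suc j)
        have "a \<otimes> \<mu> [^] Suc j = (\<mu> [^] j \<otimes> a) \<otimes> \<mu>" using ac \<mu>c by (simp add: Suc flip: m_assoc)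
        then show ?case using ac \<mu>c \<mu>(2) by (simp add: m_assoc)
      qed (use ac in simp)
      have "a \<otimes> (\<one> \<oplus> \<mu> [^] j \<otimes> y) \<otimes> inv a = \<one> \<oplus> (a \<otimes> \<mu> [^] j) \<otimes> (y \<otimes> inv a)"
        using aU yc \<mu>c by (simp add: r_distr l_distr m_assoc)
      also have "\<dots> = \<one> \<oplus> \<mu> [^] j \<otimes> (a \<otimes> y \<otimes> inv a)" unfolding a\<mu> using aU yc \<mu>c by (simp add: m_assoc)
      also have "\<dots> = \<one> \<oplus> \<mu> [^] Suc j \<otimes> y" unfolding aya using yc \<mu>c by (simp add: m_assoc)
      finally show ?thesis .
    qed
    have fjB: "\<one> \<oplus> \<mu> [^] j \<otimes> y \<in> B" for j :: nat
    proof (induction j)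
      case 0
      then show ?case using fB[of 1] yc by simp
    next
      case (Suc j)
      then show ?case using Bconj[OF Suc] conj_step by simp
    qed
    have oneB: "\<one> \<in> B" using Cc by (auto simp: B_def)
    have FB: "F y J \<in> B" for J by (induction J) (use oneB fjB Bmult in \<open>auto simp: F_Nil F_Cons\<close>)
    have conj_mult: "a \<otimes> (b \<otimes> b') \<otimes> inv a = (a \<otimes> b \<otimes> inv a) \<otimes> (a \<otimes> b' \<otimes> inv a)"
      if "b \<in> carrier R" "b' \<in> carrier R" for b b' using that aU by (simp add: unit_simps)
    have conj_F: "a \<otimes> F y J \<otimes> inv a = F y (map Suc J)" for J
    proof (induction J)
      case (Cons j J)
      then show ?case
        using conj_mult[of "\<one> \<oplus> \<mu> [^] j \<otimes> y" "F y J"] Fc[OF yc] \<mu>c yc conj_step by (simp add: F_Cons del: nat_pow_Suc)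
    qed (use aU in \<open>simp add: F_Nil\<close>)
    have F_append: "F y (I @ J) = F y I \<otimes> F y J" for I J
      using Fc[OF yc] \<mu>c yc by (induction I) (simp_all add: F_Nil F_Cons m_assoc)
    have y1B: "\<one> \<oplus> y \<in> B" using fB[of 1] yc by simp
    define g where "g n = (comm_by ?U a ^^ n) (\<one> \<oplus> y)" for n
    have gB: "g n \<in> B" for n
    proof (induction n)
      case (Suc n)
      have "g (Suc n) = comm_by ?U a (g n)" by (simp add: g_def)
      then show ?case using comm_eq[OF BU[OF Suc]] Bmult[OF Suc Binv[OF Bconj[OF Suc]]] by simp
    qed (use y1B in \<open>simp add: g_def\<close>)
    \<comment> \<open>The iterated commutator is a fraction of products. Conjugation by
      \<open>a\<close> raises all indices by one, so the index 0 occurs exactly once, and in the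
      numerator.\<close>
    have ex: "\<exists>I J. 0 \<notin> set I \<and> 0 \<notin> set J \<and> g n \<otimes> F y J = F y (0 # I)" for n
    proof (induction n)
      case 0
      show ?case using yc by (intro exI[of _ "[]"]) (simp add: g_def F_Nil F_Cons)
    next
      case (Suc n)
      then obtain I J where IJ: "0 \<notin> set I" "0 \<notin> set J" "g n \<otimes> F y J = F y (0 # I)" by blast
      let ?s = "a \<otimes> g n \<otimes> inv a"
      have sB: "?s \<in> B" using Bconj gB by blast
      have gs: "g (Suc n) = g n \<otimes> inv ?s" using comm_eq[OF BU[OF gB]] by (simp add: g_def)
      have "?s \<otimes> F y (map Suc J) = F y (map Suc (0 # I))"
        using conj_mult[of "g n" "F y J"] BU[OF gB] Fc[OF yc] IJ(3) by (simp only: conj_F Units_closed)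
      then have sF: "F y (map Suc J) = inv ?s \<otimes> F y (map Suc (0 # I))"
        using BU[OF sB] Fc[OF yc] by (metis Units_cancel(1))
      have cc: "inv ?s \<in> carrier R" "g n \<in> carrier R" "F y K \<in> carrier R" for K
        using BU[OF Binv[OF sB]] BU[OF gB] Fc[OF yc] by auto
      have "g (Suc n) \<otimes> F y (J @ map Suc (0 # I)) = g n \<otimes> (inv ?s \<otimes> F y J) \<otimes> F y (map Suc (0 # I))"
        unfolding gs F_append using cc by (simp add: m_assoc)
      also have "inv ?s \<otimes> F y J = F y J \<otimes> inv ?s" using Bcomm[OF Binv[OF sB] FB] .
      also have "g n \<otimes> (F y J \<otimes> inv ?s) \<otimes> F y (map Suc (0 # I)) = (g n \<otimes> F y J) \<otimes> (inv ?s \<otimes> F y (map Suc (0 # I)))"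
        using cc by (simp add: m_assoc)
      also have "\<dots> = F y (0 # I) \<otimes> F y (map Suc J)" by (simp only: IJ(3) sF)
      also have "\<dots> = F y (0 # (I @ map Suc J))" using F_append[of "0 # I" "map Suc J"] by simp
      finally show ?case using IJ by (intro exI[of _ "I @ map Suc J"] exI[of _ "J @ map Suc (0 # I)"]) auto
    qed
    obtain n where "g n = \<one>" using ex_n[OF BU[OF y1B]] by (auto simp: g_def)
    then obtain I J where IJ: "0 \<notin> set I" "0 \<notin> set J" "F y J = F y (0 # I)"
      using ex[of n] Fc[OF yc] by auto
    \<comment> \<open>Conjugation by \<open>a [^] s\<close> shifts all indices by \<open>s\<close>,
      which amounts to replacing \<open>y\<close> by \<open>\<mu>^s y\<close>.\<close>
    have Fs: "F (\<mu> [^] s \<otimes> y) J = F (\<mu> [^] s \<otimes> y) (0 # I)" for s :: nat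
    proof -
      have "F (\<mu> [^] s \<otimes> y) K = F y (map (\<lambda>j. j + s) K)" for K
        using \<mu>c yc by (induction K) (simp_all add: F_Nil F_Cons nat_pow_mult flip: m_assoc)
      moreover have "F y (map (\<lambda>j. j + s) J) = F y (map (\<lambda>j. j + s) (0 # I))"
      proof (induction s)
        case (Suc s)
        have "F y (map (\<lambda>j. j + Suc s) K) = a \<otimes> F y (map (\<lambda>j. j + s) K) \<otimes> inv a" for K
          unfolding conj_F by (simp add: comp_def)
        then show ?case using Suc by (simp only:)
      qed (use IJ in simp)
      ultimately show ?thesis by simp
    qed
    obtain c N where c: "\<And>k. c k \<in> carrier R" "\<And>k x. x \<in> carrier R \<Longrightarrow> x \<otimes> \<mu> = \<mu> \<otimes> x \<Longrightarrow> c k \<otimes> x = x \<otimes> c k"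
        "\<And>k. k \<ge> N \<Longrightarrow> c k = \<zero>"
        "\<And>Y. Y \<in> carrier R \<Longrightarrow> Y \<otimes> \<mu> = \<mu> \<otimes> Y \<Longrightarrow> F Y J = (\<Oplus>k\<in>{..<N::nat}. c k \<otimes> Y [^] k)"
      using product_expansion[OF \<mu>c, of J] unfolding F_def by blast
    obtain c' N' where c': "\<And>k. c' k \<in> carrier R" "\<And>k x. x \<in> carrier R \<Longrightarrow> x \<otimes> \<mu> = \<mu> \<otimes> x \<Longrightarrow> c' k \<otimes> x = x \<otimes> c' k"
        "\<And>k. k \<ge> N' \<Longrightarrow> c' k = \<zero>"
        "\<And>Y. Y \<in> carrier R \<Longrightarrow> Y \<otimes> \<mu> = \<mu> \<otimes> Y \<Longrightarrow> F Y (0 # I) = (\<Oplus>k\<in>{..<N'::nat}. c' k \<otimes> Y [^] k)"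
      using product_expansion[OF \<mu>c, of "0 # I"] unfolding F_def by blast
    define M where "M = max N N'"
    define d where "d k = c k \<ominus> c' k" for k
    have dc: "d k \<in> carrier R" for k using c c' by (simp add: d_def)
    have pad: "(\<Oplus>k\<in>{..<n}. f k \<otimes> Y [^] k) = (\<Oplus>k\<in>{..<M}. f k \<otimes> Y [^] k)"
      if "n \<le> M" "\<And>k. k \<ge> n \<Longrightarrow> f k = \<zero>" "\<And>k. f k \<in> carrier R" "Y \<in> carrier R" for f Y and n :: nat
      using that by (intro add.finprod_mono_neutral_cong_left) auto
    have diff: "F Y J = (\<Oplus>k\<in>{..<M}. d k \<otimes> Y [^] k) \<oplus> F Y (0 # I)"
      if Y: "Y \<in> carrier R" "Y \<otimes> \<mu> = \<mu> \<otimes> Y" for Y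
    proof -
      have "F Y J = (\<Oplus>k\<in>{..<M}. c k \<otimes> Y [^] k)"
        unfolding c(4)[OF Y] by (rule pad) (use c Y in \<open>auto simp: M_def\<close>)
      also have "\<dots> = (\<Oplus>k\<in>{..<M}. d k \<otimes> Y [^] k \<oplus> c' k \<otimes> Y [^] k)"
      proof (rule finsum_cong')
        fix k
        have "c k = d k \<oplus> c' k" using c(1)[of k] c'(1)[of k] by (simp add: d_def minus_eq a_assoc l_neg)
        then show "c k \<otimes> Y [^] k = d k \<otimes> Y [^] k \<oplus> c' k \<otimes> Y [^] k"
          using dc[of k] c'(1)[of k] Y by (simp add: l_distr)
      qed (use dc c' Y in auto)
      also have "\<dots> = (\<Oplus>k\<in>{..<M}. d k \<otimes> Y [^] k) \<oplus> (\<Oplus>k\<in>{..<M}. c' k \<otimes> Y [^] k)"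
        using dc c' Y by (intro finsum_addf) auto
      also have "(\<Oplus>k\<in>{..<M}. c' k \<otimes> Y [^] k) = F Y (0 # I)"
        unfolding c'(4)[OF Y] by (rule pad[symmetric]) (use c' Y in \<open>auto simp: M_def\<close>)
      finally show ?thesis .
    qed
    have \<mu>s: "\<mu> [^] s \<otimes> \<mu> = \<mu> \<otimes> \<mu> [^] s" for s :: nat using \<mu>c by (metis nat_pow_Suc nat_pow_Suc2)
    \<comment> \<open>At \<open>Y = \<mu>^s y\<close> the power with exponent \<open>k\<close>
      contributes \<open>\<mu>^(k s)\<close>. As functions of \<open>s\<close> these characters are
      distinct, so the two coefficient lists agree.\<close>
    have dz: "d k = \<zero>" if "k < M" for k
    proof -
      have "d k \<otimes> ((\<mu> [^] k) [^] (0::nat) \<otimes> y [^] k) = \<zero>"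
      proof (rule linear_independence_of_characters[where B = UNIV and \<kappa> = Suc and \<theta> = "\<lambda>k. \<mu> [^] k"
            and f = "\<lambda>k s. (\<mu> [^] k) [^] s \<otimes> y [^] k" and d = d and n = M])
        show "(\<mu> [^] j) [^] Suc b \<otimes> y [^] j = \<mu> [^] j \<otimes> ((\<mu> [^] j) [^] b \<otimes> y [^] j)" for j b :: nat
          using \<mu>c yc nat_pow_Suc2[of "\<mu> [^] j" b] by (simp add: m_assoc del: nat_pow_Suc)
        show "\<mu> [^] i \<noteq> \<mu> [^] j" if "i \<noteq> j" for i j :: nat
          using \<mu>_ne[of i j] \<mu>_ne[of j i] that by (metis nat_neq_iff)
        show "\<mu> [^] i \<otimes> \<mu> [^] j = \<mu> [^] j \<otimes> \<mu> [^] i" for i j :: nat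
          using \<mu>c by (simp add: nat_pow_mult add.commute)
        show "d j \<otimes> \<mu> [^] i = \<mu> [^] i \<otimes> d j" for i j :: nat
          using c(1,2) c'(1,2) \<mu>c \<mu>s[of i] by (simp add: d_def l_distr_minus r_distr_minus)
        fix s :: nat
        let ?Y = "\<mu> [^] s \<otimes> y"
        have Y: "?Y \<in> carrier R" "?Y \<otimes> \<mu> = \<mu> \<otimes> ?Y"
          using \<mu>c yc commute_mult[of "\<mu> [^] s" y \<mu>] \<mu>s \<mu>(3) by auto
        have \<mu>y: "\<mu> [^] s \<otimes> y = y \<otimes> \<mu> [^] s"
        proof (induction s)
          case (Suc s)
          then show ?case using commute_mult[of "\<mu> [^] s" \<mu> y] \<mu>c yc \<mu>(3) by simp
        qed (use yc in simp)
        have Yk: "?Y [^] k = (\<mu> [^] k) [^] s \<otimes> y [^] k" for k :: nat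
          using pow_mult_distrib[OF \<mu>y _ yc, of k] \<mu>c by (simp add: nat_pow_pow mult.commute)
        let ?S = "\<Oplus>k\<in>{..<M}. d k \<otimes> ?Y [^] k"
        have S: "?S \<in> carrier R" using dc Y by (intro finsum_closed) auto
        have "?S \<oplus> F ?Y (0 # I) = \<zero> \<oplus> F ?Y (0 # I)" using diff[OF Y] Fs[of s] Fc[OF Y(1)] by simp
        then have "?S = \<zero>" using S Fc[OF Y(1)] by (simp add: add.right_cancel)
        then show "(\<Oplus>k\<in>{..<M}. d k \<otimes> ((\<mu> [^] k) [^] s \<otimes> y [^] k)) = \<zero>" by (simp only: Yk)
      qed (use dc \<mu>c yc that in auto)
      moreover have "y [^] k \<noteq> \<zero>" using Units_pow_closed[OF y(1), of k] by (simp add: in_Units_iff)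
      ultimately show ?thesis using dc \<mu>c yc by (simp add: prod_zero)
    qed
    \<comment> \<open>At \<open>Y = -1\<close> the factor with index 0 is zero, whereas
      \<open>1 - \<mu>^j\<close> is nonzero for \<open>j > 0\<close>.\<close>
    have m1: "\<ominus> \<one> \<in> carrier R" "\<ominus> \<one> \<otimes> \<mu> = \<mu> \<otimes> \<ominus> \<one>" using \<mu>c by (auto simp: l_minus r_minus)
    have "(\<Oplus>k\<in>{..<M}. d k \<otimes> (\<ominus> \<one>) [^] k) = (\<Oplus>k\<in>{..<M}. \<zero>)"
      using dz by (intro finsum_cong') auto
    then have "F (\<ominus> \<one>) J = F (\<ominus> \<one>) (0 # I)" using diff[OF m1] Fc[OF m1(1)] by (simp add: finsum_zero)
    also have "\<dots> = \<zero>" using Fc[OF m1(1), of I] by (simp add: F_Cons r_neg)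
    finally have "F (\<ominus> \<one>) J = \<zero>" .
    moreover have "F (\<ominus> \<one>) K \<noteq> \<zero>" if "0 \<notin> set K" for K
      using that
    proof (induction K)
      case (Cons j K)
      have "\<one> \<oplus> \<mu> [^] j \<otimes> \<ominus> \<one> = \<one> \<ominus> \<mu> [^] j" using \<mu>c by (simp add: r_minus minus_eq)
      moreover have "\<mu> [^] (0::nat) \<noteq> \<mu> [^] j" using \<mu>_ne[of 0 j] Cons by auto
      ultimately have "\<one> \<oplus> \<mu> [^] j \<otimes> \<ominus> \<one> \<noteq> \<zero>" using \<mu>c by (simp add: minus_unique_right)
      then show ?case using Cons Fc[OF m1(1)] \<mu>c by (simp add: F_Cons prod_zero)
    qed (simp add: F_Nil one_not_zero)
    ultimately show False using IJ by blast
  qed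
  \<comment> \<open>With \<open>\<mu> [^] k = \<one>\<close> the power \<open>a [^] k\<close>
    commutes with \<open>y\<close>, so \<open>a\<close> acts on \<open>B\<close> with finite order
    and \<open>engel_torsion\<close> applies.\<close>
  have "torsion R ((\<one> \<oplus> ofi R c \<otimes> y) \<otimes> inv (\<one> \<oplus> ofi R c \<otimes> (\<mu> \<otimes> y)))" for c
  proof -
    obtain k :: nat where k: "k > 0" "\<mu> [^] k = \<one>" using tors by (auto simp: torsion_def)
    let ?x = "\<one> \<oplus> ofi R c \<otimes> y"
    obtain n where "(comm_by ?U a ^^ n) ?x = \<one>" using ex_n[OF BU[OF fB]] by blast
    then have n: "(comm_by ?U a ^^ Suc n) ?x = \<one>\<^bsub>?U\<^esub>"
      using U.comm_by_one_iff[of a "\<one>"] aU ac by (simp add: Usimps)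
    have akC: "a [^] k \<in> C"
    proof -
      have "a [^] s \<otimes> \<mu> = \<mu> \<otimes> a [^] s" for s :: nat
      proof (induction s)
        case (Suc s)
        then show ?case using commute_mult[of "a [^] s" a \<mu>] ac \<mu>c \<mu> by simp
      qed (use \<mu>c in simp)
      then show ?thesis using ay_pow[of k] k ac yc by (simp add: C_def)
    qed
    have "torsion ?U (comm_by ?U a ?x)"
    proof (rule U.engel_torsion[of a B k ?x n])
      show "a \<in> carrier ?U" "B \<subseteq> carrier ?U" using aU BU by (auto simp: Usimps)
      show "inv\<^bsub>?U\<^esub> u \<in> B" if "u \<in> B" for u using Binv[OF that] BU[OF that] by (simp add: Uinv)
      show "u \<otimes>\<^bsub>?U\<^esub> v \<in> B \<and> u \<otimes>\<^bsub>?U\<^esub> v = v \<otimes>\<^bsub>?U\<^esub> u" if "u \<in> B" "v \<in> B" for u v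
        using Bmult Bcomm that by (simp add: Usimps)
      show "a \<otimes>\<^bsub>?U\<^esub> u \<otimes>\<^bsub>?U\<^esub> inv\<^bsub>?U\<^esub> a \<in> B" if "u \<in> B" for u using Bconj that aU by (simp add: Usimps Uinv)
      show "a [^]\<^bsub>?U\<^esub> k \<otimes>\<^bsub>?U\<^esub> u = u \<otimes>\<^bsub>?U\<^esub> a [^]\<^bsub>?U\<^esub> k" if "u \<in> B" for u
        using that akC by (simp add: Usimps units_of_pow[OF aU] B_def)
    qed (use k fB n in auto)
    moreover have xx: "comm_by ?U a ?x = ?x \<otimes> inv (\<one> \<oplus> ofi R c \<otimes> (\<mu> \<otimes> y))"
      using comm_eq[OF BU[OF fB[of c]]] conj_f[of c] by simp
    moreover have "comm_by ?U a ?x \<in> Units R"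
      using U.comm_by_closed[of a ?x] aU BU[OF fB[of c]] by (simp add: Usimps)
    ultimately show ?thesis by (auto simp: torsion_def units_of_pow Usimps)
  qed
  then show ?thesis using tors by blast
qed

text \<open>Suppose \<open>a\<close> and \<open>y\<close> do not commute. Then every unit
  \<open>x\<close> that satisfies \<open>a x = \<mu> x a\<close> and commutes with
  \<open>\<mu>\<close> has finite order, and the characteristic is positive. The order of
  \<open>a\<close> is unknown, so this is used for \<open>y\<close> and for \<open>s = a y\<close>.
  Now \<open>y\<close> normalises the finite group formed by powers of \<open>\<mu>\<close> and
  \<open>s\<close>; it commutes with \<open>s\<close> by Wedderburn, and hence with
  \<open>a\<close>.\<close>

lemma engel_commutes:
  assumes engel: "left_engel (units_of R) a"
    and y: "y \<in> Units R" "a \<otimes> y = \<mu> \<otimes> y \<otimes> a"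
    and \<mu>: "\<mu> \<in> Units R" "a \<otimes> \<mu> = \<mu> \<otimes> a" "y \<otimes> \<mu> = \<mu> \<otimes> y"
  shows "a \<otimes> y = y \<otimes> a"
proof (rule ccontr)
  assume ne: "a \<otimes> y \<noteq> y \<otimes> a"
  have aU: "a \<in> Units R" using engel by (simp add: left_engel_def units_of_def)
  have c: "a \<in> carrier R" "y \<in> carrier R" "\<mu> \<in> carrier R" using aU y \<mu> by auto
  have \<mu>1: "\<mu> \<noteq> \<one>" using ne y c by auto
  have key: "torsion R \<mu> \<and> (\<exists>p. prime p \<and> ofi R (int p) = \<zero>) \<and> torsion R (inv x)"
    if x: "x \<in> Units R" "a \<otimes> x = \<mu> \<otimes> x \<otimes> a" "x \<otimes> \<mu> = \<mu> \<otimes> x" for x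
  proof -
    note E = engel_central_commutator[OF engel x(1,2) \<mu>(1,2) x(3) \<mu>1]
    have xc: "x \<in> carrier R" using x by simp
    have ax: "a \<otimes> x \<noteq> x \<otimes> a"
    proof
      assume "a \<otimes> x = x \<otimes> a"
      then have "\<mu> \<otimes> (x \<otimes> a) = \<one> \<otimes> (x \<otimes> a)" using x c xc by (simp add: m_assoc)
      then show False using rcancel[of "x \<otimes> a" \<mu> \<one>] Units_m_closed[OF x(1) aU] \<mu>1 c by (simp add: in_Units_iff)
    qed
    have conj: "\<one> \<oplus> ofi R n \<otimes> (\<mu> \<otimes> x) = a \<otimes> (\<one> \<oplus> ofi R n \<otimes> x) \<otimes> inv a" for n
    proof -
      have "\<mu> \<otimes> x = a \<otimes> x \<otimes> inv a" using x aU c xc by (simp add: m_assoc)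
      then show ?thesis using aU xc by (simp add: r_distr l_distr m_assoc ofi_lcomm[of a])
    qed
    \<comment> \<open>Here \<open>\<mu>\<close> plays the part of the periodic element; it commutes
      with \<open>inv x\<close>, so both exponents are 1.\<close>
    have "(\<exists>p. prime p \<and> ofi R (int p) = \<zero>) \<and> torsion R (inv x)"
    proof (rule torsion_family[where a = \<mu> and i = 1 and j = 1 and \<mu> = \<mu>])
      show "inv x \<otimes> \<mu> = \<mu> [^] (1::nat) \<otimes> inv x" using inv_commutes[OF x(1) c(3)] x(3) c by simp
      fix n :: nat
      show "\<one> \<oplus> ofi R (int n) \<otimes> (\<mu> \<otimes> inv (inv x)) \<in> Units R"
        using one_plus_multiple_Unit[OF c(1) xc ax] aU x(1) by (simp add: conj Units_inv_inv)
      show "torsion R ((\<one> \<oplus> ofi R (int n) \<otimes> inv (inv x)) \<otimes> inv (\<one> \<oplus> ofi R (int n) \<otimes> (\<mu> \<otimes> inv (inv x))))"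
        using E x(1) by (simp add: Units_inv_inv)
    qed (use E c x \<mu>1 in auto)
    then show ?thesis using E by blast
  qed
  have tor_inv: "torsion R x" if x: "x \<in> Units R" "torsion R (inv x)" for x
  proof -
    obtain n :: nat where n: "n > 0" "inv x [^] n = \<one>" using x by (auto simp: torsion_def)
    have "x [^] n \<otimes> inv x [^] n = \<one>" using pow_mult_distrib[of x "inv x" n] x by simp
    then show ?thesis using n x by (auto simp: torsion_def)
  qed
  obtain p where p: "prime p" "ofi R (int p) = \<zero>" and t\<mu>: "torsion R \<mu>" and ty: "torsion R y"
    using key[OF y \<mu>(3)] tor_inv[OF y(1)] by blast
  define s where "s = a \<otimes> y"
  have sU: "s \<in> Units R" unfolding s_def by (rule Units_m_closed[OF aU y(1)])
  have sc: "s \<in> carrier R" using sU by simp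
  have s\<mu>: "s \<otimes> \<mu> = \<mu> \<otimes> s" unfolding s_def using commute_mult[of a y \<mu>] c \<mu> by simp
  have "a \<otimes> s = \<mu> \<otimes> s \<otimes> a"
  proof -
    have "a \<otimes> s = a \<otimes> (\<mu> \<otimes> y \<otimes> a)" by (simp add: s_def y(2))
    also have "\<dots> = (a \<otimes> \<mu>) \<otimes> (y \<otimes> a)" using c by (simp add: m_assoc)
    also have "\<dots> = \<mu> \<otimes> s \<otimes> a" unfolding \<mu>(2) using c by (simp add: s_def m_assoc)
    finally show ?thesis .
  qed
  then have ts: "torsion R s" using key[OF sU _ s\<mu>] tor_inv[OF sU] by blast
  obtain k :: nat where k: "k > 0" "\<mu> [^] k = \<one>" using t\<mu> by (auto simp: torsion_def)
  obtain l :: nat where l: "l > 0" "s [^] l = \<one>" using ts by (auto simp: torsion_def)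
  define M where "M = range (\<lambda>(i::nat, j::nat). \<mu> [^] i \<otimes> s [^] j)"
  have "M \<subseteq> (\<lambda>(i::nat, j::nat). \<mu> [^] i \<otimes> s [^] j) ` ({..<k} \<times> {..<l})"
  proof
    fix x assume "x \<in> M"
    then obtain i j :: nat where "x = \<mu> [^] i \<otimes> s [^] j" by (auto simp: M_def)
    then have "x = (\<lambda>(i::nat, j::nat). \<mu> [^] i \<otimes> s [^] j) (i mod k, j mod l)"
      using pow_mod[OF c(3) k(2), of i] pow_mod[OF sc l(2), of j] by simp
    moreover have "(i mod k, j mod l) \<in> {..<k} \<times> {..<l}" using k l by simp
    ultimately show "x \<in> (\<lambda>(i::nat, j::nat). \<mu> [^] i \<otimes> s [^] j) ` ({..<k} \<times> {..<l})" by (rule image_eqI)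
  qed
  then have finM: "finite M" by (meson finite_SigmaI finite_imageI finite_lessThan finite_subset)
  have MI: "\<mu> [^] i \<otimes> s [^] j \<in> M" for i j :: nat by (auto simp: M_def)
  have s\<mu>p: "s [^] j \<otimes> \<mu> [^] i = \<mu> [^] i \<otimes> s [^] j" for i j :: nat
  proof -
    have "s [^] j \<otimes> \<mu> = \<mu> \<otimes> s [^] j"
    proof (induction j)
      case (Suc j)
      then show ?case using commute_mult[of "s [^] j" s \<mu>] sc c s\<mu> by simp
    qed (use c in simp)
    note base = this
    show ?thesis
    proof (induction i)
      case (Suc i)
      have "\<mu> [^] i \<otimes> \<mu> \<otimes> s [^] j = s [^] j \<otimes> (\<mu> [^] i \<otimes> \<mu>)"
        using commute_mult[of "\<mu> [^] i" \<mu> "s [^] j"] sc c Suc base by simp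
      then show ?case by simp
    qed (use sc in simp)
  qed
  have y\<mu>: "y \<otimes> \<mu> [^] i = \<mu> [^] i \<otimes> y" for i :: nat
  proof (induction i)
    case (Suc i)
    then show ?case using commute_mult[of "\<mu> [^] i" \<mu> y] c \<mu>(3) by simp
  qed (use c in simp)
  have \<nu>: "\<mu> [^] (k - 1) \<otimes> \<mu> = \<one>" using k by (cases k) auto
  \<comment> \<open>Conjugation by \<open>y\<close> takes \<open>s\<close> to
    \<open>\<mu>^-1 s\<close>, with \<open>\<mu>^-1\<close> written as
    \<open>\<mu> [^] (k - 1)\<close>.\<close>
  have ysj: "y \<otimes> s [^] j = (\<mu> [^] (k - 1)) [^] j \<otimes> s [^] j \<otimes> y" for j :: nat
  proof (induction j)
    case (Suc j)
    let ?\<nu> = "\<mu> [^] (k - 1)"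
    have ys: "y \<otimes> s = ?\<nu> \<otimes> s \<otimes> y"
    proof -
      have "?\<nu> \<otimes> s \<otimes> y = (?\<nu> \<otimes> \<mu>) \<otimes> (y \<otimes> a \<otimes> y)"
        unfolding s_def y(2) using c by (simp add: m_assoc)
      also have "\<dots> = y \<otimes> s" unfolding \<nu> using c by (simp add: s_def m_assoc)
      finally show ?thesis by (rule sym)
    qed
    have "y \<otimes> s [^] Suc j = (y \<otimes> s [^] j) \<otimes> s" using sc c by (simp add: m_assoc)
    also have "\<dots> = ?\<nu> [^] j \<otimes> s [^] j \<otimes> (y \<otimes> s)" unfolding Suc using sc c by (simp add: m_assoc)
    also have "\<dots> = ?\<nu> [^] j \<otimes> (s [^] j \<otimes> ?\<nu>) \<otimes> s \<otimes> y" unfolding ys using sc c by (simp add: m_assoc)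
    also have "\<dots> = ?\<nu> [^] Suc j \<otimes> s [^] Suc j \<otimes> y"
      unfolding s\<mu>p using sc c by (simp add: m_assoc)
    finally show ?case .
  qed (use c in simp)
  have "y \<otimes> s = s \<otimes> y"
  proof (rule torsion_normalizer_commutes[OF p(2,1) finM _ _ _ c(2) ty])
    show "M \<subseteq> carrier R" using sc c by (auto simp: M_def)
    show "\<one> \<in> M" using MI[of 0 0] by simp
    show "s \<in> M" using MI[of 0 1] sc by simp
    show "m \<otimes> n \<in> M" if mn: "m \<in> M" "n \<in> M" for m n
    proof -
      obtain i j i' j' :: nat where m: "m = \<mu> [^] i \<otimes> s [^] j" "n = \<mu> [^] i' \<otimes> s [^] j'"
        using mn by (auto simp: M_def)
      have "m \<otimes> n = \<mu> [^] i \<otimes> (s [^] j \<otimes> \<mu> [^] i') \<otimes> s [^] j'" using sc c by (simp add: m m_assoc)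
      also have "\<dots> = \<mu> [^] (i + i') \<otimes> s [^] (j + j')"
        unfolding s\<mu>p using sc c by (simp add: m_assoc flip: nat_pow_mult)
      finally show ?thesis using MI by simp
    qed
    show "\<exists>m'\<in>M. y \<otimes> m = m' \<otimes> y" if m: "m \<in> M" for m
    proof -
      obtain i j :: nat where ij: "m = \<mu> [^] i \<otimes> s [^] j" using m by (auto simp: M_def)
      have "y \<otimes> m = (y \<otimes> \<mu> [^] i) \<otimes> s [^] j" using sc c by (simp add: ij m_assoc)
      also have "\<dots> = \<mu> [^] i \<otimes> (y \<otimes> s [^] j)" unfolding y\<mu> using sc c by (simp add: m_assoc)
      also have "\<dots> = (\<mu> [^] (i + (k - 1) * j) \<otimes> s [^] j) \<otimes> y"
        unfolding ysj using sc c by (simp add: nat_pow_pow m_assoc flip: nat_pow_mult)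
      finally show ?thesis using MI by blast
    qed
  qed
  then have "(y \<otimes> a) \<otimes> y = (a \<otimes> y) \<otimes> y" using c by (simp add: s_def m_assoc)
  then show False using rcancel[of y] y(1) c ne by (simp add: in_Units_iff)
qed

end

subsection \<open>Ascendant subgroups of the multiplicative group\<close>

lemma (in group) comm_by_consistent:
  assumes "subgroup M G" "x \<in> M" "y \<in> M"
  shows "comm_by (G\<lparr>carrier := M\<rparr>) y x = comm_by G y x"
  using assms by (simp add: comm_by_def m_inv_consistent)

lemma (in group) comm_by_mem:
  assumes "subgroup M G" "x \<in> M" "y \<in> M"
  shows "comm_by G y x \<in> M"
  using assms by (simp add: comm_by_def subgroup.m_closed subgroup.m_inv_closed)

lemma (in group) comm_by_funpow_consistent:
  assumes "subgroup M G" "x \<in> M" "y \<in> M"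
  shows "(comm_by (G\<lparr>carrier := M\<rparr>) y ^^ n) x = (comm_by G y ^^ n) x \<and> (comm_by G y ^^ n) x \<in> M"
proof (induction n)
  case (Suc n)
  then show ?case using comm_by_consistent[OF assms(1) _ assms(3)] comm_by_mem[OF assms(1) _ assms(3)] by simp
qed (use assms in simp)

text \<open>An element of the derived subgroup involves finitely many commutators. The images of
  their entries generate a finite subgroup, and Schur's theorem applies to its preimage.\<close>

lemma (in group_hom) commutators_torsion_locally_finite:
  assumes lf: "locally_finite_group H"
    and central: "\<And>z x. z \<in> carrier G \<Longrightarrow> h z = \<one>\<^bsub>H\<^esub> \<Longrightarrow> x \<in> carrier G \<Longrightarrow> z \<otimes> x = x \<otimes> z"
    and c: "c \<in> generate G {comm_by G y x | x y. x \<in> carrier G \<and> y \<in> carrier G}"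
  shows "torsion G c"
proof -
  have "\<exists>S. finite S \<and> S \<subseteq> carrier G \<and> c \<in> generate G {comm_by G y x | x y. x \<in> S \<and> y \<in> S}"
    using c
  proof (induction rule: generate.induct)
    case one
    then show ?case by (intro exI[of _ "{}"]) (simp add: generate.one)
  next
    case (incl d)
    then obtain x y where "x \<in> carrier G" "y \<in> carrier G" "d = comm_by G y x" by auto
    then show ?case by (intro exI[of _ "{x, y}"]) (auto intro!: generate.incl)
  next
    case (inv d)
    then obtain x y where "x \<in> carrier G" "y \<in> carrier G" "d = comm_by G y x" by auto
    then show ?case by (intro exI[of _ "{x, y}"]) (auto intro!: generate.inv)
  next
    case (eng d d')
    then obtain S S' where S: "finite S" "S \<subseteq> carrier G" "d \<in> generate G {comm_by G y x | x y. x \<in> S \<and> y \<in> S}"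
      "finite S'" "S' \<subseteq> carrier G" "d' \<in> generate G {comm_by G y x | x y. x \<in> S' \<and> y \<in> S'}" by blast
    have "generate G {comm_by G y x | x y. x \<in> T \<and> y \<in> T}
        \<subseteq> generate G {comm_by G y x | x y. x \<in> S \<union> S' \<and> y \<in> S \<union> S'}" if "T \<subseteq> S \<union> S'" for T
      by (rule G.mono_generate) (use that in blast)
    from this[of S] this[of S'] S show ?case
      by (intro exI[of _ "S \<union> S'"]) (auto intro: generate.eng)
  qed
  then obtain S where S: "finite S" "S \<subseteq> carrier G"
    "c \<in> generate G {comm_by G y x | x y. x \<in> S \<and> y \<in> S}" by blast
  define B where "B = carrier (subgroup_generated H (h ` S))"
  have "finite (h ` S)" "h ` S \<subseteq> carrier H" using S by auto
  then have finB: "finite B" using lf by (auto simp: locally_finite_group_def B_def)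
  have sgB: "subgroup B H" unfolding B_def carrier_subgroup_generated
    by (rule H.generate_is_subgroup) auto
  have SB: "h ` S \<subseteq> B" unfolding B_def
    by (rule H.subgroup_generated_subset_carrier_subset) fact
  define M where "M = {x \<in> carrier G. h x \<in> B}"
  have sgM: "subgroup M G" unfolding M_def
  proof (rule G.subgroupI)
    show "{x \<in> carrier G. h x \<in> B} \<noteq> {}" using subgroup.one_closed[OF sgB] hom_one G.one_closed by force
  qed (use sgB in \<open>auto simp: subgroup.m_inv_closed subgroup.m_closed\<close>)
  have SM: "S \<subseteq> M" using S SB by (auto simp: M_def)
  have gM: "group (G\<lparr>carrier := M\<rparr>)" using sgM G.subgroup_imp_group by blast
  have "h \<in> hom (G\<lparr>carrier := M\<rparr>) H" by (auto simp: hom_def M_def)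
  then interpret M: group_hom "G\<lparr>carrier := M\<rparr>" H h
    using gM by (simp add: group_hom_def group_hom_axioms_def)
  have "c \<in> generate (G\<lparr>carrier := M\<rparr>) {comm_by (G\<lparr>carrier := M\<rparr>) y x | x y. x \<in> M \<and> y \<in> M}"
  proof -
    have eq: "{comm_by (G\<lparr>carrier := M\<rparr>) y x | x y. x \<in> M \<and> y \<in> M} = {comm_by G y x | x y. x \<in> M \<and> y \<in> M}"
      using G.comm_by_consistent[OF sgM] by metis
    have "generate (G\<lparr>carrier := M\<rparr>) {comm_by G y x | x y. x \<in> M \<and> y \<in> M}
      = generate G {comm_by G y x | x y. x \<in> M \<and> y \<in> M}"
      by (rule G.generate_consistent[OF _ sgM]) (use G.comm_by_mem[OF sgM] in auto)
    moreover have "generate G {comm_by G y x | x y. x \<in> S \<and> y \<in> S} \<subseteq> generate G {comm_by G y x | x y. x \<in> M \<and> y \<in> M}"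
      by (rule G.mono_generate) (use SM in blast)
    ultimately show ?thesis using S(3) unfolding eq by blast
  qed
  moreover have "finite (h ` M)" using finB by (rule finite_subset[rotated]) (auto simp: M_def)
  ultimately have "torsion (G\<lparr>carrier := M\<rparr>) c"
    using central by (intro M.commutators_torsion) (auto simp: M_def)
  then show ?thesis by (simp add: torsion_def flip: G.nat_pow_consistent)
qed

context skew_field
begin

text \<open>The normal closure of \<open>a\<close> under all units is still periodic, and it
  contains the commutators of \<open>a\<close> with all units.\<close>

lemma asc_torsion_central:
  assumes asc: "asc (units_of R) H (Units R)" and tor: "\<And>x. x \<in> H \<Longrightarrow> torsion (units_of R) x"
  shows "H \<subseteq> ring_center R"
proof
  fix a assume a: "a \<in> H"
  interpret U: group "units_of R" by (rule units_group)
  have Uc: "carrier (units_of R) = Units R" by (rule units_of_carrier)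
  have Um: "x \<otimes>\<^bsub>units_of R\<^esub> z = x \<otimes> z" for x z by (simp add: units_of_mult)
  have aU: "a \<in> Units R" using U.asc_subgroup[OF asc] a by blast
  have sgU: "subgroup (Units R) (units_of R)" using U.subgroup_self by (simp add: Uc)
  let ?N = "nclosure (units_of R) (Units R) a"
  have sgN: "subgroup ?N (units_of R)" using U.subgroup_nclosure[of "Units R" a] aU by (simp add: Uc)
  have tor_R: "torsion R x" if "torsion (units_of R) x" "x \<in> Units R" for x
    using that units_of_pow[OF that(2)] by (auto simp: torsion_def units_of_one)
  show "a \<in> ring_center R"
  proof (rule torsion_commutators_imp_central)
    show "a \<in> carrier R" using aU by simp
    show "torsion R a" using tor[OF a] tor_R aU by blast
    fix x assume x: "x \<in> Units R"
    have "x \<otimes>\<^bsub>units_of R\<^esub> a \<otimes>\<^bsub>units_of R\<^esub> inv\<^bsub>units_of R\<^esub> x \<otimes>\<^bsub>units_of R\<^esub> inv\<^bsub>units_of R\<^esub> a \<in> ?N"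
      using U.conj_mem_nclosure[OF x, of a] U.mem_nclosure[OF sgU, of a] aU sgN
      by (simp add: Uc subgroup.m_closed subgroup.m_inv_closed)
    then have "x \<otimes> a \<otimes> inv x \<otimes> inv a \<in> ?N" using x aU by (simp add: Um units_of_inv)
    then have "torsion (units_of R) (x \<otimes> a \<otimes> inv x \<otimes> inv a)"
      using U.asc_torsion_nclosure[OF asc a tor] by blast
    then show "torsion R (x \<otimes> a \<otimes> inv x \<otimes> inv a)" using tor_R x aU by simp
  qed
qed

text \<open>With \<open>\<mu>\<close> the commutator of \<open>a\<close> and \<open>b\<close> one
  has \<open>a b = \<mu> b a\<close>. In this form \<open>engel_commutes\<close> fits both
  \<open>asc_commutes_conj\<close> and the locally nilpotent case.\<close>

lemma engel_commutator_commutes: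
  assumes "left_engel (units_of R) a" "b \<in> Units R"
    and "comm_by (units_of R) b a \<otimes> a = a \<otimes> comm_by (units_of R) b a"
    and "comm_by (units_of R) b a \<otimes> b = b \<otimes> comm_by (units_of R) b a"
  shows "a \<otimes> b = b \<otimes> a"
proof -
  have aU: "a \<in> Units R" using assms(1) by (simp add: left_engel_def units_of_carrier)
  have z: "comm_by (units_of R) b a = a \<otimes> b \<otimes> inv a \<otimes> inv b"
    using assms(2) aU by (simp add: comm_by_def units_of_mult units_of_inv)
  then have zU: "comm_by (units_of R) b a \<in> Units R" using assms(2) aU by simp
  have "a \<otimes> b = comm_by (units_of R) b a \<otimes> b \<otimes> a"
    unfolding z using assms(2) aU by (simp add: unit_simps)
  then show ?thesis by (rule engel_commutes[OF assms(1,2) _ zU]) (use assms in simp_all)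
qed

lemma asc_engel:
  assumes asc: "asc (units_of R) H (Units R)" and a: "a \<in> H"
    and eng: "\<And>x. x \<in> H \<Longrightarrow> \<exists>n. (comm_by (units_of R) a ^^ n) x = \<one>"
  shows "left_engel (units_of R) a"
  unfolding left_engel_def
proof (intro conjI ballI)
  interpret U: group "units_of R" by (rule units_group)
  show "a \<in> carrier (units_of R)" using U.asc_subgroup[OF asc] a by (auto simp: units_of_carrier)
  fix x assume "x \<in> carrier (units_of R)"
  then obtain m where "(comm_by (units_of R) a ^^ m) x \<in> H"
    using U.comm_by_reaches_asc[OF asc a, of x] by (auto simp: units_of_carrier)
  then obtain n where "(comm_by (units_of R) a ^^ n) ((comm_by (units_of R) a ^^ m) x) = \<one>"
    using eng by blast
  then have "(comm_by (units_of R) a ^^ (n + m)) x = \<one>" by (simp add: funpow_add)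
  then show "\<exists>n. (comm_by (units_of R) a ^^ n) x = \<one>\<^bsub>units_of R\<^esub>" by (auto simp: units_of_one)
qed

text \<open>Elements of an abelian ascendant \<open>H\<close> are left Engel among all units, which
  provides the assumption \<open>central\<close> of \<open>asc_commutes_conj\<close>. So
  \<open>a\<close> commutes with its conjugates, and by translation any two conjugates
  commute.\<close>

lemma asc_abelian_central:
  assumes asc: "asc (units_of R) H (Units R)"
    and comm: "\<And>x y. x \<in> H \<Longrightarrow> y \<in> H \<Longrightarrow> x \<otimes> y = y \<otimes> x"
  shows "H \<subseteq> ring_center R"
proof
  fix a assume a: "a \<in> H"
  interpret U: group "units_of R" by (rule units_group)
  note Us = units_of_carrier units_of_mult units_of_one
  have HU: "H \<subseteq> Units R" using U.asc_subgroup[OF asc] by blast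
  have aU: "a \<in> Units R" using HU a by blast
  have engel: "left_engel (units_of R) a"
  proof (rule asc_engel[OF asc a])
    fix x assume x: "x \<in> H"
    then have "comm_by (units_of R) a x = \<one>"
      using U.comm_by_one_iff[of a x] comm[OF x a] HU aU by (auto simp: Us)
    then show "\<exists>n. (comm_by (units_of R) a ^^ n) x = \<one>" by (intro exI[of _ 1]) simp
  qed
  have "a \<otimes>\<^bsub>units_of R\<^esub> (g \<otimes>\<^bsub>units_of R\<^esub> a \<otimes>\<^bsub>units_of R\<^esub> inv\<^bsub>units_of R\<^esub> g) =
      (g \<otimes>\<^bsub>units_of R\<^esub> a \<otimes>\<^bsub>units_of R\<^esub> inv\<^bsub>units_of R\<^esub> g) \<otimes>\<^bsub>units_of R\<^esub> a" if "g \<in> Units R" for g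
    by (rule U.asc_commutes_conj[OF asc a _ _ that])
      (use comm engel_commutator_commutes[OF engel] in \<open>auto simp: Us\<close>)
  then have key: "a \<otimes> (g \<otimes> a \<otimes> inv g) = (g \<otimes> a \<otimes> inv g) \<otimes> a" if "g \<in> Units R" for g
    using that by (simp add: Us units_of_inv)
  show "a \<in> ring_center R"
  proof (rule conjugates_commute_imp_central)
    fix x z assume xz: "x \<in> Units R" "z \<in> Units R"
    let ?g = "inv x \<otimes> z"
    have gU: "?g \<in> Units R" using xz by simp
    have "(x \<otimes> a \<otimes> inv x) \<otimes> (z \<otimes> a \<otimes> inv z) = x \<otimes> (a \<otimes> (?g \<otimes> a \<otimes> inv ?g)) \<otimes> inv x"
      using xz aU by (simp add: unit_simps Units_inv_inv)
    also have "\<dots> = x \<otimes> ((?g \<otimes> a \<otimes> inv ?g) \<otimes> a) \<otimes> inv x" by (simp only: key[OF gU])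
    also have "\<dots> = (z \<otimes> a \<otimes> inv z) \<otimes> (x \<otimes> a \<otimes> inv x)"
      using xz aU by (simp add: unit_simps Units_inv_inv)
    finally show "(x \<otimes> a \<otimes> inv x) \<otimes> (z \<otimes> a \<otimes> inv z) = (z \<otimes> a \<otimes> inv z) \<otimes> (x \<otimes> a \<otimes> inv x)" .
  qed (use aU in simp)
qed

text \<open>A noncommuting pair would yield \<open>u\<close> and \<open>v\<close>, again not
  commuting, whose commutator commutes with both, although \<open>u\<close> is left Engel. Hence
  \<open>H\<close> is abelian.\<close>

lemma asc_engelian_central:
  assumes asc: "asc (units_of R) H (Units R)"
    and eng: "\<And>x y. x \<in> H \<Longrightarrow> y \<in> H \<Longrightarrow> \<exists>n. (comm_by (units_of R) y ^^ n) x = \<one>"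
    and nil: "\<And>x y. x \<in> H \<Longrightarrow> y \<in> H \<Longrightarrow> x \<otimes> y \<noteq> y \<otimes> x \<Longrightarrow> \<exists>u\<in>H. \<exists>v\<in>H. u \<otimes> v \<noteq> v \<otimes> u \<and>
      comm_by (units_of R) v u \<otimes> u = u \<otimes> comm_by (units_of R) v u \<and>
      comm_by (units_of R) v u \<otimes> v = v \<otimes> comm_by (units_of R) v u"
  shows "H \<subseteq> ring_center R"
proof (rule asc_abelian_central[OF asc], rule ccontr)
  interpret U: group "units_of R" by (rule units_group)
  fix x y assume "x \<in> H" "y \<in> H" "x \<otimes> y \<noteq> y \<otimes> x"
  then obtain u v where uv: "u \<in> H" "v \<in> H" "u \<otimes> v \<noteq> v \<otimes> u"
      "comm_by (units_of R) v u \<otimes> u = u \<otimes> comm_by (units_of R) v u"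
      "comm_by (units_of R) v u \<otimes> v = v \<otimes> comm_by (units_of R) v u" using nil by blast
  have "left_engel (units_of R) u" using asc_engel[OF asc uv(1)] eng uv(1) by blast
  moreover have "v \<in> Units R" using U.asc_subgroup[OF asc] uv(2) by blast
  ultimately show False using engel_commutator_commutes uv by blast
qed

text \<open>The derived subgroup is normal in \<open>H\<close>, hence itself ascendant, and being
  periodic it is central. So \<open>H\<close> has class at most 2, and a noncommuting pair already
  has a commutator commuting with both.\<close>

lemma asc_derived_torsion_central:
  assumes asc: "asc (units_of R) H (Units R)"
    and tor: "\<And>c. c \<in> generate (units_of R) {comm_by (units_of R) y x | x y. x \<in> H \<and> y \<in> H} \<Longrightarrow>
      torsion (units_of R) c"
  shows "H \<subseteq> ring_center R"
proof -
  interpret U: group "units_of R" by (rule units_group)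
  note Us = units_of_carrier units_of_mult units_of_one
  let ?S = "{comm_by (units_of R) y x | x y. x \<in> H \<and> y \<in> H}"
  let ?D = "generate (units_of R) ?S"
  have sgH: "subgroup H (units_of R)" using U.asc_subgroup_base[OF asc] .
  have HU: "H \<subseteq> Units R" using U.asc_subgroup[OF asc] by blast
  have SH: "?S \<subseteq> H" using U.comm_by_mem[OF sgH] by blast
  have DH: "?D \<subseteq> H" using U.generate_subgroup_incl[OF SH sgH] .
  have sgD: "subgroup ?D (units_of R)" by (rule U.generate_is_subgroup) (use SH HU in \<open>auto simp: Us\<close>)
  have "conj_closed (units_of R) H ?D"
    unfolding conj_closed_def
  proof (intro ballI)
    fix g k assume gk: "g \<in> H" "k \<in> ?D"
    then have kH: "k \<in> H" using DH by blast
    have "comm_by (units_of R) k g \<in> ?D" using gk kH by (intro generate.incl) blast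
    then have "comm_by (units_of R) k g \<otimes>\<^bsub>units_of R\<^esub> k \<in> ?D" using gk by (intro generate.eng)
    moreover have "g \<in> carrier (units_of R)" "k \<in> carrier (units_of R)" using gk(1) kH HU by (auto simp: Us)
    then have "comm_by (units_of R) k g \<otimes>\<^bsub>units_of R\<^esub> k = g \<otimes>\<^bsub>units_of R\<^esub> k \<otimes>\<^bsub>units_of R\<^esub> inv\<^bsub>units_of R\<^esub> g"
      by (simp add: comm_by_def U.word_simps)
    ultimately show "g \<otimes>\<^bsub>units_of R\<^esub> k \<otimes>\<^bsub>units_of R\<^esub> inv\<^bsub>units_of R\<^esub> g \<in> ?D" by simp
  qed
  then have "asc (units_of R) ?D H" using asc.step[OF asc.refl[OF sgD] sgH DH] by blast
  then have "asc (units_of R) ?D (Units R)" using U.asc_trans[OF asc] by blast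
  then have "?D \<subseteq> ring_center R" using asc_torsion_central tor by blast
  then have central: "comm_by (units_of R) y x \<in> ring_center R" if "x \<in> H" "y \<in> H" for x y
  proof -
    have "comm_by (units_of R) y x \<in> ?D" using that by (intro generate.incl) blast
    then show ?thesis using \<open>?D \<subseteq> ring_center R\<close> by blast
  qed
  have cc: "comm_by (units_of R) y x \<otimes> w = w \<otimes> comm_by (units_of R) y x" if "x \<in> H" "y \<in> H" "w \<in> H" for x y w
    using central[OF that(1,2)] that(3) HU by (auto simp: ring_center_def)
  show ?thesis
  proof (rule asc_engelian_central[OF asc])
    fix x y assume xy: "x \<in> H" "y \<in> H"
    have "comm_by (units_of R) y x \<in> Units R" "y \<in> Units R"
      using U.comm_by_mem[OF sgH] xy HU by blast+
    then have "comm_by (units_of R) y (comm_by (units_of R) y x) = \<one>"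
      using U.comm_by_one_iff[of y "comm_by (units_of R) y x"] cc[OF xy xy(2)] by (simp add: Us)
    then show "\<exists>n. (comm_by (units_of R) y ^^ n) x = \<one>"
      by (intro exI[of _ 2]) (simp add: numeral_2_eq_2)
  qed (use cc in blast)
qed

text \<open>One factor of the series: \<open>H\<close> is the preimage of a term, \<open>Q\<close>
  the factor below it, and \<open>ker\<close> is the induction hypothesis for the preceding
  term.\<close>

lemma generalized_radical_step:
  assumes asc: "asc (units_of R) H (Units R)" and hom: "group_hom (units_of R\<lparr>carrier := H\<rparr>) Q f"
    and Q: "locally_nilpotent_group Q \<or> locally_finite_group Q"
    and ker: "\<And>z. z \<in> H \<Longrightarrow> f z = \<one>\<^bsub>Q\<^esub> \<Longrightarrow> z \<in> ring_center R"
  shows "H \<subseteq> ring_center R"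
proof -
  interpret U: group "units_of R" by (rule units_group)
  let ?H = "units_of R\<lparr>carrier := H\<rparr>"
  interpret f: group_hom ?H Q f by (rule hom)
  have sgH: "subgroup H (units_of R)" and HU: "H \<subseteq> Units R"
    using U.asc_subgroup_base[OF asc] U.asc_subgroup[OF asc] by blast+
  have central: "z \<otimes>\<^bsub>?H\<^esub> x = x \<otimes>\<^bsub>?H\<^esub> z" if "z \<in> carrier ?H" "f z = \<one>\<^bsub>Q\<^esub>" "x \<in> carrier ?H" for z x
    using ker[of z] that HU by (auto simp: units_of_mult ring_center_def)
  have con: "comm_by ?H y x = comm_by (units_of R) y x" if "x \<in> H" "y \<in> H" for x y
    using U.comm_by_consistent[OF sgH] that by simp
  from Q show ?thesis
  proof
    assume nil: "locally_nilpotent_group Q"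
    show ?thesis
    proof (rule asc_engelian_central[OF asc])
      fix x y assume xy: "x \<in> H" "y \<in> H"
      then have xy': "x \<in> carrier ?H" "y \<in> carrier ?H" by auto
      note N = f.nilpotent_kernel_central[OF nil central xy', simplified]
      from N(1) obtain n where "(comm_by ?H y ^^ n) x = \<one>\<^bsub>units_of R\<^esub>" by auto
      then show "\<exists>n. (comm_by (units_of R) y ^^ n) x = \<one>"
        using U.comm_by_funpow_consistent[OF sgH xy, of n] by (auto simp: units_of_one)
      assume "x \<otimes> y \<noteq> y \<otimes> x"
      then obtain u v where uv: "u \<in> H" "v \<in> H" "u \<otimes> v \<noteq> v \<otimes> u"
          "comm_by ?H v u \<otimes> u = u \<otimes> comm_by ?H v u" "comm_by ?H v u \<otimes> v = v \<otimes> comm_by ?H v u"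
        using N(2) by (auto simp: units_of_mult)
      then show "\<exists>u\<in>H. \<exists>v\<in>H. u \<otimes> v \<noteq> v \<otimes> u \<and>
          comm_by (units_of R) v u \<otimes> u = u \<otimes> comm_by (units_of R) v u \<and>
          comm_by (units_of R) v u \<otimes> v = v \<otimes> comm_by (units_of R) v u"
        by (intro bexI[of _ u] bexI[of _ v]) (simp_all add: con)
    qed
  next
    assume lf: "locally_finite_group Q"
    show ?thesis
    proof (rule asc_derived_torsion_central[OF asc])
      fix c assume c: "c \<in> generate (units_of R) {comm_by (units_of R) y x | x y. x \<in> H \<and> y \<in> H}"
      have eq: "{comm_by ?H y x | x y. x \<in> H \<and> y \<in> H} = {comm_by (units_of R) y x | x y. x \<in> H \<and> y \<in> H}"
      proof (intro equalityI subsetI)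
        fix d assume "d \<in> {comm_by ?H y x | x y. x \<in> H \<and> y \<in> H}"
        then obtain x y where "x \<in> H" "y \<in> H" "d = comm_by ?H y x" by blast
        then show "d \<in> {comm_by (units_of R) y x | x y. x \<in> H \<and> y \<in> H}" using con[of x y] by blast
      next
        fix d assume "d \<in> {comm_by (units_of R) y x | x y. x \<in> H \<and> y \<in> H}"
        then obtain x y where "x \<in> H" "y \<in> H" "d = comm_by (units_of R) y x" by blast
        then show "d \<in> {comm_by ?H y x | x y. x \<in> H \<and> y \<in> H}" using con[of x y, symmetric] by blast
      qed
      have "generate ?H {comm_by (units_of R) y x | x y. x \<in> H \<and> y \<in> H}
          = generate (units_of R) {comm_by (units_of R) y x | x y. x \<in> H \<and> y \<in> H}"
        by (rule U.generate_consistent[OF _ sgH]) (use U.comm_by_mem[OF sgH] in auto)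
      then have "c \<in> generate ?H {comm_by ?H y x | x y. x \<in> carrier ?H \<and> y \<in> carrier ?H}"
        using c eq by simp
      then have "torsion ?H c" using f.commutators_torsion_locally_finite[OF lf central] by blast
      then show "torsion (units_of R) c" by (simp add: torsion_def flip: U.nat_pow_consistent)
    qed
  qed
qed

end

theorem theorem4p7:
  fixes D :: "('a, 'b) ring_scheme" and G :: "'a set"
  assumes "skew_field D"
    and "ascendant TYPE('i) G (units_of D)"
    and "periodic_by_generalized_radical TYPE('j) ((units_of D)\<lparr>carrier := G\<rparr>)"
  shows "G \<subseteq> ring_center D"
proof -
  interpret skew_field D by fact
  interpret U: group "units_of D" by (rule units_group)
  obtain r' :: "'i rel" and F' where ser': "ascending_series r' F' G (units_of D)"
    using assms(2) by (auto simp: ascendant_def)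
  obtain \<zeta> \<gamma> where "\<gamma> \<in> Field r'" "(\<zeta>, \<gamma>) \<in> r'" "F' \<zeta> = G" "F' \<gamma> = carrier (units_of D)"
    using ser' by (auto simp: ascending_series_def)
  then have ascG: "asc (units_of D) G (Units D)"
    using U.ascending_series_asc[OF ser', of \<zeta> \<gamma>] by (simp add: units_of_carrier)
  have sgG: "subgroup G (units_of D)" using U.asc_subgroup_base[OF ascG] .
  let ?G = "(units_of D)\<lparr>carrier := G\<rparr>"
  obtain N where N: "N \<lhd> ?G" "periodic_group (?G\<lparr>carrier := N\<rparr>)" and
    rad: "generalized_radical TYPE('j) (?G Mod N)"
    using assms(3) by (auto simp: periodic_by_generalized_radical_def)
  interpret N: normal N ?G by (rule N(1))
  let ?Q = "?G Mod N"
  interpret Q: group ?Q by (rule N.factorgroup_is_group)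
  let ?\<pi> = "\<lambda>x. N #>\<^bsub>?G\<^esub> x"
  interpret \<pi>: group_hom ?G ?Q ?\<pi>
    using N.r_coset_hom_Mod by unfold_locales
  obtain r :: "'j rel" and F where ser: "ascending_series r F {\<one>\<^bsub>?Q\<^esub>} ?Q" and
    fac: "\<And>\<alpha> \<beta>. immediate_succ r \<alpha> \<beta> \<Longrightarrow> locally_nilpotent_group (?Q\<lparr>carrier := F \<beta>\<rparr> Mod F \<alpha>) \<or>
      locally_finite_group (?Q\<lparr>carrier := F \<beta>\<rparr> Mod F \<alpha>)"
    using rad by (auto simp: generalized_radical_def)
  \<comment> \<open>The preimages are ascendant among the units because the series of the quotient,
    pulled back to \<open>G\<close>, is continued by the given series above
    \<open>G\<close>.\<close>
  define pre where "pre A = {x \<in> G. ?\<pi> x \<in> A}" for A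
  have asc_pre: "asc (units_of D) (pre A) (Units D)" if "asc ?Q A (carrier ?Q)" for A
  proof -
    have "asc ?G (pre A) (pre (carrier ?Q))"
      using \<pi>.asc_vimage[OF that] by (simp add: pre_def)
    moreover have "pre (carrier ?Q) = G" using \<pi>.hom_closed by (auto simp: pre_def)
    ultimately have "asc (units_of D) (pre A) G" using U.asc_consistent[OF sgG] by simp
    then show ?thesis using U.asc_trans[OF ascG] by blast
  qed
  obtain \<gamma>' where \<gamma>': "\<gamma>' \<in> Field r" "\<And>\<alpha>. \<alpha> \<in> Field r \<Longrightarrow> (\<alpha>, \<gamma>') \<in> r" "F \<gamma>' = carrier ?Q"
    using ser by (auto simp: ascending_series_def)
  have ascF: "asc ?Q (F \<alpha>) (carrier ?Q)" if "\<alpha> \<in> Field r" for \<alpha>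
    using Q.ascending_series_asc[OF ser \<gamma>'(2)[OF that]] \<gamma>'(3) by simp
  have "pre (carrier ?Q) \<subseteq> ring_center D"
  proof (rule Q.ascending_series_induct[OF ser, where P = "\<lambda>A. pre A \<subseteq> ring_center D"])
    obtain \<zeta>' where \<zeta>': "\<zeta>' \<in> Field r" "F \<zeta>' = {\<one>\<^bsub>?Q\<^esub>}" using ser by (auto simp: ascending_series_def)
    have "asc (units_of D) (pre {\<one>\<^bsub>?Q\<^esub>}) (Units D)" using asc_pre ascF \<zeta>' by metis
    \<comment> \<open>The preimage of the trivial subgroup is the periodic group
      \<open>N\<close>.\<close>
    moreover have "torsion (units_of D) x" if "x \<in> pre {\<one>\<^bsub>?Q\<^esub>}" for x
    proof -
      have x: "x \<in> G" "?\<pi> x = N" using that by (auto simp: pre_def)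
      then have "x \<in> N" using N.rcos_self[OF _ normal_imp_subgroup[OF N(1)], of x] by simp
      then obtain n :: nat where "n > 0" "x [^]\<^bsub>?G\<lparr>carrier := N\<rparr>\<^esub> n = \<one>\<^bsub>?G\<lparr>carrier := N\<rparr>\<^esub>"
        using N(2) by (auto simp: periodic_group_def)
      then show ?thesis by (auto simp: torsion_def simp flip: U.nat_pow_consistent)
    qed
    ultimately show "pre {\<one>\<^bsub>?Q\<^esub>} \<subseteq> ring_center D" by (rule asc_torsion_central)
  next
    fix \<alpha> \<beta> assume succ: "immediate_succ r \<alpha> \<beta>" and \<beta>: "\<beta> \<in> Field r" and IH: "pre (F \<alpha>) \<subseteq> ring_center D"
    have sgF: "subgroup (F \<beta>) ?Q" using ser \<beta> by (auto simp: ascending_series_def)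
    have nrm: "F \<alpha> \<lhd> ?Q\<lparr>carrier := F \<beta>\<rparr>" using ser succ by (auto simp: ascending_series_def)
    interpret A: normal "F \<alpha>" "?Q\<lparr>carrier := F \<beta>\<rparr>" by (rule nrm)
    let ?K = "?Q\<lparr>carrier := F \<beta>\<rparr> Mod F \<alpha>"
    \<comment> \<open>The composite of two quotient maps; its kernel on
      \<open>pre (F \<beta>)\<close> lies in \<open>pre (F \<alpha>)\<close>, which is central by
      induction.\<close>
    let ?f = "\<lambda>x. F \<alpha> #>\<^bsub>?Q\<lparr>carrier := F \<beta>\<rparr>\<^esub> ?\<pi> x"
    have ascB: "asc (units_of D) (pre (F \<beta>)) (Units D)" using asc_pre ascF \<beta> by blast
    have sgB: "subgroup (pre (F \<beta>)) (units_of D)" using U.asc_subgroup_base[OF ascB] .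
    have "?f \<in> hom (units_of D\<lparr>carrier := pre (F \<beta>)\<rparr>) ?K"
    proof (rule homI)
      fix x y assume "x \<in> carrier (units_of D\<lparr>carrier := pre (F \<beta>)\<rparr>)" "y \<in> carrier (units_of D\<lparr>carrier := pre (F \<beta>)\<rparr>)"
      then have xy: "x \<in> G" "?\<pi> x \<in> F \<beta>" "y \<in> G" "?\<pi> y \<in> F \<beta>" by (auto simp: pre_def)
      show "?f x \<in> carrier ?K" using xy by (auto simp: FactGroup_def RCOSETS_def)
      have "?\<pi> (x \<otimes>\<^bsub>units_of D\<^esub> y) = ?\<pi> x \<otimes>\<^bsub>?Q\<^esub> ?\<pi> y" using \<pi>.hom_mult[of x y] xy by simp
      then show "?f (x \<otimes>\<^bsub>units_of D\<lparr>carrier := pre (F \<beta>)\<rparr>\<^esub> y) = ?f x \<otimes>\<^bsub>?K\<^esub> ?f y"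
        using hom_mult[OF A.r_coset_hom_Mod, of "?\<pi> x" "?\<pi> y"] xy by simp
    qed
    then have "group_hom (units_of D\<lparr>carrier := pre (F \<beta>)\<rparr>) ?K ?f"
      using U.subgroup_imp_group[OF sgB] A.factorgroup_is_group
      by (simp add: group_hom_def group_hom_axioms_def)
    then show "pre (F \<beta>) \<subseteq> ring_center D"
    proof (rule generalized_radical_step[OF ascB _ fac[OF succ]])
      fix z assume z: "z \<in> pre (F \<beta>)" "?f z = \<one>\<^bsub>?K\<^esub>"
      then have "?\<pi> z \<in> F \<alpha>" using A.rcos_self[OF _ normal_imp_subgroup[OF nrm], of "?\<pi> z"] by (simp add: pre_def FactGroup_def)
      then show "z \<in> ring_center D" using IH z by (auto simp: pre_def)
    qed
  next
    fix \<C> assume "\<And>K. K \<in> \<C> \<Longrightarrow> pre K \<subseteq> ring_center D"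
    then show "pre (\<Union>\<C>) \<subseteq> ring_center D" by (auto simp: pre_def)
  qed
  moreover have "pre (carrier ?Q) = G" using \<pi>.hom_closed by (auto simp: pre_def)
  ultimately show ?thesis by simp
qed

end
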